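(* As $k\to\infty$, where $r=r(k)\ge1$ may either stay fixed or vary with $k$, \[ \mathsf{tr}(k,r)=\frac{\big(2^r(r+1)\big)^k}{16\sqrt\pi\,\big(r(r+5)/6\big)^{3/2}k^{3/2}}\big(1+o(1)\big). \]
   Context: For integers $k\ge 3$, $r\ge 1$, let $\mathrm{SC}(k,r)$ be a convex $k$-gon in the plane each of whose sides is subdivided by $r-1$ additional points lying on that side ($kr$ points in total). A triangulation of a finite planar point set is a maximal dissection of its convex hull into triangles by non-crossing segments between points of the set (no point lying in the interior of a triangle side). $\mathsf{tr}(k,r)$ is the number of triangulations of $\mathrm{SC}(k,r)$. *)

theory Defs
  imports "HOL-Analysis.Analysis" "HOL-Library.Landau_Symbols"
begin

section \<open>Triangulations of a planar point set\<close>

text \<open>A segment that passes through a further point of the set is not admitted: otherwise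
  that point would lie in the interior of a triangle side.\<close>

definition segments_of :: "(real^2) set \<Rightarrow> (real^2) set set" where
  "segments_of S =
     {closed_segment a b | a b. a \<in> S \<and> b \<in> S \<and> a \<noteq> b \<and> open_segment a b \<inter> S = {}}"

definition noncrossing :: "(real^2) set set \<Rightarrow> bool" where
  "noncrossing E \<longleftrightarrow> pairwise (\<lambda>e f. rel_interior e \<inter> rel_interior f = {}) E"

text \<open>A dissection is represented by its set \<open>E\<close> of segments (the sides on the boundary of the
  convex hull included); \<open>\<T>\<close> is the collection of the triangles that they cut out.\<close>

definition triangle_dissection :: "(real^2) set \<Rightarrow> (real^2) set set \<Rightarrow> bool" where
  "triangle_dissection S E \<longleftrightarrow>
     E \<subseteq> segments_of S \<and> noncrossing E \<and>
     (\<exists>\<T>. (\<forall>T\<in>\<T>. 2 simplex T) \<and>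
          pairwise (\<lambda>T U. interior T \<inter> interior U = {}) \<T> \<and>
          \<Union>\<T> = convex hull S \<and>
          E = {e. \<exists>T\<in>\<T>. e edge_of T})"

definition triangulations_of :: "(real^2) set \<Rightarrow> (real^2) set set set" where
  "triangulations_of S =
     {E. triangle_dissection S E \<and> (\<forall>E'. triangle_dissection S E' \<and> E \<subseteq> E' \<longrightarrow> E' = E)}"

definition num_triangulations :: "(real^2) set \<Rightarrow> nat" where
  "num_triangulations S = card (triangulations_of S)"


section \<open>Subdivided convex polygons\<close>

text \<open>The points \<open>v 0, \<dots>, v (k - 1)\<close> are, in cyclic order (either orientation), the vertices of a
  convex \<open>k\<close>-gon. Since an end point of an edge of a convex set is an extreme point of it, all
  \<open>k\<close> points are proper corners, and no three of them are collinear. Meaningful for \<open>k \<ge> 3\<close>.\<close>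

definition convex_polygon :: "nat \<Rightarrow> (nat \<Rightarrow> real^2) \<Rightarrow> bool" where
  "convex_polygon k v \<longleftrightarrow>
     inj_on v {..<k} \<and>
     (\<forall>i<k. closed_segment (v i) (v (Suc i mod k)) edge_of (convex hull (v ` {..<k})))"

text \<open>The configurations \<open>SC(k,r)\<close>: all point sets consisting of the vertices of a convex
  \<open>k\<close>-gon and of \<open>r - 1\<close> points \<open>X i\<close> inside each of its sides (for \<open>k \<ge> 3\<close>, \<open>r \<ge> 1\<close>).\<close>

definition SC :: "nat \<Rightarrow> nat \<Rightarrow> (real^2) set set" where
  "SC k r =
     {S. \<exists>v X. convex_polygon k v \<and>
          (\<forall>i<k. X i \<subseteq> open_segment (v i) (v (Suc i mod k)) \<and> finite (X i) \<and> card (X i) = r - 1) \<and>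
          S = v ` {..<k} \<union> (\<Union>i<k. X i)}"

text \<open>Such configurations exist, for instance with the vertices on a parabola.\<close>

lemma closed_segment_edge_of_hull:
  fixes V :: "(real^2) set"
  assumes "finite V" "p \<in> V" "q \<in> V" "p \<noteq> q"
    and ge: "\<And>x. x \<in> V \<Longrightarrow> a \<bullet> x \<ge> c"
    and eq: "\<And>x. x \<in> V \<Longrightarrow> a \<bullet> x = c \<longleftrightarrow> x = p \<or> x = q"
  shows "closed_segment p q edge_of (convex hull V)"
proof -
  let ?F = "(convex hull V) \<inter> {x. a \<bullet> x = c}"
  have sub: "convex hull V \<subseteq> {x. a \<bullet> x \<ge> c}"
    by (intro hull_minimal) (auto simp: ge convex_halfspace_ge)
  have F: "?F face_of (convex hull V)"
    using sub by (intro face_of_Int_supporting_hyperplane_ge) auto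
  then obtain W where W: "W \<subseteq> V" "?F = convex hull W"
    using face_of_convex_hull_subset assms(1) finite_imp_compact by metis
  have "W \<subseteq> ?F" using W hull_subset by metis
  then have "W \<subseteq> {p, q}" using W(1) eq by auto
  then have "?F \<subseteq> closed_segment p q"
    unfolding W(2) segment_convex_hull by (rule hull_mono)
  moreover have "closed_segment p q \<subseteq> ?F"
    unfolding segment_convex_hull
  proof (rule hull_minimal)
    show "{p, q} \<subseteq> ?F" using assms(2,3) eq by (auto intro: hull_inc)
    show "convex ?F" by (simp add: convex_Int convex_hyperplane)
  qed
  ultimately have "closed_segment p q face_of (convex hull V)" using F by auto
  moreover have "aff_dim (closed_segment p q) = 1"
    using \<open>p \<noteq> q\<close> by (simp add: segment_convex_hull aff_dim_convex_hull aff_dim_2)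
  ultimately show ?thesis by (simp add: edge_of_def)
qed

lemma SC_nonempty:
  assumes "k \<ge> 3"
  shows "SC k r \<noteq> {}"
proof -
  define v :: "nat \<Rightarrow> real^2" where "v i = vector [real i, (real i)\<^sup>2]" for i
  have inj: "v i = v j \<longleftrightarrow> i = j" for i j
    by (auto simp: v_def vec_eq_iff forall_2)
  have inner: "(vector [x, y] :: real^2) \<bullet> v j = x * real j + y * (real j)\<^sup>2" for x y j
    by (simp add: v_def inner_vec_def sum_2)
  have "closed_segment (v i) (v (Suc i mod k)) edge_of (convex hull (v ` {..<k}))"
    if i: "i < k" for i
  proof (cases "Suc i = k")
    case False
    with i have S: "Suc i mod k = Suc i" "Suc i < k" by auto
    have key: "vector [- (2 * real i + 1), 1] \<bullet> v j - (- (real i * (real i + 1)))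
        = (real j - real i) * (real j - real (Suc i))" for j
      by (simp add: inner algebra_simps power2_eq_square)
    have nonneg: "(real j - real i) * (real j - real (Suc i)) \<ge> 0" for j
      by (cases "j \<le> i") (auto intro: mult_nonneg_nonneg mult_nonpos_nonpos)
    show ?thesis unfolding S(1)
    proof (rule closed_segment_edge_of_hull)
      fix x assume "x \<in> v ` {..<k}"
      then obtain j where j: "x = v j" by auto
      show "vector [- (2 * real i + 1), 1] \<bullet> x \<ge> - (real i * (real i + 1))"
        unfolding j using key[of j] nonneg[of j] by linarith
      have "vector [- (2 * real i + 1), 1] \<bullet> x = - (real i * (real i + 1))
          \<longleftrightarrow> (real j - real i) * (real j - real (Suc i)) = 0"
        unfolding j using key[of j] by linarith
      also have "\<dots> \<longleftrightarrow> x = v i \<or> x = v (Suc i)"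
        by (auto simp: j inj)
      finally show "vector [- (2 * real i + 1), 1] \<bullet> x = - (real i * (real i + 1))
          \<longleftrightarrow> x = v i \<or> x = v (Suc i)" .
    qed (use i S inj in auto)
  next
    case True
    then have S: "Suc i mod k = 0" by simp
    have key: "vector [real i, - 1] \<bullet> v j = real j * (real i - real j)" for j
      by (simp add: inner algebra_simps power2_eq_square)
    show ?thesis unfolding S
    proof (rule closed_segment_edge_of_hull)
      fix x assume "x \<in> v ` {..<k}"
      then obtain j where j: "x = v j" "j \<le> i" using True by auto
      show "vector [real i, - 1] \<bullet> x \<ge> 0" using j by (simp add: key)
      show "vector [real i, - 1] \<bullet> x = 0 \<longleftrightarrow> x = v i \<or> x = v 0"
        using j by (auto simp: key inj)
    qed (use i True assms inj in auto)
  qed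
  then have poly: "convex_polygon k v"
    by (auto simp: convex_polygon_def inj_on_def inj)
  have "\<exists>Y. Y \<subseteq> open_segment (v i) (v (Suc i mod k)) \<and> finite Y \<and> card Y = r - 1"
    if "i < k" for i
  proof -
    have "Suc i mod k \<noteq> i" using that assms by (cases "Suc i = k") auto
    then have "v i \<noteq> v (Suc i mod k)" by (simp add: inj)
    then have "infinite (open_segment (v i) (v (Suc i mod k)))"
      by (simp add: finite_open_segment)
    then show ?thesis using infinite_arbitrarily_large by metis
  qed
  then obtain X where X: "\<And>i. i < k \<Longrightarrow> X i \<subseteq> open_segment (v i) (v (Suc i mod k)) \<and>
      finite (X i) \<and> card (X i) = r - 1" by metis
  then have "v ` {..<k} \<union> (\<Union>i<k. X i) \<in> SC k r"
    using poly unfolding SC_def by blast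
  then show ?thesis by blast
qed

end

theory Submission
  imports Defs "HOL-Probability.Probability" "HOL-Real_Asymp.Real_Asymp"
begin

text \<open>The triangle on a fixed base edge cuts a triangulation into two smaller ones, which gives
  the Catalan recursion with the apexes on the line of the base excluded. Let \<open>P\<^sub>0 = 1\<close>,
  \<open>P\<^sub>1 = x\<close>, \<open>P\<^sub>r\<^sub>+\<^sub>1 = x (P\<^sub>r - P\<^sub>r\<^sub>-\<^sub>1)\<close>, and let \<open>L\<close> be the linear functional that maps
  \<open>x ^ (n + 2)\<close> to the \<open>n\<close>-th Catalan number. Since \<open>(x - y) (\<Sum>m<r. P\<^sub>m(x) P\<^sub>r\<^sub>-\<^sub>m(y)) = y (P\<^sub>r(x) - P\<^sub>r(y))\<close>,
  an identity that is compatible with products, the recursion is solved by applying \<open>L\<close> to the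
  product of the \<open>P\<^sub>r\<close> over all sides; hence \<open>tr(k,r) = L(P\<^sub>r ^ k)\<close>.

  Write \<open>L\<close> as an integral and substitute \<open>x = 4 cos\<^sup>2 \<theta>\<close>. Then \<open>P\<^sub>r = (2 cos \<theta>) ^ r sin ((r + 1) \<theta>) / sin \<theta>\<close>,
  whose logarithm is \<open>ln (2 ^ r (r + 1)) - \<sigma> \<theta>\<^sup>2 + \<dots>\<close> with \<open>\<sigma> = r (r + 5) / 6\<close>. The scaling
  \<open>\<theta> = u / \<surd>(\<sigma> k)\<close> and dominated convergence give the asymptotics uniformly in \<open>r\<close>; the dominating
  function comes from \<open>\<bar>sin (m \<theta>) / (m sin \<theta>)\<bar> \<le> (1 + m\<^sup>2 \<theta>\<^sup>2 / 4) powr (-1/2)\<close>.\<close>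

section \<open>Orientation in the plane\<close>

text \<open>The geometric obstacle is that \<open>triangulations_of\<close> speaks of arbitrary sets
  of segments and triangles in the plane. All geometry is therefore reduced to signs of
  \<open>orient\<close> and to betweenness on a side, stated for indices; both directions (cutting
  yields a dissection, every dissection arises by cutting) rest on these. Maximality is automatic:
  all dissections of one chain have the same number of segments, so inclusion implies equality. Why
  a product over the sides: a chord that is cut off acts as one more side of length 1, whose
  polynomial is \<open>x\<close>. Why \<open>4 cos\<^sup>2\<close>: the Catalan numbers are the even
  moments of the semicircle law, and the shift by two in \<open>L\<close> becomes a division by
  \<open>x\<^sup>2\<close> under the integral; at angle 0 this \<open>x\<^sup>2\<close> is the 16 of
  the formula. Uniformity in \<open>r\<close> rests on one comparison,
  \<open>3 * \<sigma> r \<le> (r + 1)\<^sup>2 \<le> 6 * \<sigma> r\<close>: the right half sends the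
  inner angle \<open>(r + 1) \<theta>\<close> to 0 whatever \<open>r\<close> does, the left half
  makes the dominating function independent of \<open>r\<close>.\<close>

definition orient :: "real^2 \<Rightarrow> real^2 \<Rightarrow> real^2 \<Rightarrow> real" where
  "orient a b c = (b$1 - a$1) * (c$2 - a$2) - (b$2 - a$2) * (c$1 - a$1)"

lemma orient_rotate: "orient a b c = orient b c a"
  by (simp add: orient_def algebra_simps)

lemma orient_swap: "orient a c b = - orient a b c" "orient b a c = - orient a b c"
  by (simp_all add: orient_def algebra_simps)

lemma orient_same [simp]: "orient a a b = 0" "orient a b a = 0" "orient a b b = 0"
  by (simp_all add: orient_def algebra_simps)

lemma orient_affine:
  assumes "u + v = 1"
  shows "orient a b (u *\<^sub>R x + v *\<^sub>R y) = u * orient a b x + v * orient a b y"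
proof -
  have u: "u = 1 - v" using assms by simp
  show ?thesis unfolding u orient_def by (simp add: algebra_simps)
qed

lemma orient_affine3:
  assumes "u + v + w = 1"
  shows "orient a b (u *\<^sub>R x + v *\<^sub>R y + w *\<^sub>R z)
    = u * orient a b x + v * orient a b y + w * orient a b z"
proof -
  have u: "u = 1 - v - w" using assms by simp
  show ?thesis unfolding u orient_def by (simp add: algebra_simps)
qed

lemma orient_open_segment: "z \<in> open_segment a b \<Longrightarrow> orient a b z = 0"
  by (auto simp: in_segment orient_affine)

lemma orient_halfplane:
  "orient a b x = vector [a$2 - b$2, b$1 - a$1] \<bullet> x - vector [a$2 - b$2, b$1 - a$1] \<bullet> a"
  by (simp add: orient_def inner_vec_def sum_2 algebra_simps)

lemma orient_0_param:
  assumes "orient a b c = 0" "a \<noteq> b"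
  obtains t where "c = (1 - t) *\<^sub>R a + t *\<^sub>R b"
proof -
  from assms(2) have "b$1 - a$1 \<noteq> 0 \<or> b$2 - a$2 \<noteq> 0"
    by (auto simp: vec_eq_iff forall_2)
  then show ?thesis
  proof
    assume *: "b$1 - a$1 \<noteq> 0"
    define t where "t = (c$1 - a$1) / (b$1 - a$1)"
    have t1: "t * (b$1 - a$1) = c$1 - a$1" using * by (simp add: t_def)
    have "(b$1 - a$1) * (t * (b$2 - a$2)) = (b$1 - a$1) * (c$2 - a$2)"
      using assms(1) t1 unfolding orient_def by algebra
    then have t2: "t * (b$2 - a$2) = c$2 - a$2" using * by simp
    show ?thesis
      by (rule that[of t]) (use t1 t2 in \<open>simp add: vec_eq_iff forall_2 algebra_simps\<close>)
  next
    assume *: "b$2 - a$2 \<noteq> 0"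
    define t where "t = (c$2 - a$2) / (b$2 - a$2)"
    have t1: "t * (b$2 - a$2) = c$2 - a$2" using * by (simp add: t_def)
    have "(b$2 - a$2) * (t * (b$1 - a$1)) = (b$2 - a$2) * (c$1 - a$1)"
      using assms(1) t1 unfolding orient_def by algebra
    then have t2: "t * (b$1 - a$1) = c$1 - a$1" using * by simp
    show ?thesis
      by (rule that[of t]) (use t1 t2 in \<open>simp add: vec_eq_iff forall_2 algebra_simps\<close>)
  qed
qed

lemma orient_0_iff_collinear: "orient a b c = 0 \<longleftrightarrow> collinear {a, b, c}"
proof (cases "a = b")
  case False
  show ?thesis
  proof
    assume "orient a b c = 0"
    then obtain t where t: "c = (1 - t) *\<^sub>R a + t *\<^sub>R b"
      using False orient_0_param by blast
    show "collinear {a, b, c}"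
      unfolding collinear_def
    proof (intro exI[of _ "b - a"] ballI)
      fix x y assume "x \<in> {a, b, c}" "y \<in> {a, b, c}"
      then have "\<exists>s. x = a + s *\<^sub>R (b - a)" "\<exists>s. y = a + s *\<^sub>R (b - a)"
        using exI[of "\<lambda>s. a = a + s *\<^sub>R (b - a)" 0] exI[of "\<lambda>s. b = a + s *\<^sub>R (b - a)" 1]
          exI[of "\<lambda>s. c = a + s *\<^sub>R (b - a)" t]
        by (auto simp: t algebra_simps)
      then obtain s s' where "x = a + s *\<^sub>R (b - a)" "y = a + s' *\<^sub>R (b - a)" by blast
      then show "\<exists>d. x - y = d *\<^sub>R (b - a)"
        by (intro exI[of _ "s - s'"]) (simp add: scaleR_left_diff_distrib)
    qed
  next
    assume "collinear {a, b, c}"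
    then obtain u where u: "\<And>x y. x \<in> {a, b, c} \<Longrightarrow> y \<in> {a, b, c} \<Longrightarrow> \<exists>d. x - y = d *\<^sub>R u"
      unfolding collinear_def by blast
    obtain d e where "b - a = d *\<^sub>R u" "c - a = e *\<^sub>R u" using u[of b a] u[of c a] by auto
    then have "b$1 - a$1 = d * u$1" "b$2 - a$2 = d * u$2" "c$1 - a$1 = e * u$1" "c$2 - a$2 = e * u$2"
      by (simp_all add: vec_eq_iff forall_2)
    then show "orient a b c = 0" by (simp add: orient_def)
  qed
qed simp

lemma orient_distinct:
  assumes "orient a b c \<noteq> 0"
  shows "a \<noteq> b" "a \<noteq> c" "b \<noteq> c"
  using assms by auto

lemma orient_affine_independent:
  assumes "orient a b c \<noteq> 0"
  shows "\<not> affine_dependent {a, b, c}" "card {a, b, c} = 3"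
  using assms orient_distinct[OF assms] orient_0_iff_collinear[of a b c]
    affine_dependent_imp_collinear_3[of a b c]
  by auto

lemma open_segment_param:
  assumes "a \<noteq> b" "s < t" "t < u"
  shows "(1 - t) *\<^sub>R a + t *\<^sub>R b \<in> open_segment ((1 - s) *\<^sub>R a + s *\<^sub>R b) ((1 - u) *\<^sub>R a + u *\<^sub>R b)"
proof -
  define w where "w = (t - s) / (u - s)"
  have w: "0 < w" "w < 1" "t = (1 - w) * s + w * u"
  proof -
    have "w * (u - s) = t - s" using assms by (simp add: w_def)
    then show "t = (1 - w) * s + w * u" by (simp add: algebra_simps)
  qed (use assms in \<open>auto simp: w_def\<close>)
  have "(1 - s) *\<^sub>R a + s *\<^sub>R b - ((1 - u) *\<^sub>R a + u *\<^sub>R b) = (u - s) *\<^sub>R (a - b)"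
    by (simp add: algebra_simps)
  then have "(1 - s) *\<^sub>R a + s *\<^sub>R b \<noteq> (1 - u) *\<^sub>R a + u *\<^sub>R b"
    using assms by auto
  moreover have "(1 - t) *\<^sub>R a + t *\<^sub>R b
      = (1 - w) *\<^sub>R ((1 - s) *\<^sub>R a + s *\<^sub>R b) + w *\<^sub>R ((1 - u) *\<^sub>R a + u *\<^sub>R b)"
    unfolding w(3) by (simp add: algebra_simps)
  ultimately show ?thesis
    using w by (auto simp: in_segment)
qed

text \<open>Parametrise the line so that \<open>a\<close> and \<open>b\<close> sit at 0 and 1. Then
  \<open>c\<close> and \<open>d\<close> have parameters outside (0, 1), and on different sides of it
  because of the common point, so the first segment lies in the second; as \<open>a\<close> and
  \<open>b\<close> are not interior to that one, the ends agree.\<close>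

lemma open_segments_meet_collinear:
  assumes z: "z \<in> open_segment a b" "z \<in> open_segment c d"
    and col: "orient a b c = 0" "orient a b d = 0"
    and cd: "c \<notin> open_segment a b" "d \<notin> open_segment a b"
    and ab: "a \<notin> open_segment c d" "b \<notin> open_segment c d"
  shows "{a, b} = {c, d}"
proof -
  have ne: "a \<noteq> b" using z(1) by auto
  define f where "f t = (1 - t) *\<^sub>R a + t *\<^sub>R b" for t
  have betw: "f t \<in> open_segment (f s) (f u)" if "s < t" "t < u" for s t u
    unfolding f_def using open_segment_param[OF ne that] .
  have f01: "f 0 = a" "f 1 = b" by (simp_all add: f_def)
  have main: "{a, b} = {f s, f u}"
    if "s \<le> 0" "u \<ge> 1" "a \<notin> open_segment (f s) (f u)" "b \<notin> open_segment (f s) (f u)" for s u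
  proof -
    have "s = 0" using betw[of s 0 u] that f01 by (cases "s = 0") auto
    moreover have "u = 1" using betw[of s 1 u] that f01 by (cases "u = 1") auto
    ultimately show ?thesis using f01 by simp
  qed
  obtain s where s: "c = f s" using orient_0_param[OF col(1) ne] f_def by metis
  obtain u where u: "d = f u" using orient_0_param[OF col(2) ne] f_def by metis
  obtain t where t: "0 < t" "t < 1" "z = f t" using z(1) by (auto simp: in_segment f_def)
  obtain w where w: "0 < w" "w < 1" "z = (1 - w) *\<^sub>R c + w *\<^sub>R d" using z(2) by (auto simp: in_segment)
  have "z = f ((1 - w) * s + w * u)" unfolding w(3) s u f_def by (simp add: algebra_simps)
  then have "f t = f ((1 - w) * s + w * u)" using t by simp
  then have "(t - ((1 - w) * s + w * u)) *\<^sub>R (b - a) = 0" by (simp add: f_def algebra_simps)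
  then have tw: "t = (1 - w) * s + w * u" using ne by auto
  have "s \<le> 0 \<or> s \<ge> 1" "u \<le> 0 \<or> u \<ge> 1"
    using betw[of 0 s 1] betw[of 0 u 1] cd f01 s u by force+
  moreover have "\<not> (s \<le> 0 \<and> u \<le> 0)"
  proof
    assume "s \<le> 0 \<and> u \<le> 0"
    then have "(1 - w) * s + w * u \<le> 0 + 0"
      using w by (intro add_mono) (auto simp: mult_nonneg_nonpos)
    then show False using tw t by simp
  qed
  moreover have "\<not> (s \<ge> 1 \<and> u \<ge> 1)"
  proof
    assume "s \<ge> 1 \<and> u \<ge> 1"
    then have "(1 - w) * s + w * u \<ge> (1 - w) * 1 + w * 1"
      using w by (intro add_mono mult_left_mono) auto
    then show False using tw t by simp
  qed
  ultimately consider "s \<le> 0" "u \<ge> 1" | "u \<le> 0" "s \<ge> 1" by linarith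
  then show ?thesis
  proof cases
    case 1 then show ?thesis using main[of s u] ab s u by simp
  next
    case 2 then show ?thesis using main[of u s] ab s u
      by (metis insert_commute open_segment_commute)
  qed
qed

text \<open>The point is explicit: the four signed areas give the affine dependence
  \<open>\<beta> a + \<alpha> b = \<gamma> c + \<delta> d\<close> with equal weight sums, and the
  signs make both sides convex combinations after division by
  \<open>\<alpha> + \<beta>\<close>.\<close>

lemma crossing_point:
  assumes "orient c d a > 0" "orient c d b < 0" "orient a b d > 0" "orient a b c < 0"
  shows "open_segment a b \<inter> open_segment c d \<noteq> {}"
proof -
  define \<alpha> \<beta> \<gamma> \<delta> where "\<alpha> = orient c d a" "\<beta> = - orient c d b"
    "\<gamma> = orient a b d" "\<delta> = - orient a b c"
  note defs = this
  have pos: "\<alpha> > 0" "\<beta> > 0" "\<gamma> > 0" "\<delta> > 0" using assms by (auto simp: defs)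
  have sum: "\<gamma> + \<delta> = \<alpha> + \<beta>" by (simp add: defs orient_def algebra_simps)
  have eq: "\<beta> *\<^sub>R a + \<alpha> *\<^sub>R b = \<gamma> *\<^sub>R c + \<delta> *\<^sub>R d"
    by (simp add: vec_eq_iff forall_2 defs orient_def algebra_simps)
  define z where "z = (1 / (\<alpha> + \<beta>)) *\<^sub>R (\<beta> *\<^sub>R a + \<alpha> *\<^sub>R b)"
  have "z = (1 - \<alpha> / (\<alpha> + \<beta>)) *\<^sub>R a + (\<alpha> / (\<alpha> + \<beta>)) *\<^sub>R b"
    using pos by (simp add: z_def scaleR_add_right field_simps)
  moreover have "a \<noteq> b" using assms by auto
  ultimately have "z \<in> open_segment a b"
    using pos by (auto simp: in_segment intro!: exI[of _ "\<alpha> / (\<alpha> + \<beta>)"])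
  moreover have "z = (1 - \<delta> / (\<alpha> + \<beta>)) *\<^sub>R c + (\<delta> / (\<alpha> + \<beta>)) *\<^sub>R d"
    using pos sum unfolding z_def eq sum[symmetric] by (simp add: scaleR_add_right field_simps)
  moreover have "c \<noteq> d" "\<delta> / (\<alpha> + \<beta>) < 1" using assms sum pos by auto
  ultimately have "z \<in> open_segment c d"
    using pos by (auto simp: in_segment intro!: exI[of _ "\<delta> / (\<alpha> + \<beta>)"])
  then show ?thesis using \<open>z \<in> open_segment a b\<close> by blast
qed

text \<open>Cramer's rule: the barycentric coordinates of \<open>x\<close> are ratios of signed
  areas.\<close>

lemma orient_barycentric:
  "orient b c x *\<^sub>R a + orient c a x *\<^sub>R b + orient a b x *\<^sub>R c = orient a b c *\<^sub>R x"
  by (simp add: vec_eq_iff forall_2 orient_def algebra_simps)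

lemma orient_sum: "orient b c x + orient c a x + orient a b x = orient a b c"
  by (simp add: orient_def algebra_simps)

lemma simplex_2_iff:
  fixes T :: "(real^2) set"
  shows "2 simplex T \<longleftrightarrow> (\<exists>a b c. orient a b c \<noteq> 0 \<and> T = convex hull {a, b, c})"
proof
  assume "2 simplex T"
  then obtain C where C: "\<not> affine_dependent C" "card C = 3" "T = convex hull C"
    by (auto simp: simplex)
  then obtain a b c where abc: "C = {a, b, c}" "a \<noteq> b" "a \<noteq> c" "b \<noteq> c"
    by (auto simp: card_3_iff)
  then show "\<exists>a b c. orient a b c \<noteq> 0 \<and> T = convex hull {a, b, c}"
    using C collinear_3_eq_affine_dependent orient_0_iff_collinear by metis
next
  assume "\<exists>a b c. orient a b c \<noteq> 0 \<and> T = convex hull {a, b, c}"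
  then obtain a b c where "orient a b c \<noteq> 0" "T = convex hull {a, b, c}" by blast
  with orient_affine_independent[OF this(1)] show "2 simplex T"
    by (simp add: simplex_convex_hull)
qed

lemma edge_of_triangle_iff:
  assumes "orient a b c \<noteq> 0"
  shows "e edge_of convex hull {a, b, c} \<longleftrightarrow>
    e = closed_segment a b \<or> e = closed_segment b c \<or> e = closed_segment a c"
proof -
  note ind = orient_affine_independent[OF assms] and ne = orient_distinct[OF assms]
  have face: "e face_of convex hull {a, b, c} \<longleftrightarrow> (\<exists>C \<subseteq> {a, b, c}. e = convex hull C)"
    using face_of_convex_hull_affine_independent[OF ind(1)] .
  show ?thesis
  proof
    assume "e edge_of convex hull {a, b, c}"
    then obtain C where C: "C \<subseteq> {a, b, c}" "e = convex hull C" "aff_dim e = 1"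
      using face by (auto simp: edge_of_def)
    have "\<not> affine_dependent C" using ind C affine_independent_subset by blast
    then have "card C = 2" using C aff_dim_affine_independent[of C] by (simp add: aff_dim_convex_hull)
    then obtain x y where "C = {x, y}" "x \<noteq> y" by (meson card_2_iff)
    then show "e = closed_segment a b \<or> e = closed_segment b c \<or> e = closed_segment a c"
      using C by (auto simp: segment_convex_hull insert_commute)
  next
    have "closed_segment x y edge_of convex hull {a, b, c}"
      if "x \<in> {a, b, c}" "y \<in> {a, b, c}" "x \<noteq> y" for x y
    proof -
      have "closed_segment x y face_of convex hull {a, b, c}"
        unfolding face_of_convex_hull_affine_independent[OF ind(1)]
        by (rule exI[of _ "{x, y}"]) (use that in \<open>auto simp: segment_convex_hull\<close>)
      moreover have "aff_dim (closed_segment x y) = 1"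
        using that by (simp add: segment_convex_hull aff_dim_convex_hull aff_dim_2)
      ultimately show ?thesis by (simp add: edge_of_def)
    qed
    then show "e = closed_segment a b \<or> e = closed_segment b c \<or> e = closed_segment a c \<Longrightarrow>
        e edge_of convex hull {a, b, c}"
      using ne by auto
  qed
qed

section \<open>Recursively cut triangulations\<close>

definition separated :: "nat set \<Rightarrow> nat \<Rightarrow> nat \<Rightarrow> bool" where
  "separated K a b \<longleftrightarrow> (\<exists>q\<in>K. a < q \<and> q < b)"

text \<open>The points of the boundary are numbered \<open>0, \<dots>, n - 1\<close>, where \<open>K\<close> is the set of corners and
  \<open>0\<close> is a corner. Points \<open>a < b < c\<close> lie on one side iff there is no corner strictly between
  \<open>a\<close> and \<open>c\<close>, or they lie on the last side, which ends at \<open>0 = n\<close>, so that \<open>a = 0\<close>.\<close>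

definition nonflat :: "nat \<Rightarrow> nat set \<Rightarrow> nat \<Rightarrow> nat \<Rightarrow> nat \<Rightarrow> bool" where
  "nonflat n K a b c \<longleftrightarrow> separated K a c \<and> (a = 0 \<longrightarrow> separated K b n)"

text \<open>\<open>F\<close> is what gets counted, \<open>\<tau>\<close> holds the triangles that
  \<open>triangle_dissection\<close> asks for. The polygon is bounded by the points from
  \<open>i\<close> to \<open>j\<close> and the base \<open>(i, j)\<close>, and \<open>m\<close> is
  the apex over the base. The rule \<open>edge\<close> is the degenerate polygon on two neighbouring
  points, which has no triangle.\<close>

inductive tri :: "nat \<Rightarrow> nat set \<Rightarrow> nat \<Rightarrow> nat \<Rightarrow> (nat \<times> nat) set \<Rightarrow> (nat \<times> nat \<times> nat) set \<Rightarrow> bool"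
  for n K where
  edge: "tri n K i (Suc i) {(i, Suc i)} {}"
| apex: "\<lbrakk>i < m; m < j; nonflat n K i m j; tri n K i m F1 \<tau>1; tri n K m j F2 \<tau>2\<rbrakk>
    \<Longrightarrow> tri n K i j (insert (i, j) (F1 \<union> F2)) (insert (i, m, j) (\<tau>1 \<union> \<tau>2))"

definition sides :: "nat \<times> nat \<times> nat \<Rightarrow> (nat \<times> nat) set" where
  "sides t = (case t of (a, b, c) \<Rightarrow> {(a, b), (b, c), (a, c)})"

definition pairs :: "nat \<Rightarrow> nat \<Rightarrow> (nat \<times> nat) set" where
  "pairs i j = {(a, b). i \<le> a \<and> a < b \<and> b \<le> j}"

lemma finite_pairs: "finite (pairs i j)"
  by (rule finite_subset[of _ "{i..j} \<times> {i..j}"]) (auto simp: pairs_def)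

lemma tri_pairs:
  assumes "tri n K i j F \<tau>"
  shows "i < j \<and> F \<subseteq> pairs i j \<and> (i, j) \<in> F"
  using assms by induction (auto simp: pairs_def)

lemma tri_triples:
  assumes "tri n K i j F \<tau>" "(a, b, c) \<in> \<tau>"
  shows "i \<le> a \<and> a < b \<and> b < c \<and> c \<le> j \<and> nonflat n K a b c"
  using assms by (induction arbitrary: a b c) (fastforce dest: tri_pairs)+

lemma tri_sides:
  assumes "tri n K i j F \<tau>"
  shows "F = insert (i, j) (\<Union> (sides ` \<tau>)) \<and> (j \<noteq> Suc i \<longrightarrow> F = \<Union> (sides ` \<tau>))"
  using assms by induction (auto simp: sides_def)

lemma tri_noncrossing:
  assumes "tri n K i j F \<tau>" "(a, b) \<in> F" "(c, d) \<in> F"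
  shows "\<not> (a < c \<and> c < b \<and> b < d)"
  using assms
proof (induction arbitrary: a b c d)
  case (apex i m j F1 \<tau>1 F2 \<tau>2)
  have "F1 \<subseteq> pairs i m" "F2 \<subseteq> pairs m j" using apex.hyps tri_pairs by blast+
  then have le: "(x, y) \<in> F1 \<Longrightarrow> i \<le> x \<and> x < y \<and> y \<le> m"
    and ge: "(x, y) \<in> F2 \<Longrightarrow> m \<le> x \<and> x < y \<and> y \<le> j" for x y
    by (auto simp: pairs_def)
  show ?case
  proof
    assume cr: "a < c \<and> c < b \<and> b < d"
    have "(a, b) = (i, j) \<or> (a, b) \<in> F1 \<or> (a, b) \<in> F2" "(c, d) = (i, j) \<or> (c, d) \<in> F1 \<or> (c, d) \<in> F2"
      using apex.prems by auto
    then consider "(a, b) = (i, j)" | "(c, d) = (i, j)" | "(a, b) \<in> F1" "(c, d) \<in> F1"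
      | "(a, b) \<in> F2" "(c, d) \<in> F2" | "(a, b) \<in> F1" "(c, d) \<in> F2" | "(a, b) \<in> F2" "(c, d) \<in> F1"
      by blast
    then show False
    proof cases
      case 1
      with apex.prems(2) show False using cr le[of c d] ge[of c d] apex.hyps(1,2) by auto
    next
      case 2
      with apex.prems(1) show False using cr le[of a b] ge[of a b] apex.hyps(1,2) by auto
    next
      case 3 then show False using apex.IH(1) cr by blast
    next
      case 4 then show False using apex.IH(2) cr by blast
    next
      case 5 then show False using le ge cr by fastforce
    next
      case 6 then show False using le ge cr by fastforce
    qed
  qed
qed auto

text \<open>The base is new and the two halves share no segment, since \<open>pairs i m\<close> and
  \<open>pairs m j\<close> are disjoint.\<close>

lemma tri_card:
  assumes "tri n K i j F \<tau>"
  shows "card F + 1 = 2 * (j - i)"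
  using assms
proof induction
  case (apex i m j F1 \<tau>1 F2 \<tau>2)
  have F: "F1 \<subseteq> pairs i m" "F2 \<subseteq> pairs m j" using apex.hyps tri_pairs by blast+
  then have "finite F1" "finite F2" using finite_pairs finite_subset by blast+
  moreover have "F1 \<inter> F2 = {}" "(i, j) \<notin> F1 \<union> F2"
    using F apex.hyps(1,2) by (fastforce simp: pairs_def)+
  ultimately have "card (insert (i, j) (F1 \<union> F2)) = Suc (card F1 + card F2)"
    by (simp add: card_Un_disjoint)
  then show ?case using apex.IH apex.hyps(1,2) by linarith
qed simp

lemma tri_subset_eq:
  assumes "tri n K i j F \<tau>" "tri n K i j F' \<tau>'" "F \<subseteq> F'"
  shows "F = F'"
proof -
  have "finite F'" using tri_pairs[OF assms(2)] finite_pairs finite_subset by blast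
  moreover have "card F = card F'" using tri_card[OF assms(1)] tri_card[OF assms(2)] by simp
  ultimately show ?thesis using assms(3) card_subset_eq by blast
qed

definition tri_sets :: "nat \<Rightarrow> nat set \<Rightarrow> nat \<Rightarrow> nat \<Rightarrow> (nat \<times> nat) set set" where
  "tri_sets n K i j = {F. \<exists>\<tau>. tri n K i j F \<tau>}"

lemma tri_sets_Suc: "tri_sets n K i (Suc i) = {{(i, Suc i)}}"
proof -
  have "F = {(i, Suc i)}" if "tri n K i (Suc i) F \<tau>" for F \<tau>
    using that by cases auto
  then show ?thesis by (auto simp: tri_sets_def intro: tri.edge)
qed

lemma finite_tri_sets: "finite (tri_sets n K i j)"
  by (rule finite_subset[of _ "Pow (pairs i j)"])
    (auto simp: tri_sets_def finite_pairs dest: tri_pairs)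

text \<open>The apex is determined by \<open>F\<close>, as the only \<open>m\<close> with \<open>(i, m)\<close> and \<open>(m, j)\<close> in \<open>F\<close>.\<close>

lemma card_tri_sets:
  assumes "Suc i < j"
  shows "card (tri_sets n K i j) =
    (\<Sum>m | i < m \<and> m < j \<and> nonflat n K i m j. card (tri_sets n K i m) * card (tri_sets n K m j))"
proof -
  define M where "M = {m. i < m \<and> m < j \<and> nonflat n K i m j}"
  define glue where "glue = (\<lambda>(m :: nat, F1, F2). insert (i, j) (F1 \<union> F2))"
  define A where "A = (SIGMA m:M. tri_sets n K i m \<times> tri_sets n K m j)"
  have finM: "finite M" by (rule finite_subset[of _ "{..j}"]) (auto simp: M_def)
  have sub: "F1 \<subseteq> pairs i m" "F2 \<subseteq> pairs m j" "(i, m) \<in> F1" "(m, j) \<in> F2" "i < m" "m < j"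
    if "(m, F1, F2) \<in> A" for m F1 F2
    using that by (auto simp: A_def M_def tri_sets_def dest!: tri_pairs)
  have "tri_sets n K i j = glue ` A"
  proof (intro equalityI subsetI)
    fix F assume "F \<in> tri_sets n K i j"
    then obtain \<tau> where "tri n K i j F \<tau>" by (auto simp: tri_sets_def)
    then show "F \<in> glue ` A"
    proof cases
      case (apex m F1 \<tau>1 F2 \<tau>2)
      then have "(m, F1, F2) \<in> A" by (auto simp: A_def M_def tri_sets_def)
      moreover have "F = glue (m, F1, F2)" using apex(1) by (simp add: glue_def)
      ultimately show ?thesis by blast
    qed (use assms in simp)
  next
    fix F assume "F \<in> glue ` A"
    then obtain m F1 F2 where "(m, F1, F2) \<in> A" and F: "F = insert (i, j) (F1 \<union> F2)"
      by (auto simp: glue_def)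
    then obtain \<tau>1 \<tau>2 where "i < m" "m < j" "nonflat n K i m j" "tri n K i m F1 \<tau>1" "tri n K m j F2 \<tau>2"
      by (auto simp: A_def M_def tri_sets_def)
    from tri.apex[OF this] show "F \<in> tri_sets n K i j"
      unfolding F tri_sets_def by blast
  qed
  moreover have "inj_on glue A"
  proof (rule inj_onI)
    fix x y assume xy: "x \<in> A" "y \<in> A" "glue x = glue y"
    obtain m F1 F2 m' F1' F2' where x: "x = (m, F1, F2)" and y: "y = (m', F1', F2')"
      by (metis prod_cases3)
    have A: "(m, F1, F2) \<in> A" "(m', F1', F2') \<in> A" using xy x y by auto
    note s = sub[OF A(1)] and s' = sub[OF A(2)]
    have eq: "insert (i, j) (F1 \<union> F2) = insert (i, j) (F1' \<union> F2')"
      using xy(3) by (simp add: x y glue_def)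
    have "(i, m) \<in> insert (i, j) (F1' \<union> F2')" "(i, m') \<in> insert (i, j) (F1 \<union> F2)"
      using eq s s' by auto
    then have "m \<le> m'" "m' \<le> m" using s s' by (auto simp: pairs_def)
    then have m: "m' = m" by simp
    have "F1 = insert (i, j) (F1 \<union> F2) \<inter> pairs i m" "F2 = insert (i, j) (F1 \<union> F2) \<inter> pairs m j"
      using s by (auto simp: pairs_def)
    moreover have "F1' = insert (i, j) (F1' \<union> F2') \<inter> pairs i m" "F2' = insert (i, j) (F1' \<union> F2') \<inter> pairs m j"
      using s' m by (auto simp: pairs_def)
    ultimately show "x = y" using m eq x y by auto
  qed
  ultimately have "card (tri_sets n K i j) = card A" by (simp add: card_image)
  also have "\<dots> = (\<Sum>m\<in>M. card (tri_sets n K i m) * card (tri_sets n K m j))"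
    unfolding A_def using finM by (simp add: finite_tri_sets card_cartesian_product)
  finally show ?thesis unfolding M_def .
qed

section \<open>Triangulations of a subdivided polygon\<close>

lemma separated_mono: "separated K a b \<Longrightarrow> a' \<le> a \<Longrightarrow> b \<le> b' \<Longrightarrow> separated K a' b'"
  unfolding separated_def by (meson le_less_trans less_le_trans)

lemma open_segment_antisym:
  fixes a b c :: "'a::euclidean_space"
  shows "b \<in> open_segment a c \<Longrightarrow> c \<notin> open_segment a b"
  using dist_in_open_segment[of b a c] dist_in_open_segment[of c a b]
  by (auto simp: dist_commute)

text \<open>What the counting uses of \<open>SC k r\<close>: the signs of triples that do not lie on
  one side, and the order of the points on a side. \<open>\<epsilon>\<close> absorbs the orientation
  of the numbering. The last side closes up at index 0, so the order on it is stated separately.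
  \<open>corners\<close> says that the chain from 0 to \<open>n - 1\<close> is not flat and that the
  point 1 is off the last side.\<close>

locale subdivided_polygon =
  fixes n :: nat and K :: "nat set" and p :: "nat \<Rightarrow> real^2" and \<epsilon> :: real
  assumes eps_nz: "\<epsilon> \<noteq> 0"
    and n3: "3 \<le> n"
    and corners: "separated K 0 (n - 1)" "separated K 1 n"
    and orient_pos: "\<lbrakk>a < b; b < c; c < n; nonflat n K a b c\<rbrakk> \<Longrightarrow> \<epsilon> * orient (p a) (p b) (p c) > 0"
    and same_side: "\<lbrakk>a < b; b < c; c < n; \<not> separated K a c\<rbrakk> \<Longrightarrow> p b \<in> open_segment (p a) (p c)"
    and last_side: "\<lbrakk>0 < b; b < c; c < n; \<not> separated K b n\<rbrakk> \<Longrightarrow> p c \<in> open_segment (p b) (p 0)"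
begin

section \<open>Chords separate the boundary points by index\<close>

definition D :: "nat \<Rightarrow> nat \<Rightarrow> real^2 \<Rightarrow> real" where
  "D a b x = \<epsilon> * orient (p a) (p b) x"

definition seg :: "nat \<times> nat \<Rightarrow> (real^2) set" where
  "seg e = closed_segment (p (fst e)) (p (snd e))"

definition tria :: "nat \<times> nat \<times> nat \<Rightarrow> (real^2) set" where
  "tria t = (case t of (a, b, c) \<Rightarrow> convex hull {p a, p b, p c})"

definition chain :: "nat \<Rightarrow> nat \<Rightarrow> (real^2) set" where
  "chain i j = p ` {i..j}"

lemma D_rotate: "D a b (p c) = D b c (p a)"
  unfolding D_def by (metis orient_rotate)

lemma D_swap: "D b a x = - D a b x" "D a c (p b) = - D a b (p c)"
  using orient_swap(2)[of "p b" "p a" x] orient_swap(1)[of "p a" "p c" "p b"] by (simp_all add: D_def)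

lemma D_same [simp]: "D a a x = 0" "D a b (p a) = 0" "D a b (p b) = 0"
  by (simp_all add: D_def)

lemma D_open_segment: "x \<in> open_segment (p a) (p b) \<Longrightarrow> D a b x = 0"
  by (simp add: D_def orient_open_segment)

lemma D_affine: "u + v = 1 \<Longrightarrow> D a b (u *\<^sub>R x + v *\<^sub>R y) = u * D a b x + v * D a b y"
  by (simp add: D_def orient_affine algebra_simps)

lemma D_affine3: "u + v + w = 1 \<Longrightarrow>
    D a b (u *\<^sub>R x + v *\<^sub>R y + w *\<^sub>R z) = u * D a b x + v * D a b y + w * D a b z"
  by (simp only: D_def orient_affine3) (simp add: algebra_simps)

lemma D_pos: "\<lbrakk>a < b; b < c; c < n; nonflat n K a b c\<rbrakk> \<Longrightarrow> D a b (p c) > 0"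
  using orient_pos by (simp add: D_def)

lemma D_flat:
  assumes "a < b" "b < c" "c < n" "\<not> nonflat n K a b c"
  shows "D a b (p c) = 0"
proof (cases "separated K a c")
  case False
  then have "p b \<in> open_segment (p a) (p c)" using assms same_side by blast
  then have "D a c (p b) = 0" by (rule D_open_segment)
  then show ?thesis using D_swap(2)[of a c b] by simp
next
  case True
  then have "a = 0" "\<not> separated K b n" using assms by (auto simp: nonflat_def)
  then have "p c \<in> open_segment (p b) (p a)" using assms last_side by blast
  then have "D b a (p c) = 0" by (rule D_open_segment)
  then show ?thesis using D_swap(1)[of b a "p c"] by simp
qed

lemma D_nonneg: "\<lbrakk>a < b; b < c; c < n\<rbrakk> \<Longrightarrow> D a b (p c) \<ge> 0"
  using D_pos[of a b c] D_flat[of a b c] by fastforce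

lemma D_inside: "\<lbrakk>a < b; b < n; a \<le> c; c \<le> b\<rbrakk> \<Longrightarrow> D a b (p c) \<le> 0"
  using D_nonneg[of a c b] D_swap(2)[of a b c] by (cases "a = c \<or> c = b") auto

lemma D_inside_rev: "\<lbrakk>a < b; b < n; a \<le> c; c \<le> b\<rbrakk> \<Longrightarrow> D b a (p c) \<ge> 0"
  using D_inside[of a b c] by (subst D_swap(1)) simp

lemma D_outside:
  assumes "a < b" "b < n" "c < n" "c \<le> a \<or> b \<le> c"
  shows "D a b (p c) \<ge> 0"
proof -
  consider "c = a" | "c = b" | "c < a" | "b < c" using assms by linarith
  then show ?thesis
  proof cases
    case 3 then show ?thesis using D_nonneg[of c a b] D_rotate[of c a b] assms by simp
  next
    case 4 then show ?thesis using D_nonneg[of a b c] assms by simp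
  qed simp_all
qed

lemma p_distinct_triple:
  assumes "a < b" "b < c" "c < n"
  shows "p a \<noteq> p b \<and> p b \<noteq> p c \<and> p a \<noteq> p c"
proof (cases "nonflat n K a b c")
  case True
  then have "D a b (p c) \<noteq> 0" using D_pos assms by fastforce
  then show ?thesis unfolding D_def by auto
next
  case False
  then have "p b \<in> open_segment (p a) (p c) \<or> p c \<in> open_segment (p b) (p a)"
    using same_side last_side assms by (auto simp: nonflat_def)
  then show ?thesis by (auto simp: open_segment_def)
qed

lemma p_neq:
  assumes "a < b" "b < n"
  shows "p a \<noteq> p b"
proof -
  consider "Suc a < b" | "0 < a" | "Suc b < n" using assms n3 by linarith
  then show ?thesis
  proof cases
    case 1 then show ?thesis using p_distinct_triple[of a "Suc a" b] assms by auto
  next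
    case 2 then show ?thesis using p_distinct_triple[of 0 a b] assms by auto
  next
    case 3 then show ?thesis using p_distinct_triple[of a b "Suc b"] assms by auto
  qed
qed

lemma p_eq_iff: "a < n \<Longrightarrow> b < n \<Longrightarrow> p a = p b \<longleftrightarrow> a = b"
  using p_neq[of a b] p_neq[of b a] by (cases a b rule: linorder_cases) auto

lemma seg_eq_iff:
  assumes "a < b" "b < n" "c < d" "d < n"
  shows "seg (a, b) = seg (c, d) \<longleftrightarrow> a = c \<and> b = d"
  using assms p_eq_iff[of a c] p_eq_iff[of b d] p_eq_iff[of a d] p_eq_iff[of b c]
  by (auto simp: seg_def doubleton_eq_iff)

text \<open>The index form of a segment that contains no further point: neighbours, or points
  without a common side. For \<open>a = 0\<close> the last side has to be checked too; there
  \<open>b = n - 1\<close> is the cyclic neighbour of 0.\<close>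

definition valid :: "nat \<Rightarrow> nat \<Rightarrow> bool" where
  "valid a b \<longleftrightarrow> b = Suc a \<or> separated K a b \<and> (a = 0 \<longrightarrow> b = n - 1 \<or> separated K b n)"

text \<open>If \<open>p l\<close> were on the segment, \<open>D a b (p l) = 0\<close> would make the
  sorted triple flat. The flat cases that \<open>valid\<close> and \<open>corners\<close> leave open
  put \<open>p a\<close> or \<open>p b\<close> in the middle of the three points, against
  \<open>open_segment_antisym\<close>.\<close>

lemma valid_free:
  assumes "valid a b" "a < b" "b < n" "l < n"
  shows "p l \<notin> open_segment (p a) (p b)"
proof
  assume l: "p l \<in> open_segment (p a) (p b)"
  then have D0: "D a b (p l) = 0" by (rule D_open_segment)
  have "l \<noteq> a" "l \<noteq> b" using l by (auto simp: open_segment_def)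
  then consider "l < a" | "a < l" "l < b" | "b < l" by linarith
  then show False
  proof cases
    case 1
    then have "\<not> nonflat n K l a b" using D0 D_pos[of l a b] D_rotate[of l a b] assms by auto
    then consider "\<not> separated K l b" | "l = 0" "\<not> separated K a n" by (auto simp: nonflat_def)
    then show False
    proof cases
      case 1
      then have "p a \<in> open_segment (p b) (p l)"
        using same_side[of l a b] assms \<open>l < a\<close> by (simp add: open_segment_commute)
      then show False using open_segment_antisym l by (metis open_segment_commute)
    next
      case 2
      then have "p b \<in> open_segment (p a) (p l)" using last_side[of a b] assms \<open>l < a\<close> by simp
      then show False using open_segment_antisym l by metis
    qed
  next
    case 2
    then have sep: "separated K a b" "a = 0 \<longrightarrow> b = n - 1 \<or> separated K b n"
      using assms by (auto simp: valid_def)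
    have "\<not> nonflat n K a l b" using D0 D_pos[of a l b] D_swap(2)[of a b l] assms 2 by auto
    then have a: "a = 0" "\<not> separated K l n" using sep by (auto simp: nonflat_def)
    then have "p b \<in> open_segment (p a) (p l)"
      using last_side[of l b] assms 2 by (simp add: open_segment_commute)
    then show False using open_segment_antisym l by metis
  next
    case 3
    then have nf: "\<not> nonflat n K a b l" using D0 D_pos[of a b l] assms by auto
    have ns: "\<not> (a = 0 \<and> \<not> separated K b n)"
    proof
      assume a: "a = 0 \<and> \<not> separated K b n"
      then have "b = Suc a" using assms 3 by (auto simp: valid_def)
      then show False using corners a by simp
    qed
    then have "\<not> separated K a l" using nf by (auto simp: nonflat_def)
    then have "p b \<in> open_segment (p a) (p l)" using same_side[of a b l] assms 3 by simp
    then show False using open_segment_antisym l by metis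
  qed
qed

text \<open>Pairs that do not interleave have \<open>c\<close> and \<open>d\<close> on the same
  closed side of the line of the chord \<open>(a, b)\<close>. A common point then forces both onto
  that line, which is the collinear case.\<close>

lemma noncrossing_disjoint:
  assumes ab: "a < b" "b < n" and cd: "c < d" "d < n" and ne: "(a, b) \<noteq> (c, d)"
    and nc: "\<not> (a < c \<and> c < b \<and> b < d)" "\<not> (c < a \<and> a < d \<and> d < b)"
    and free: "p c \<notin> open_segment (p a) (p b)" "p d \<notin> open_segment (p a) (p b)"
      "p a \<notin> open_segment (p c) (p d)" "p b \<notin> open_segment (p c) (p d)"
  shows "open_segment (p a) (p b) \<inter> open_segment (p c) (p d) = {}"
proof (rule ccontr)
  assume "open_segment (p a) (p b) \<inter> open_segment (p c) (p d) \<noteq> {}"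
  then obtain z where z: "z \<in> open_segment (p a) (p b)" "z \<in> open_segment (p c) (p d)" by blast
  obtain w where w: "0 < w" "w < 1" "z = (1 - w) *\<^sub>R p c + w *\<^sub>R p d"
    using z(2) by (auto simp: in_segment)
  have 0: "(1 - w) * D a b (p c) + w * D a b (p d) = 0"
    using D_open_segment[OF z(1)] D_affine[of "1 - w" w a b "p c" "p d"] w by simp
  have "a \<le> c \<and> c \<le> b \<and> a \<le> d \<and> d \<le> b \<or> (c \<le> a \<or> b \<le> c) \<and> (d \<le> a \<or> b \<le> d)"
    using ab cd nc by linarith
  then have "D a b (p c) \<le> 0 \<and> D a b (p d) \<le> 0 \<or> D a b (p c) \<ge> 0 \<and> D a b (p d) \<ge> 0"
    using D_inside[of a b c] D_inside[of a b d] D_outside[of a b c] D_outside[of a b d] ab cd by auto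
  then have "D a b (p c) = 0 \<and> D a b (p d) = 0"
  proof
    assume "D a b (p c) \<le> 0 \<and> D a b (p d) \<le> 0"
    then have "(1 - w) * D a b (p c) \<le> 0" "w * D a b (p d) \<le> 0"
      using w by (auto simp: mult_nonneg_nonpos)
    then have "(1 - w) * D a b (p c) = 0" "w * D a b (p d) = 0" using 0 by linarith+
    then show ?thesis using w by simp
  next
    assume "D a b (p c) \<ge> 0 \<and> D a b (p d) \<ge> 0"
    then have "(1 - w) * D a b (p c) \<ge> 0" "w * D a b (p d) \<ge> 0" using w by auto
    then have "(1 - w) * D a b (p c) = 0" "w * D a b (p d) = 0" using 0 by linarith+
    then show ?thesis using w by simp
  qed
  then have "{p a, p b} = {p c, p d}"
    using open_segments_meet_collinear[OF z] free eps_nz by (simp add: D_def)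
  then show False using seg_eq_iff[OF ab cd] ne by (simp add: seg_def)
qed

text \<open>The freeness assumptions rule out the flat triples, so all signs are strict and
  \<open>crossing_point\<close> applies.\<close>

lemma crossing_meet:
  assumes "a < c" "c < b" "b < d" "d < n"
    and free: "p c \<notin> open_segment (p a) (p b)" "p d \<notin> open_segment (p a) (p b)"
      "p b \<notin> open_segment (p c) (p d)"
  shows "open_segment (p a) (p b) \<inter> open_segment (p c) (p d) \<noteq> {}"
proof -
  have sab: "separated K a b" using same_side[of a c b] assms by force
  have scd: "separated K c d" using same_side[of c b d] assms by force
  have sad: "separated K a d" and scn: "separated K c n"
    using sab scd assms separated_mono by (meson less_imp_le order.refl)+
  have sbn: "a = 0 \<Longrightarrow> separated K b n" using last_side[of b d] assms by (force simp: open_segment_commute)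
  have "D a c (p d) > 0" "D c b (p d) > 0" "D a b (p d) > 0" "D a c (p b) > 0"
    using sab scd sad scn sbn assms by (auto intro!: D_pos simp: nonflat_def)
  then have "D c d (p a) > 0" "D c d (p b) < 0" "D a b (p d) > 0" "D a b (p c) < 0"
    using D_rotate[of a c d] D_swap(2)[of c d b] D_swap(2)[of a b c] by auto
  note s = this[unfolded D_def]
  show ?thesis
  proof (cases "\<epsilon> > 0")
    case True
    then show ?thesis using s by (intro crossing_point) (auto simp: zero_less_mult_iff mult_less_0_iff)
  next
    case False
    then have "\<epsilon> < 0" using eps_nz by simp
    then have "open_segment (p b) (p a) \<inter> open_segment (p c) (p d) \<noteq> {}"
      using s orient_swap(2)[of "p a" "p b"]
      by (intro crossing_point) (auto simp: zero_less_mult_iff mult_less_0_iff)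
    then show ?thesis by (simp add: open_segment_commute)
  qed
qed


section \<open>Recursive cuts are geometric dissections\<close>

lemma D_halfplane:
  obtains u v where "\<And>x. D a b x = u \<bullet> x - v" "p a \<noteq> p b \<Longrightarrow> u \<noteq> 0"
proof -
  define w :: "real^2" where "w = vector [p a$2 - p b$2, p b$1 - p a$1]"
  have "D a b x = (\<epsilon> *\<^sub>R w) \<bullet> x - (\<epsilon> * (w \<bullet> p a))" for x
    unfolding D_def orient_halfplane w_def by (simp add: algebra_simps)
  moreover have "\<epsilon> *\<^sub>R w \<noteq> 0" if "p a \<noteq> p b"
    using that eps_nz by (auto simp: w_def vec_eq_iff forall_2)
  ultimately show ?thesis using that by blast
qed

lemma hull_D_nonneg:
  assumes "\<And>x. x \<in> X \<Longrightarrow> D a b x \<ge> 0" "x \<in> convex hull X"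
  shows "D a b x \<ge> 0"
proof -
  obtain u v where uv: "\<And>x. D a b x = u \<bullet> x - v" using D_halfplane by metis
  have "convex hull X \<subseteq> {x. u \<bullet> x \<ge> v}"
    using assms(1) uv by (intro hull_minimal) (auto simp: convex_halfspace_ge)
  then show ?thesis using assms(2) uv by auto
qed

lemma interior_D_pos:
  assumes "a \<noteq> b" "a < n" "b < n" "\<And>x. x \<in> X \<Longrightarrow> D a b x \<ge> 0" "x \<in> interior X"
  shows "D a b x > 0"
proof -
  obtain u v where uv: "\<And>x. D a b x = u \<bullet> x - v" "p a \<noteq> p b \<Longrightarrow> u \<noteq> 0" using D_halfplane by metis
  have "X \<subseteq> {x. u \<bullet> x \<ge> v}" using assms(4) uv by auto
  then have "interior X \<subseteq> interior {x. u \<bullet> x \<ge> v}" by (rule interior_mono)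
  then show ?thesis using assms uv p_eq_iff by auto
qed

lemma interiors_disjoint:
  assumes "a \<noteq> b" "a < n" "b < n" "\<And>x. x \<in> X \<Longrightarrow> D a b x \<ge> 0" "\<And>x. x \<in> Y \<Longrightarrow> D a b x \<le> 0"
  shows "interior X \<inter> interior Y = {}"
  using interior_D_pos[of a b X] interior_D_pos[of b a Y] assms D_swap(1)[of b a] by fastforce

lemma tria_D_nonneg:
  assumes "D u v (p a) \<ge> 0" "D u v (p b) \<ge> 0" "D u v (p c) \<ge> 0" "x \<in> tria (a, b, c)"
  shows "D u v x \<ge> 0"
  by (rule hull_D_nonneg[of "{p a, p b, p c}"]) (use assms in \<open>auto simp: tria_def\<close>)

lemma tria_memI:
  assumes "D a b (p c) > 0" "D a b x \<ge> 0" "D b c x \<ge> 0" "D c a x \<ge> 0"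
  shows "x \<in> tria (a, b, c)"
proof -
  define d where "d = D a b (p c)"
  have "D b c x *\<^sub>R p a + D c a x *\<^sub>R p b + D a b x *\<^sub>R p c = d *\<^sub>R x"
    using arg_cong[OF orient_barycentric[of "p b" "p c" x "p a"], of "\<lambda>y. \<epsilon> *\<^sub>R y"]
    by (simp add: D_def d_def scaleR_add_right)
  then have "(1 / d) *\<^sub>R (D b c x *\<^sub>R p a + D c a x *\<^sub>R p b + D a b x *\<^sub>R p c) = x"
    using assms(1) by (simp add: d_def)
  then have x: "x = (D b c x / d) *\<^sub>R p a + (D c a x / d) *\<^sub>R p b + (D a b x / d) *\<^sub>R p c"
    by (simp add: scaleR_add_right)
  have "D b c x + D c a x + D a b x = d"
    using arg_cong[OF orient_sum[of "p b" "p c" x "p a"], of "\<lambda>y. \<epsilon> * y"]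
    by (simp add: D_def d_def algebra_simps)
  then have "D b c x / d + D c a x / d + D a b x / d = 1"
    using assms(1) by (simp add: d_def add_divide_distrib[symmetric])
  then show ?thesis
    unfolding tria_def prod.case convex_hull_3 mem_Collect_eq
    using x assms by (intro exI[of _ "D b c x / d"] exI[of _ "D c a x / d"] exI[of _ "D a b x / d"])
      (simp add: d_def)
qed

text \<open>A descent to \<open>x\<close>, which is assumed to be on the inner side of every
  boundary edge and of the base. Either \<open>x\<close> is on the inner side of both new sides of
  the apex triangle and lies in it, or it is beyond one of them, and this one is the base of the
  piece that is searched next.\<close>

lemma tri_covers:
  assumes "tri n K i j F \<tau>" "j < n" "j \<noteq> Suc i"
    and "\<And>l. i \<le> l \<Longrightarrow> l < j \<Longrightarrow> D l (Suc l) x \<ge> 0" "D j i x \<ge> 0"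
  shows "\<exists>t\<in>\<tau>. x \<in> tria t"
  using assms
proof induction
  case (apex i m j F1 \<tau>1 F2 \<tau>2)
  show ?case
  proof (cases "D i m x < 0 \<or> D m j x < 0")
    case False
    have "D i m (p j) > 0" using D_pos apex by blast
    then have "x \<in> tria (i, m, j)" using tria_memI False apex.prems by auto
    then show ?thesis by blast
  next
    case True
    then show ?thesis
    proof
      assume neg: "D i m x < 0"
      then have "m \<noteq> Suc i" using apex.prems(3)[of i] apex.hyps(1,2) by auto
      moreover have "D m i x \<ge> 0" using neg D_swap(1)[of m i x] by simp
      ultimately have "\<exists>t\<in>\<tau>1. x \<in> tria t" using apex by simp
      then show ?thesis by blast
    next
      assume neg: "D m j x < 0"
      then have "j \<noteq> Suc m" using apex.prems(3)[of m] apex.hyps(1,2) by auto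
      moreover have "D j m x \<ge> 0" using neg D_swap(1)[of j m x] by simp
      ultimately have "\<exists>t\<in>\<tau>2. x \<in> tria t" using apex by simp
      then show ?thesis by blast
    qed
  qed
qed simp

text \<open>The lines of the chords \<open>(i, m)\<close> and \<open>(m, j)\<close> separate the two
  pieces and the apex triangle from each other.\<close>

lemma tri_interiors:
  assumes "tri n K i j F \<tau>" "j < n" "t \<in> \<tau>" "t' \<in> \<tau>" "t \<noteq> t'"
  shows "interior (tria t) \<inter> interior (tria t') = {}"
  using assms
proof (induction arbitrary: t t')
  case (apex i m j F1 \<tau>1 F2 \<tau>2)
  have im: "i < m" "m < j" "j < n" using apex by auto
  have t1: "D m i x \<ge> 0" if "t \<in> \<tau>1" "x \<in> tria t" for x t
  proof -
    obtain a b c where t: "t = (a, b, c)" by (cases t)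
    then have "i \<le> a \<and> a < b \<and> b < c \<and> c \<le> m" using tri_triples[OF apex.hyps(4)] that by simp
    then show ?thesis using that(2) im unfolding t
      by - (rule tria_D_nonneg[of m i a b c], auto intro!: D_inside_rev)
  qed
  have t1': "D m j x \<ge> 0" if "t \<in> \<tau>1" "x \<in> tria t" for x t
  proof -
    obtain a b c where t: "t = (a, b, c)" by (cases t)
    then have "i \<le> a \<and> a < b \<and> b < c \<and> c \<le> m" using tri_triples[OF apex.hyps(4)] that by simp
    then show ?thesis using that(2) im unfolding t
      by - (rule tria_D_nonneg[of m j a b c], auto intro!: D_outside)
  qed
  have t2: "D j m x \<ge> 0" if "t \<in> \<tau>2" "x \<in> tria t" for x t
  proof -
    obtain a b c where t: "t = (a, b, c)" by (cases t)
    then have "m \<le> a \<and> a < b \<and> b < c \<and> c \<le> j" using tri_triples[OF apex.hyps(5)] that by simp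
    then show ?thesis using that(2) im unfolding t
      by - (rule tria_D_nonneg[of j m a b c], auto intro!: D_inside_rev)
  qed
  have t0: "D i m x \<ge> 0 \<and> D m j x \<ge> 0" if "x \<in> tria (i, m, j)" for x
    using tria_D_nonneg[OF _ _ _ that] D_nonneg[OF im] D_rotate[of i m j] by simp
  have 12: "interior (tria t) \<inter> interior (tria t') = {}" if "t \<in> \<tau>1" "t' \<in> \<tau>2" for t t'
  proof (rule interiors_disjoint[of m j])
    show "D m j x \<le> 0" if "x \<in> tria t'" for x
      using t2[OF \<open>t' \<in> \<tau>2\<close> that] D_swap(1)[of j m x] by simp
  qed (use im t1'[OF that(1)] in auto)
  have 10: "interior (tria t) \<inter> interior (tria (i, m, j)) = {}" if "t \<in> \<tau>1" for t
  proof (rule interiors_disjoint[of m i])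
    show "D m i x \<le> 0" if "x \<in> tria (i, m, j)" for x
      using t0[OF that] D_swap(1)[of m i x] by simp
  qed (use im t1[OF that(1)] in auto)
  have 20: "interior (tria t) \<inter> interior (tria (i, m, j)) = {}" if "t \<in> \<tau>2" for t
  proof (rule interiors_disjoint[of j m])
    show "D j m x \<le> 0" if "x \<in> tria (i, m, j)" for x
      using t0[OF that] D_swap(1)[of j m x] by simp
  qed (use im t2[OF that(1)] in auto)
  have "t = (i, m, j) \<or> t \<in> \<tau>1 \<or> t \<in> \<tau>2" "t' = (i, m, j) \<or> t' \<in> \<tau>1 \<or> t' \<in> \<tau>2"
    using apex.prems by auto
  then show ?case
  proof (elim disjE)
    assume "t \<in> \<tau>1" "t' \<in> \<tau>1"
    then show ?thesis using apex.IH(1) apex.prems(4) im by simp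
  next
    assume "t \<in> \<tau>2" "t' \<in> \<tau>2"
    then show ?thesis using apex.IH(2) apex.prems(4) im by simp
  next
    assume "t \<in> \<tau>1" "t' \<in> \<tau>2"
    then show ?thesis by (rule 12)
  next
    assume "t \<in> \<tau>2" "t' \<in> \<tau>1"
    then show ?thesis using 12[of t' t] by blast
  next
    assume "t = (i, m, j)" "t' \<in> \<tau>1"
    then show ?thesis using 10[of t'] by blast
  next
    assume "t = (i, m, j)" "t' \<in> \<tau>2"
    then show ?thesis using 20[of t'] by blast
  next
    assume "t \<in> \<tau>1" "t' = (i, m, j)"
    then show ?thesis using 10[of t] by blast
  next
    assume "t \<in> \<tau>2" "t' = (i, m, j)"
    then show ?thesis using 20[of t] by blast
  qed (use apex.prems(4) in blast)
qed simp

text \<open>The base is excepted because nothing is known about what lies beyond it. Every other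
  segment is the base of a smaller piece and a side of a nonflat triangle above it, and the two
  facts together give \<open>valid\<close>.\<close>

lemma tri_valid:
  assumes "tri n K i j F \<tau>" "j < n" "(a, b) \<in> F"
  shows "(a, b) = (i, j) \<or> valid a b"
  using assms
proof (induction arbitrary: a b)
  case (apex i m j F1 \<tau>1 F2 \<tau>2)
  have base: "m' = Suc i' \<or> separated K i' m'" if "tri n K i' m' F' \<tau>'" for i' m' F' \<tau>'
    using that by cases (auto simp: nonflat_def)
  have "valid i m" "valid m j"
    using base[OF apex.hyps(4)] base[OF apex.hyps(5)] apex.hyps(1-3)
    by (auto simp: valid_def nonflat_def)
  then show ?case using apex by auto
qed simp

text \<open>This is \<open>valid\<close> without the neighbouring pairs, whose polygon is degenerate
  and has no triangle on the base.\<close>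

definition proper_base :: "nat \<Rightarrow> nat \<Rightarrow> bool" where
  "proper_base i j \<longleftrightarrow> i < j \<and> j < n \<and> separated K i j \<and> (i = 0 \<longrightarrow> j = n - 1 \<or> separated K j n)"

lemma proper_base_valid: "proper_base i j \<Longrightarrow> valid i j"
  by (simp add: proper_base_def valid_def)

lemma proper_base_less: "proper_base i j \<Longrightarrow> Suc i < j"
  unfolding proper_base_def separated_def by (metis Suc_lessI not_less_eq)

lemma tria_subset_chain: "\<lbrakk>i \<le> a; a < b; b < c; c \<le> j\<rbrakk> \<Longrightarrow> tria (a, b, c) \<subseteq> convex hull (chain i j)"
  unfolding tria_def prod.case chain_def by (intro hull_mono) auto

lemma orient_triple: "\<lbrakk>a < b; b < c; c < n; nonflat n K a b c\<rbrakk> \<Longrightarrow> orient (p a) (p b) (p c) \<noteq> 0"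
  using orient_pos[of a b c] by auto

lemma edges_of_trias:
  assumes "\<And>a b c. (a, b, c) \<in> \<tau> \<Longrightarrow> orient (p a) (p b) (p c) \<noteq> 0"
  shows "{e. \<exists>T\<in>tria ` \<tau>. e edge_of T} = seg ` (\<Union> (sides ` \<tau>))"
proof -
  have 1: "{e. e edge_of tria t} = seg ` sides t" if "t \<in> \<tau>" for t
  proof -
    obtain a b c where t: "t = (a, b, c)" by (cases t)
    with assms that have "orient (p a) (p b) (p c) \<noteq> 0" by simp
    from edge_of_triangle_iff[OF this] show ?thesis by (auto simp: t tria_def sides_def seg_def)
  qed
  have "{e. \<exists>T\<in>tria ` \<tau>. e edge_of T} = (\<Union>t\<in>\<tau>. {e. e edge_of tria t})" by blast
  also have "\<dots> = (\<Union>t\<in>\<tau>. seg ` sides t)" using 1 by (intro SUP_cong) auto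
  finally show ?thesis by blast
qed

lemma tri_dissection:
  assumes tri: "tri n K i j F \<tau>" and ij: "proper_base i j"
  shows "triangle_dissection (chain i j) (seg ` F)"
  unfolding triangle_dissection_def
proof (intro conjI exI)
  have jn: "j < n" using ij by (simp add: proper_base_def)
  have ne: "j \<noteq> Suc i" using proper_base_less[OF ij] by simp
  note P = tri_pairs[OF tri]
  have F: "i \<le> a \<and> a < b \<and> b \<le> j \<and> valid a b" if "(a, b) \<in> F" for a b
    using P that tri_valid[OF tri jn that] proper_base_valid[OF ij] by (auto simp: pairs_def)
  have trip: "i \<le> a \<and> a < b \<and> b < c \<and> c \<le> j \<and> nonflat n K a b c" if "(a, b, c) \<in> \<tau>" for a b c
    using tri_triples[OF tri that] .
  have ori: "orient (p a) (p b) (p c) \<noteq> 0" if "(a, b, c) \<in> \<tau>" for a b c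
    using trip[OF that] jn orient_triple[of a b c] by linarith
  show "seg ` F \<subseteq> segments_of (chain i j)"
  proof clarify
    fix a b assume ab: "(a, b) \<in> F"
    have "open_segment (p a) (p b) \<inter> chain i j = {}"
      using valid_free[of a b] F[OF ab] jn by (auto simp: chain_def)
    moreover have "p a \<noteq> p b" using p_neq F[OF ab] jn by simp
    moreover have "p a \<in> chain i j" "p b \<in> chain i j" using F[OF ab] by (auto simp: chain_def)
    ultimately show "seg (a, b) \<in> segments_of (chain i j)" by (auto simp: segments_of_def seg_def)
  qed
  show "noncrossing (seg ` F)"
    unfolding noncrossing_def pairwise_def
  proof clarify
    fix a b c d assume ab: "(a, b) \<in> F" and cd: "(c, d) \<in> F" and ne: "seg (a, b) \<noteq> seg (c, d)"
    note F' = F[OF ab] F[OF cd]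
    have "open_segment (p a) (p b) \<inter> open_segment (p c) (p d) = {}"
      by (rule noncrossing_disjoint)
        (use F' jn ne tri_noncrossing[OF tri ab cd] tri_noncrossing[OF tri cd ab]
          valid_free[of a b] valid_free[of c d] in auto)
    then show "rel_interior (seg (a, b)) \<inter> rel_interior (seg (c, d)) = {}"
      using p_neq[of a b] p_neq[of c d] F' jn by (simp add: seg_def rel_interior_closed_segment)
  qed
  show "\<forall>T\<in>tria ` \<tau>. 2 simplex T"
  proof clarify
    fix a b c assume "(a, b, c) \<in> \<tau>"
    then have "orient (p a) (p b) (p c) \<noteq> 0" by (rule ori)
    then show "2 simplex tria (a, b, c)" unfolding simplex_2_iff tria_def prod.case by blast
  qed
  show "pairwise (\<lambda>T U. interior T \<inter> interior U = {}) (tria ` \<tau>)"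
    unfolding pairwise_image pairwise_def using tri_interiors[OF tri jn] by blast
  show "\<Union> (tria ` \<tau>) = convex hull (chain i j)"
  proof (intro equalityI subsetI)
    fix x assume "x \<in> \<Union> (tria ` \<tau>)"
    then obtain a b c where "(a, b, c) \<in> \<tau>" "x \<in> tria (a, b, c)" by auto
    then show "x \<in> convex hull (chain i j)" using trip tria_subset_chain by blast
  next
    fix x assume x: "x \<in> convex hull (chain i j)"
    have "D l (Suc l) x \<ge> 0" if "i \<le> l" "l < j" for l
    proof (rule hull_D_nonneg[OF _ x])
      fix y assume "y \<in> chain i j"
      then obtain c where "y = p c" "c \<le> j" by (auto simp: chain_def)
      then show "D l (Suc l) y \<ge> 0" using D_outside[of l "Suc l" c] that jn by (cases "c \<le> l") auto
    qed
    moreover have "D j i x \<ge> 0"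
    proof (rule hull_D_nonneg[OF _ x])
      fix y assume "y \<in> chain i j"
      then obtain c where "y = p c" "i \<le> c" "c \<le> j" by (auto simp: chain_def)
      then show "D j i y \<ge> 0" using D_inside_rev[of i j c] P jn by auto
    qed
    ultimately show "x \<in> \<Union> (tria ` \<tau>)" using tri_covers[OF tri jn ne, of x] by blast
  qed
  show "seg ` F = {e. \<exists>T\<in>tria ` \<tau>. e edge_of T}"
  proof -
    have "F = \<Union> (sides ` \<tau>)" using tri_sides[OF tri] ne by blast
    then show ?thesis using edges_of_trias[of \<tau>] ori by blast
  qed
qed

end

section \<open>Geometric dissections are recursive cuts\<close>

lemma orient_0_common_line:
  assumes "orient x y a = 0" "orient x y b = 0" "orient x y c = 0" "x \<noteq> y"
  shows "orient a b c = 0"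
proof -
  obtain s t u where abc: "a = (1 - s) *\<^sub>R x + s *\<^sub>R y" "b = (1 - t) *\<^sub>R x + t *\<^sub>R y"
    "c = (1 - u) *\<^sub>R x + u *\<^sub>R y"
    using assms orient_0_param by metis
  show ?thesis unfolding abc by (simp add: orient_def algebra_simps)
qed

lemma sorted_triple:
  fixes a b c :: nat
  assumes "a \<noteq> b" "b \<noteq> c" "a \<noteq> c"
  obtains x y z where "{a, b, c} = {x, y, z}" "x < y" "y < z"
proof -
  have "\<exists>x y z. {a, b, c} = {x, y, z} \<and> x < y \<and> y < z"
  proof (cases a b rule: linorder_cases)
    case less
    consider "c < a" | "a < c" "c < b" | "b < c" using assms by linarith
    then show ?thesis
      by cases (use less in \<open>blast intro: exI[of _ c] exI[of _ a] exI[of _ b]\<close>)+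
  next
    case greater
    consider "c < b" | "b < c" "c < a" | "a < c" using assms by linarith
    then show ?thesis
      by cases (use greater in \<open>blast intro: exI[of _ c] exI[of _ a] exI[of _ b]\<close>)+
  qed (use assms in simp)
  then show ?thesis using that by blast
qed

context subdivided_polygon
begin

text \<open>These properties of a dissection pass to the pieces on both sides of an apex triangle.
  With triangles as increasing index triples, the induction on \<open>j - i\<close> never has to
  return to sets of segments.\<close>

definition index_dissection :: "nat \<Rightarrow> nat \<Rightarrow> (nat \<times> nat \<times> nat) set \<Rightarrow> bool" where
  "index_dissection i j \<tau> \<longleftrightarrow>
     (\<forall>a b c. (a, b, c) \<in> \<tau> \<longrightarrow> i \<le> a \<and> a < b \<and> b < c \<and> c \<le> j \<and> nonflat n K a b c) \<and>
     (\<forall>a b l. (a, b) \<in> \<Union> (sides ` \<tau>) \<longrightarrow> i \<le> l \<longrightarrow> l \<le> j \<longrightarrow> p l \<notin> open_segment (p a) (p b)) \<and>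
     (\<forall>a b c d. (a, b) \<in> \<Union> (sides ` \<tau>) \<longrightarrow> (c, d) \<in> \<Union> (sides ` \<tau>) \<longrightarrow> (a, b) \<noteq> (c, d) \<longrightarrow>
        open_segment (p a) (p b) \<inter> open_segment (p c) (p d) = {}) \<and>
     convex hull (chain i j) \<subseteq> \<Union> (tria ` \<tau>)"

lemma dissection_vertices:
  assumes "E \<subseteq> segments_of (chain i j)" "closed_segment A B \<in> E"
  obtains a b where "A = p a" "B = p b" "i \<le> a" "a \<le> j" "i \<le> b" "b \<le> j"
proof -
  obtain x y where "closed_segment A B = closed_segment x y" "x \<in> chain i j" "y \<in> chain i j"
    using assms unfolding segments_of_def by blast
  then have "A \<in> chain i j" "B \<in> chain i j" by (auto simp: doubleton_eq_iff)
  then show ?thesis unfolding chain_def using that by (meson atLeastAtMost_iff imageE)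
qed

text \<open>Two closed segments agree only if their ends do, so the triangle sides in
  \<open>E\<close> end in the chain and the vertices get indices, which are then sorted.
  \<open>D_flat\<close> turns nonzero orientation into \<open>nonflat\<close>.\<close>

lemma dissection_index:
  assumes dis: "triangle_dissection (chain i j) E" and jn: "j < n"
  obtains \<tau> where "index_dissection i j \<tau>" "E = seg ` (\<Union> (sides ` \<tau>))"
proof -
  note d = dis[unfolded triangle_dissection_def]
  have E: "E \<subseteq> segments_of (chain i j)" "noncrossing E" using d by blast+
  obtain \<T> where d': "(\<forall>T\<in>\<T>. 2 simplex T) \<and> pairwise (\<lambda>T U. interior T \<inter> interior U = {}) \<T> \<and>
      \<Union>\<T> = convex hull (chain i j) \<and> E = {e. \<exists>T\<in>\<T>. e edge_of T}"
    using d[THEN conjunct2, THEN conjunct2] by (rule exE)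
  have T: "\<And>T. T \<in> \<T> \<Longrightarrow> 2 simplex T" "\<Union>\<T> = convex hull (chain i j)" using d' by blast+
  have ET: "E = {e. \<exists>T\<in>\<T>. e edge_of T}" using d' by (elim conjE)
  define \<tau> where "\<tau> = {(a, b, c). i \<le> a \<and> a < b \<and> b < c \<and> c \<le> j \<and>
    orient (p a) (p b) (p c) \<noteq> 0 \<and> tria (a, b, c) \<in> \<T>}"
  have "T \<in> tria ` \<tau>" if TT: "T \<in> \<T>" for T
  proof -
    obtain A B C where ABC: "orient A B C \<noteq> 0" "T = convex hull {A, B, C}"
      using T(1)[OF TT] simplex_2_iff by blast
    have edges: "closed_segment A B \<in> E" "closed_segment B C \<in> E"
      using edge_of_triangle_iff[OF ABC(1)] TT ET ABC(2) by blast+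
    obtain a b where ab: "A = p a" "B = p b" "i \<le> a" "a \<le> j" "i \<le> b" "b \<le> j"
      using dissection_vertices[OF E(1) edges(1)] by blast
    obtain c where c: "C = p c" "i \<le> c" "c \<le> j"
      using dissection_vertices[OF E(1) edges(2)] by metis
    have "a \<noteq> b" "b \<noteq> c" "a \<noteq> c" using orient_distinct[OF ABC(1)] ab c by auto
    then obtain x y z where xyz: "{a, b, c} = {x, y, z}" "x < y" "y < z" by (rule sorted_triple)
    have "p ` {a, b, c} = p ` {x, y, z}" using xyz(1) by simp
    then have ABCxyz: "{A, B, C} = {p x, p y, p z}" using ab c by simp
    have "x \<in> {a, b, c}" "y \<in> {a, b, c}" "z \<in> {a, b, c}" using xyz(1) by auto
    then have le: "i \<le> x" "z \<le> j" using ab c by auto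
    have "tria (x, y, z) = T" using ABC(2) ABCxyz by (simp add: tria_def)
    moreover have "orient (p x) (p y) (p z) \<noteq> 0"
      using ABC(1) ABCxyz orient_0_iff_collinear by metis
    ultimately have "(x, y, z) \<in> \<tau>" using le xyz TT by (simp add: \<tau>_def)
    then show ?thesis using \<open>tria (x, y, z) = T\<close> by blast
  qed
  moreover have "tria ` \<tau> \<subseteq> \<T>" by (auto simp: \<tau>_def)
  ultimately have img: "tria ` \<tau> = \<T>" by blast
  have Eseg: "E = seg ` (\<Union> (sides ` \<tau>))"
    unfolding ET img[symmetric] by (rule edges_of_trias) (simp add: \<tau>_def)
  have side: "i \<le> a \<and> a < b \<and> b \<le> j" if "(a, b) \<in> \<Union> (sides ` \<tau>)" for a b
    using that by (auto simp: \<tau>_def sides_def)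
  have segE: "closed_segment (p a) (p b) \<in> E" if "(a, b) \<in> \<Union> (sides ` \<tau>)" for a b
    using that image_eqI[of _ seg "(a, b)"] by (simp add: Eseg seg_def)
  have 1: "i \<le> a \<and> a < b \<and> b < c \<and> c \<le> j \<and> nonflat n K a b c" if "(a, b, c) \<in> \<tau>" for a b c
  proof -
    have "i \<le> a \<and> a < b \<and> b < c \<and> c \<le> j" "orient (p a) (p b) (p c) \<noteq> 0"
      using that by (auto simp: \<tau>_def)
    moreover from this have "nonflat n K a b c"
      using D_flat[of a b c] jn eps_nz by (auto simp: D_def)
    ultimately show ?thesis by simp
  qed
  have 2: "p l \<notin> open_segment (p a) (p b)" if ab: "(a, b) \<in> \<Union> (sides ` \<tau>)" and l: "i \<le> l" "l \<le> j" for a b l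
  proof -
    obtain x y where "closed_segment (p a) (p b) = closed_segment x y" "open_segment x y \<inter> chain i j = {}"
      using segE[OF ab] E(1) unfolding segments_of_def by blast
    then have "open_segment (p a) (p b) \<inter> chain i j = {}"
      by (auto simp: doubleton_eq_iff open_segment_commute)
    then show ?thesis using l by (auto simp: chain_def)
  qed
  have 3: "open_segment (p a) (p b) \<inter> open_segment (p c) (p d) = {}"
    if ab: "(a, b) \<in> \<Union> (sides ` \<tau>)" and cd: "(c, d) \<in> \<Union> (sides ` \<tau>)" and ne: "(a, b) \<noteq> (c, d)" for a b c d
  proof -
    have lt: "a < b" "b < n" "c < d" "d < n" using side[OF ab] side[OF cd] jn by auto
    have "closed_segment (p a) (p b) \<noteq> closed_segment (p c) (p d)"
      using seg_eq_iff[OF lt] ne by (simp add: seg_def)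
    then have "rel_interior (closed_segment (p a) (p b)) \<inter> rel_interior (closed_segment (p c) (p d)) = {}"
      using E(2) segE[OF ab] segE[OF cd] unfolding noncrossing_def pairwise_def by blast
    then show ?thesis using p_neq lt by (simp add: rel_interior_closed_segment)
  qed
  have "index_dissection i j \<tau>"
    unfolding index_dissection_def img T(2) using 1 2 3 by blast
  then show ?thesis using that Eseg by blast
qed

context
  fixes i j \<tau>
  assumes dis: "index_dissection i j \<tau>" and base: "proper_base i j"
begin

lemma base_less: "i < j" "j < n"
  using base by (auto simp: proper_base_def)

lemma dis_triple: "(a, b, c) \<in> \<tau> \<Longrightarrow> i \<le> a \<and> a < b \<and> b < c \<and> c \<le> j \<and> nonflat n K a b c"
  using dis[unfolded index_dissection_def, THEN conjunct1] by blast

lemma dis_side_free: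
  "\<lbrakk>(a, b) \<in> \<Union> (sides ` \<tau>); i \<le> l; l \<le> j\<rbrakk> \<Longrightarrow> p l \<notin> open_segment (p a) (p b)"
  using dis[unfolded index_dissection_def, THEN conjunct2, THEN conjunct1] by blast

lemma dis_disjoint:
  "\<lbrakk>(a, b) \<in> \<Union> (sides ` \<tau>); (c, d) \<in> \<Union> (sides ` \<tau>); (a, b) \<noteq> (c, d)\<rbrakk> \<Longrightarrow>
    open_segment (p a) (p b) \<inter> open_segment (p c) (p d) = {}"
  using dis[unfolded index_dissection_def, THEN conjunct2, THEN conjunct2, THEN conjunct1] by blast

lemma dis_covers: "x \<in> convex hull (chain i j) \<Longrightarrow> \<exists>t\<in>\<tau>. x \<in> tria t"
  using dis[unfolded index_dissection_def, THEN conjunct2, THEN conjunct2, THEN conjunct2] by blast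

lemma dis_side: "(a, b) \<in> \<Union> (sides ` \<tau>) \<Longrightarrow> i \<le> a \<and> a < b \<and> b \<le> j"
  by (auto simp: sides_def dest!: dis_triple)

lemma dis_no_crossing:
  assumes "(a, b) \<in> \<Union> (sides ` \<tau>)" "(c, d) \<in> \<Union> (sides ` \<tau>)"
  shows "\<not> (a < c \<and> c < b \<and> b < d)"
proof
  assume lt: "a < c \<and> c < b \<and> b < d"
  then have "open_segment (p a) (p b) \<inter> open_segment (p c) (p d) = {}"
    using dis_disjoint[OF assms] by simp
  moreover have "open_segment (p a) (p b) \<inter> open_segment (p c) (p d) \<noteq> {}"
    using lt dis_side[OF assms(1)] dis_side[OF assms(2)] base_less
      dis_side_free[OF assms(1)] dis_side_free[OF assms(2)]
    by (intro crossing_meet) auto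
  ultimately show False by blast
qed

text \<open>The chain satisfies \<open>D i j \<le> 0\<close>, with value 0 on the base. A proper
  convex combination with value 0 has both ends at 0, so the side is collinear with the base, and
  the collinear case identifies them.\<close>

lemma side_through_base:
  assumes xy: "(x, y) \<in> \<Union> (sides ` \<tau>)" and uv: "u \<ge> 0" "v \<ge> 0" "u + v = 1"
    and z: "u *\<^sub>R p x + v *\<^sub>R p y \<in> open_segment (p i) (p j)"
  shows "x = i \<and> y = j"
proof -
  note xy' = dis_side[OF xy]
  have free: "p l \<notin> open_segment (p i) (p j)" if "l \<le> j" for l
    using valid_free proper_base_valid[OF base] base_less that by simp
  have "u \<noteq> 0"
  proof
    assume "u = 0"
    then have "p y \<in> open_segment (p i) (p j)" using uv z by simp
    then show False using free xy' by blast
  qed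
  moreover have "v \<noteq> 0"
  proof
    assume "v = 0"
    then have "p x \<in> open_segment (p i) (p j)" using uv z by simp
    then show False using free[of x] xy' by simp
  qed
  ultimately have pos: "u > 0" "v > 0" using uv by auto
  have "u * D i j (p x) + v * D i j (p y) = 0"
    using D_open_segment[OF z] D_affine[OF uv(3)] by simp
  moreover have "u * D i j (p x) \<le> 0" "v * D i j (p y) \<le> 0"
    using pos D_inside[of i j x] D_inside[of i j y] xy' base_less by (auto simp: mult_nonneg_nonpos)
  ultimately have "u * D i j (p x) = 0" "v * D i j (p y) = 0" by linarith+
  then have "orient (p i) (p j) (p x) = 0" "orient (p i) (p j) (p y) = 0"
    using pos eps_nz by (auto simp: D_def)
  moreover have "u *\<^sub>R p x + v *\<^sub>R p y \<in> open_segment (p x) (p y)"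
  proof -
    have "u = 1 - v" using uv by simp
    moreover have "p x \<noteq> p y" using p_neq xy' base_less by simp
    ultimately show ?thesis using pos by (auto simp: in_segment)
  qed
  ultimately have "{p i, p j} = {p x, p y}"
    using free xy' dis_side_free[OF xy] base_less
    by (intro open_segments_meet_collinear[OF z]) auto
  then have "seg (i, j) = seg (x, y)" by (simp add: seg_def)
  then show ?thesis using seg_eq_iff[of i j x y] base_less xy' by simp
qed

text \<open>Take the triangle that covers the midpoint of the base. Its vertices off the base line
  have weight 0 there, and not all three are on the line, so the midpoint lies on a side, which is
  \<open>(i, j)\<close> by \<open>side_through_base\<close>. The order \<open>a < b < c\<close>
  leaves only the side \<open>(a, c)\<close>.\<close>

lemma base_triangle: "\<exists>m. (i, m, j) \<in> \<tau>"
proof -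
  define \<mu> where "\<mu> = (1/2) *\<^sub>R p i + (1/2) *\<^sub>R p j"
  have \<mu>: "\<mu> \<in> open_segment (p i) (p j)"
    using p_neq[of i j] base_less by (auto simp: in_segment \<mu>_def intro!: exI[of _ "1/2"])
  have "\<mu> \<in> convex hull (chain i j)"
  proof -
    have "p i \<in> convex hull (chain i j)" "p j \<in> convex hull (chain i j)"
      using base_less by (auto simp: chain_def intro!: hull_inc)
    then show ?thesis
      using \<mu> convex_contains_open_segment[of "convex hull (chain i j)"] by auto
  qed
  then obtain t where t: "t \<in> \<tau>" "\<mu> \<in> tria t" using dis_covers by blast
  obtain a b c where abc: "t = (a, b, c)" by (cases t)
  note tr = dis_triple[OF t(1)[unfolded abc]]
  obtain u v w where uvw: "0 \<le> u" "0 \<le> v" "0 \<le> w" "u + v + w = 1"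
      "\<mu> = u *\<^sub>R p a + v *\<^sub>R p b + w *\<^sub>R p c"
    using t(2) unfolding abc tria_def prod.case convex_hull_3 by blast
  have le: "D i j (p x) \<le> 0" if "i \<le> x" "x \<le> j" for x using D_inside base_less that by simp
  have "u * D i j (p a) + v * D i j (p b) + w * D i j (p c) = 0"
    using D_open_segment[OF \<mu>] D_affine3[OF uvw(4)] uvw(5) by simp
  moreover have "u * D i j (p a) \<le> 0" "v * D i j (p b) \<le> 0" "w * D i j (p c) \<le> 0"
    using le[of a] le[of b] le[of c] tr uvw by (auto intro!: mult_nonneg_nonpos)
  ultimately have zero: "u * D i j (p a) = 0" "v * D i j (p b) = 0" "w * D i j (p c) = 0"
    by linarith+
  have sides: "(a, b) \<in> \<Union> (sides ` \<tau>)" "(b, c) \<in> \<Union> (sides ` \<tau>)" "(a, c) \<in> \<Union> (sides ` \<tau>)"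
    using t abc by (force simp: sides_def)+
  have "\<not> (D i j (p a) = 0 \<and> D i j (p b) = 0 \<and> D i j (p c) = 0)"
  proof
    assume "D i j (p a) = 0 \<and> D i j (p b) = 0 \<and> D i j (p c) = 0"
    then have "orient (p a) (p b) (p c) = 0"
      using orient_0_common_line[of "p i" "p j"] p_neq base_less eps_nz by (simp add: D_def)
    then show False using orient_triple[of a b c] tr base_less by simp
  qed
  then consider "u = 0" | "v = 0" | "w = 0" using zero by auto
  then show ?thesis
  proof cases
    case 1
    then have "b = i \<and> c = j" using side_through_base[OF sides(2)] uvw \<mu> by simp
    then show ?thesis using tr by simp
  next
    case 2
    then have "a = i \<and> c = j" using side_through_base[OF sides(3)] uvw \<mu> by simp
    then show ?thesis using t abc by blast
  next
    case 3
    then have "a = i \<and> b = j" using side_through_base[OF sides(1)] uvw \<mu> by simp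
    then show ?thesis using tr by simp
  qed
qed

text \<open>If \<open>a < m < c\<close>, the side \<open>(a, c)\<close> avoids crossing
  \<open>(i, m)\<close> and \<open>(m, j)\<close> only by being the base itself; then
  \<open>b\<close> on either side of \<open>m\<close> produces a crossing.\<close>

lemma split_at_apex:
  assumes m: "(i, m, j) \<in> \<tau>" and t: "(a, b, c) \<in> \<tau>"
  shows "(a, b, c) = (i, m, j) \<or> c \<le> m \<or> m \<le> a"
proof (rule ccontr)
  assume not: "\<not> ((a, b, c) = (i, m, j) \<or> c \<le> m \<or> m \<le> a)"
  have s: "(a, b) \<in> \<Union> (sides ` \<tau>)" "(b, c) \<in> \<Union> (sides ` \<tau>)" "(a, c) \<in> \<Union> (sides ` \<tau>)"
    "(i, m) \<in> \<Union> (sides ` \<tau>)" "(m, j) \<in> \<Union> (sides ` \<tau>)"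
    using m t by (force simp: sides_def)+
  note tr = dis_triple[OF t] dis_triple[OF m]
  have "a = i" using dis_no_crossing[OF s(4) s(3)] tr not by linarith
  moreover have "c = j" using dis_no_crossing[OF s(3) s(5)] tr not by linarith
  moreover have "\<not> b < m" using dis_no_crossing[OF s(4) s(2)] tr \<open>a = i\<close> \<open>c = j\<close> by linarith
  moreover have "\<not> m < b" using dis_no_crossing[OF s(1) s(5)] tr \<open>a = i\<close> \<open>c = j\<close> by linarith
  ultimately show False using not by simp
qed

lemma finite_dis: "finite \<tau>"
  by (rule finite_subset[of _ "{..j} \<times> {..j} \<times> {..j}"]) (auto dest!: dis_triple)

text \<open>The part of the hull strictly beyond the chord \<open>(s, e)\<close> is covered by \<open>\<tau>'\<close>, and it is dense
  in the hull of the chain from \<open>s\<close> to \<open>e\<close>.\<close>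

lemma part_covers:
  assumes se: "i \<le> s" "s < l" "l < e" "e \<le> j" and l: "nonflat n K s l e"
    and \<tau>': "\<tau>' \<subseteq> \<tau>" "\<And>t x. t \<in> \<tau> - \<tau>' \<Longrightarrow> x \<in> tria t \<Longrightarrow> D s e x \<ge> 0"
  shows "convex hull (chain s e) \<subseteq> \<Union> (tria ` \<tau>')"
proof
  fix x assume x: "x \<in> convex hull (chain s e)"
  have l_in: "p l \<in> convex hull (chain s e)" using se by (auto simp: chain_def intro!: hull_inc)
  have sub: "convex hull (chain s e) \<subseteq> convex hull (chain i j)"
    using se by (intro hull_mono) (auto simp: chain_def)
  have open_part: "y \<in> \<Union> (tria ` \<tau>')" if y: "y \<in> convex hull (chain s e)" "D s e y < 0" for y
  proof -
    obtain t where t: "t \<in> \<tau>" "y \<in> tria t"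
      using dis_covers y(1) sub by blast
    then have "t \<in> \<tau>'" using \<tau>'(2)[of t y] y(2) by force
    then show ?thesis using t by blast
  qed
  have "D e s x \<ge> 0"
  proof (rule hull_D_nonneg[OF _ x])
    fix y assume "y \<in> chain s e"
    then show "D e s y \<ge> 0" using D_inside_rev[of s e] se base_less by (auto simp: chain_def)
  qed
  then have Dx: "D s e x \<le> 0" using D_swap(1)[of s e x] by simp
  have Dl: "D s e (p l) < 0" using D_pos[of s l e] D_swap(2)[of s l e] l se base_less by simp
  \<comment> \<open>\<open>f\<close> runs from \<open>x\<close> to \<open>p l\<close>, which is
    strictly beyond the chord; \<open>x\<close> is recovered as the limit at 0.\<close>
  define f where "f = (\<lambda>u::real. (1 - u) *\<^sub>R x + u *\<^sub>R p l)"
  have "f u \<in> \<Union> (tria ` \<tau>')" if u: "0 < u" "u < 1" for u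
  proof (rule open_part)
    show "f u \<in> convex hull (chain s e)"
      unfolding f_def using x l_in u by (intro convexD) auto
    have "D s e (f u) = (1 - u) * D s e x + u * D s e (p l)" unfolding f_def by (simp add: D_affine)
    also have "\<dots> < 0" using Dx Dl u by (intro add_nonpos_neg mult_nonneg_nonpos mult_pos_neg) auto
    finally show "D s e (f u) < 0" .
  qed
  then have "\<forall>\<^sub>F u in at_right 0. f u \<in> \<Union> (tria ` \<tau>')"
    unfolding eventually_at_right_field by (intro exI[of _ 1]) auto
  moreover have "(f \<longlongrightarrow> (1 - 0) *\<^sub>R x + 0 *\<^sub>R p l) (at_right 0)"
    unfolding f_def by (intro tendsto_intros)
  moreover have "closed (\<Union> (tria ` \<tau>'))"
  proof (rule closed_Union)
    show "finite (tria ` \<tau>')" using finite_dis \<tau>'(1) finite_subset by blast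
    show "\<forall>T\<in>tria ` \<tau>'. closed T"
      by (auto simp: tria_def intro!: compact_imp_closed finite_imp_compact_convex_hull)
  qed
  ultimately show "x \<in> \<Union> (tria ` \<tau>')"
    using Lim_in_closed_set[of "\<Union> (tria ` \<tau>')" f "at_right 0" x] by simp
qed

end


text \<open>\<open>base_triangle\<close> gives the apex, \<open>split_at_apex\<close> divides the
  remaining triangles, and \<open>part_covers\<close> shows that each part still covers its own
  polygon, so that it is an \<open>index_dissection\<close> again.\<close>

lemma index_dissection_tri:
  assumes "index_dissection i j \<tau>" "proper_base i j"
  shows "tri n K i j (insert (i, j) (\<Union> (sides ` \<tau>))) \<tau>"
  using assms
proof (induction "j - i" arbitrary: i j \<tau> rule: less_induct)
  case less
  note dis = less.prems
  obtain m where m: "(i, m, j) \<in> \<tau>" using base_triangle[OF dis] by blast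
  have imj: "i < m" "m < j" "j < n" "nonflat n K i m j"
    using dis_triple[OF dis m] base_less[OF dis] by auto
  have side_free: "p l \<notin> open_segment (p i) (p m)" "p l \<notin> open_segment (p m) (p j)"
    if "i \<le> l" "l \<le> j" for l
    using dis_side_free[OF dis _ that] m by (force simp: sides_def)+
  define \<tau>1 where "\<tau>1 = {(a, b, c) \<in> \<tau>. c \<le> m}"
  define \<tau>2 where "\<tau>2 = {(a, b, c) \<in> \<tau>. m \<le> a}"
  have sub: "\<tau>1 \<subseteq> \<tau>" "\<tau>2 \<subseteq> \<tau>" by (auto simp: \<tau>1_def \<tau>2_def)
  have split: "\<tau> = insert (i, m, j) (\<tau>1 \<union> \<tau>2)"
    using split_at_apex[OF dis m] m by (force simp: \<tau>1_def \<tau>2_def)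
  have sub_dissection: "index_dissection s e \<tau>'"
    if \<tau>': "\<tau>' \<subseteq> \<tau>" "\<And>a b c. (a, b, c) \<in> \<tau>' \<Longrightarrow> s \<le> a \<and> c \<le> e"
      and se: "i \<le> s" "e \<le> j" and cov: "convex hull (chain s e) \<subseteq> \<Union> (tria ` \<tau>')" for s e \<tau>'
  proof -
    have "\<Union> (sides ` \<tau>') \<subseteq> \<Union> (sides ` \<tau>)" using \<tau>'(1) by blast
    then have "(a, b) \<in> \<Union> (sides ` \<tau>') \<Longrightarrow> (a, b) \<in> \<Union> (sides ` \<tau>)" for a b by blast
    then show ?thesis
      unfolding index_dissection_def using cov \<tau>' se dis_triple[OF dis] dis_side_free[OF dis] dis_disjoint[OF dis]
      by (intro conjI allI impI) (meson order_trans subsetD)+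
  qed
  have far1: "D i m x \<ge> 0" if "t \<in> \<tau> - \<tau>1" "x \<in> tria t" for t x
  proof -
    obtain a b c where t: "t = (a, b, c)" by (cases t)
    then have "(a, b, c) = (i, m, j) \<or> m \<le> a" "i \<le> a \<and> a < b \<and> b < c \<and> c \<le> j"
      using that split_at_apex[OF dis m, of a b c] dis_triple[OF dis, of a b c] by (auto simp: \<tau>1_def)
    then show ?thesis using that(2) imj unfolding t
      by - (rule tria_D_nonneg[of i m a b c], auto intro!: D_outside)
  qed
  have far2: "D m j x \<ge> 0" if "t \<in> \<tau> - \<tau>2" "x \<in> tria t" for t x
  proof -
    obtain a b c where t: "t = (a, b, c)" by (cases t)
    then have "(a, b, c) = (i, m, j) \<or> c \<le> m" "i \<le> a \<and> a < b \<and> b < c \<and> c \<le> j"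
      using that split_at_apex[OF dis m, of a b c] dis_triple[OF dis, of a b c] by (auto simp: \<tau>2_def)
    then show ?thesis using that(2) imj unfolding t
      by - (rule tria_D_nonneg[of m j a b c], auto intro!: D_outside)
  qed
  have T1: "tri n K i m (insert (i, m) (\<Union> (sides ` \<tau>1))) \<tau>1"
  proof (cases "m = Suc i")
    case True
    then have "\<tau>1 = {}" using dis_triple[OF dis] by (fastforce simp: \<tau>1_def)
    then show ?thesis using True tri.edge by simp
  next
    case False
    \<comment> \<open>Without a corner in between, the point \<open>Suc i\<close> would lie inside
      the side \<open>(i, m)\<close> of the apex triangle.\<close>
    have sep: "separated K i m"
      using same_side[of i "Suc i" m] side_free(1)[of "Suc i"] False imj by fastforce
    then have pb: "proper_base i m" using imj by (auto simp: proper_base_def nonflat_def)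
    have nf: "nonflat n K i (Suc i) m" using sep corners(2) by (simp add: nonflat_def)
    have "index_dissection i m \<tau>1"
    proof (rule sub_dissection)
      show "convex hull (chain i m) \<subseteq> \<Union> (tria ` \<tau>1)"
        by (rule part_covers[OF dis _ _ _ _ nf]) (use imj False sub far1 in auto)
      show "i \<le> a \<and> c \<le> m" if "(a, b, c) \<in> \<tau>1" for a b c
        using that dis_triple[OF dis, of a b c] by (auto simp: \<tau>1_def)
    qed (use sub imj in auto)
    then show ?thesis using less.hyps[of m i \<tau>1] pb imj by simp
  qed
  have T2: "tri n K m j (insert (m, j) (\<Union> (sides ` \<tau>2))) \<tau>2"
  proof (cases "j = Suc m")
    case True
    then have "\<tau>2 = {}" using dis_triple[OF dis] by (fastforce simp: \<tau>2_def)
    then show ?thesis using True tri.edge by simp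
  next
    case False
    have sep: "separated K m j"
      using same_side[of m "Suc m" j] side_free(2)[of "Suc m"] False imj by fastforce
    then have pb: "proper_base m j" using imj by (auto simp: proper_base_def)
    have nf: "nonflat n K m (Suc m) j" using sep imj by (simp add: nonflat_def)
    have "index_dissection m j \<tau>2"
    proof (rule sub_dissection)
      show "convex hull (chain m j) \<subseteq> \<Union> (tria ` \<tau>2)"
        by (rule part_covers[OF dis _ _ _ _ nf]) (use imj False sub far2 in auto)
      show "m \<le> a \<and> c \<le> j" if "(a, b, c) \<in> \<tau>2" for a b c
        using that dis_triple[OF dis, of a b c] by (auto simp: \<tau>2_def)
    qed (use sub imj in auto)
    then show ?thesis using less.hyps[of j m \<tau>2] pb imj by simp
  qed
  have "insert (i, j) (\<Union> (sides ` \<tau>)) =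
      insert (i, j) (insert (i, m) (\<Union> (sides ` \<tau>1)) \<union> insert (m, j) (\<Union> (sides ` \<tau>2)))"
    unfolding split by (auto simp: sides_def)
  then show ?case using tri.apex[OF imj(1,2,4) T1 T2] split by simp
qed

lemma triangle_dissection_chain:
  assumes "proper_base i j"
  shows "triangle_dissection (chain i j) E \<longleftrightarrow> E \<in> (`) seg ` tri_sets n K i j"
proof
  assume "triangle_dissection (chain i j) E"
  moreover have "j < n" using assms by (simp add: proper_base_def)
  ultimately obtain \<tau> where \<tau>: "index_dissection i j \<tau>" "E = seg ` (\<Union> (sides ` \<tau>))"
    by (rule dissection_index)
  note t = index_dissection_tri[OF \<tau>(1) assms]
  have "insert (i, j) (\<Union> (sides ` \<tau>)) = \<Union> (sides ` \<tau>)"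
    using tri_sides[OF t] proper_base_less[OF assms] by blast
  then show "E \<in> (`) seg ` tri_sets n K i j" using t \<tau>(2) by (auto simp: tri_sets_def)
next
  assume "E \<in> (`) seg ` tri_sets n K i j"
  then show "triangle_dissection (chain i j) E"
    using tri_dissection[OF _ assms] by (auto simp: tri_sets_def)
qed

lemma inj_on_seg: "inj_on seg (pairs 0 (n - 1))"
proof (rule inj_onI)
  fix e f assume "e \<in> pairs 0 (n - 1)" "f \<in> pairs 0 (n - 1)" "seg e = seg f"
  moreover obtain a b c d where "e = (a, b)" "f = (c, d)" by (metis surj_pair)
  ultimately show "e = f" using seg_eq_iff[of a b c d] n3 by (auto simp: pairs_def)
qed

theorem num_triangulations_eq: "num_triangulations (p ` {..<n}) = card (tri_sets n K 0 (n - 1))"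
proof -
  have base: "proper_base 0 (n - 1)" using n3 corners by (simp add: proper_base_def)
  have S: "p ` {..<n} = chain 0 (n - 1)"
    unfolding chain_def by (rule arg_cong[of _ _ "\<lambda>A. p ` A"]) (use n3 in auto)
  have sub: "F \<subseteq> pairs 0 (n - 1)" if "F \<in> tri_sets n K 0 (n - 1)" for F
    using that by (auto simp: tri_sets_def dest: tri_pairs)
  have inj: "inj_on ((`) seg) (tri_sets n K 0 (n - 1))"
    using inj_on_seg sub by (intro inj_onI) (meson inj_on_image_eq_iff)
  have "E' = E" if E: "E \<in> (`) seg ` tri_sets n K 0 (n - 1)" and E': "E' \<in> (`) seg ` tri_sets n K 0 (n - 1)"
    and EE: "E \<subseteq> E'" for E E'
  proof -
    obtain F F' where F: "F \<in> tri_sets n K 0 (n - 1)" "E = seg ` F" "F' \<in> tri_sets n K 0 (n - 1)" "E' = seg ` F'"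
      using E E' by blast
    have "F \<subseteq> F'" using EE inj_on_image_subset_iff[OF inj_on_seg sub[OF F(1)] sub[OF F(3)]] F(2,4) by simp
    moreover obtain \<tau> \<tau>' where "tri n K 0 (n - 1) F \<tau>" "tri n K 0 (n - 1) F' \<tau>'"
      using F(1,3) by (auto simp: tri_sets_def)
    ultimately show ?thesis using F(2,4) tri_subset_eq by blast
  qed
  then have "triangulations_of (chain 0 (n - 1)) = (`) seg ` tri_sets n K 0 (n - 1)"
    unfolding triangulations_of_def triangle_dissection_chain[OF base] by blast
  then show ?thesis unfolding num_triangulations_def S using card_image[OF inj] by simp
qed

end

section \<open>The Catalan functional\<close>

text \<open>At a point that is not a corner, the subtracted term removes the triangulations in which the
  two edges at that point belong to a (flat) triangle.\<close>

fun chain_poly :: "nat set \<Rightarrow> nat \<Rightarrow> nat \<Rightarrow> real poly" where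
  "chain_poly K a 0 = 1"
| "chain_poly K a (Suc 0) = [:0, 1:]"
| "chain_poly K a (Suc (Suc d)) =
     [:0, 1:] * (chain_poly K a (Suc d) - (if a + Suc d \<in> K then 0 else chain_poly K a d))"

text \<open>Both factors obey the recurrence at the right end with the same correction
  \<open>\<kappa>\<close>, since \<open>chain_poly K (a + m)\<close> tests membership in
  \<open>K\<close> at the absolute position \<open>a + Suc d\<close>. Corners inside the chain
  therefore do no harm to the identity.\<close>

lemma chain_poly_half_open_sum:
  "(x - y) * (\<Sum>m<d. poly (chain_poly K a m) x * poly (chain_poly K (a + m) (d - m)) y)
    = y * (poly (chain_poly K a d) x - poly (chain_poly K a d) y)"
proof -
  define X where "X m = poly (chain_poly K a m) x" for m
  define Y where "Y m d = poly (chain_poly K (a + m) (d - m)) y" for m d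
  define F where "F d = (\<Sum>m<d. X m * Y m d)" for d
  have "(x - y) * F d = y * (X d - Y 0 d)"
  proof (induction d rule: induct_nat_012)
    case (ge2 d)
    define \<kappa> :: real where "\<kappa> = (if a + Suc d \<in> K then 0 else 1)"
    have Yrec: "Y m (Suc (Suc d)) = y * (Y m (Suc d) - \<kappa> * Y m d)" if "m \<le> d" for m
      using that by (simp add: Y_def \<kappa>_def Suc_diff_le)
    have Xrec: "X (Suc (Suc d)) = x * (X (Suc d) - \<kappa> * X d)"
      by (simp add: X_def \<kappa>_def)
    have "F (Suc (Suc d)) = (\<Sum>m<Suc d. X m * Y m (Suc (Suc d))) + X (Suc d) * y"
      by (simp add: F_def Y_def)
    also have "(\<Sum>m<Suc d. X m * Y m (Suc (Suc d))) = (\<Sum>m<Suc d. y * (X m * Y m (Suc d)) - y * \<kappa> * (X m * Y m d))"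
      by (rule sum.cong) (auto simp: Yrec algebra_simps)
    \<comment> \<open>The extra \<open>X d\<close> is the term \<open>m = d\<close>, where
      \<open>Y d d = 1\<close>.\<close>
    also have "\<dots> = y * F (Suc d) - y * \<kappa> * (F d + X d)"
      by (simp add: F_def sum_subtractf sum_distrib_left Y_def algebra_simps)
    finally have "F (Suc (Suc d)) = y * F (Suc d) - y * \<kappa> * (F d + X d) + X (Suc d) * y" .
    then have "(x - y) * F (Suc (Suc d)) = (x - y) * (y * F (Suc d) - y * \<kappa> * (F d + X d) + X (Suc d) * y)"
      by (simp only:)
    also have "\<dots> = y * ((x - y) * F (Suc d)) - y * \<kappa> * ((x - y) * F d + (x - y) * X d)
        + (x - y) * X (Suc d) * y"
      by (simp add: algebra_simps)
    also have "\<dots> = y * (X (Suc (Suc d)) - Y 0 (Suc (Suc d)))"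
      unfolding ge2 Xrec Yrec[of 0, simplified] by (simp add: algebra_simps)
    finally show ?case .
  qed (auto simp: F_def X_def Y_def algebra_simps)
  then show ?thesis by (simp add: F_def X_def Y_def)
qed

lemma chain_poly_sum:
  assumes "0 < d"
  shows "(x - y) * (\<Sum>m\<in>{0<..<d}. poly (chain_poly K a m) x * poly (chain_poly K (a + m) (d - m)) y)
    = y * poly (chain_poly K a d) x - x * poly (chain_poly K a d) y"
proof -
  have "{..<d} = insert 0 {0<..<d}" using assms by auto
  then show ?thesis using chain_poly_half_open_sum[of x y K a d] by (simp add: algebra_simps)
qed

lemma chain_poly_coeff_0: "0 < d \<Longrightarrow> coeff (chain_poly K a d) 0 = 0"
  by (induction K a d rule: chain_poly.induct) (auto simp: coeff_mult)

text \<open>This coefficient is the inhomogeneous term of \<open>shift_eval_chain_rec\<close>: 1 for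
  a single edge, -1 to cancel the flat triangle on three consecutive points.\<close>

lemma chain_poly_coeff_1:
  "coeff (chain_poly K a d) (Suc 0) = (if d = 1 then 1 else if d = 2 \<and> Suc a \<notin> K then -1 else 0)"
proof -
  consider "d = 0" | "d = 1" | e where "d = Suc (Suc e)"
    by (metis One_nat_def not0_implies_Suc)
  then show ?thesis
  proof cases
    case 3
    then show ?thesis using chain_poly_coeff_0[of e K a] by (cases e) (auto simp: coeff_pCons)
  qed (auto simp: coeff_pCons)
qed

lemma chain_poly_coeff_1_separated:
  assumes "separated K a (a + d)"
  shows "coeff (chain_poly K a d) (Suc 0) = 0"
proof -
  obtain q where q: "q \<in> K" "a < q" "q < a + d" using assms by (auto simp: separated_def)
  have "d \<noteq> 1" "d = 2 \<Longrightarrow> q = Suc a" using q by auto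
  then show ?thesis using q(1) by (auto simp: chain_poly_coeff_1)
qed

text \<open>For the Catalan sequence \<open>c\<close> and \<open>f\<close> without constant term
  this is \<open>L(x f)\<close>: it sends \<open>x ^ Suc n\<close> to \<open>c n\<close>. The factor
  \<open>x\<close> is the polynomial of the base chord, counted as a side of length 1.\<close>

definition shift_eval :: "(nat \<Rightarrow> real) \<Rightarrow> real poly \<Rightarrow> real" where
  "shift_eval c f = (\<Sum>i<degree f. coeff f (Suc i) * c i)"

lemma shift_eval_bound:
  assumes "degree f \<le> N"
  shows "shift_eval c f = (\<Sum>i<N. coeff f (Suc i) * c i)"
  unfolding shift_eval_def
  by (rule sum.mono_neutral_left) (use assms in \<open>auto simp: coeff_eq_0\<close>)

lemma shift_eval_add: "shift_eval c (f + g) = shift_eval c f + shift_eval c g"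
proof -
  define N where "N = max (degree f) (degree g)"
  have "degree (f + g) \<le> N" unfolding N_def by (rule degree_add_le_max)
  then show ?thesis
    using shift_eval_bound[of f N c] shift_eval_bound[of g N c] shift_eval_bound[of "f + g" N c]
    by (simp add: N_def sum.distrib algebra_simps)
qed

lemma shift_eval_smult: "shift_eval c (smult a f) = a * shift_eval c f"
  using shift_eval_bound[of f "degree f" c] shift_eval_bound[of "smult a f" "degree f" c]
  by (simp add: degree_smult_le sum_distrib_left mult.assoc)

lemma shift_eval_diff: "shift_eval c (f - g) = shift_eval c f - shift_eval c g"
  using shift_eval_add[of c f "smult (-1) g"] shift_eval_smult[of c "-1" g] by simp

lemma shift_eval_0 [simp]: "shift_eval c 0 = 0"
  by (simp add: shift_eval_def)

lemma shift_eval_sum: "shift_eval c (\<Sum>i\<in>I. f i) = (\<Sum>i\<in>I. shift_eval c (f i))"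
  by (induction I rule: infinite_finite_induct) (simp_all add: shift_eval_add)

lemma shift_eval_monom: "shift_eval c (monom a (Suc n)) = a * c n"
  by (cases "a = 0") (simp_all add: shift_eval_def degree_monom_eq)

text \<open>Cancelling in the polynomial ring also covers the point \<open>x = y\<close>, where the
  assumption is void.\<close>

lemma poly_eq_by_linear_factor:
  fixes f g :: "real poly"
  assumes "\<And>x. (x - y) * poly f x = (x - y) * poly g x"
  shows "f = g"
proof -
  have "poly ([:-y, 1:] * f) x = poly ([:-y, 1:] * g) x" for x
    using assms[of x] by (simp add: algebra_simps)
  then have "poly ([:-y, 1:] * f) = poly ([:-y, 1:] * g)" by (rule ext)
  then have "[:-y, 1:] * f = [:-y, 1:] * g" by (simp only: poly_eq_poly_eq_iff)
  then show ?thesis by (simp only: mult_cancel_left) simp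
qed

text \<open>For \<open>f = x ^ Suc l\<close> the right-hand side of \<open>eq\<close> divided by
  \<open>x - y\<close> is \<open>\<Sum>m<l. x ^ Suc m * y ^ (l - m)\<close>, and the functional in
  both variables turns this into \<open>\<Sum>m<l. c m * c (l - m - 1)\<close>. By the Catalan
  recursion this is \<open>c l\<close> for \<open>l > 0\<close>, but 0 instead of
  \<open>c 0 = 1\<close> for \<open>l = 0\<close>: hence the correction by the linear coefficient.
  The functional is applied in \<open>x\<close> for fixed \<open>y\<close> first, and then in
  \<open>y\<close>.\<close>

lemma convolution_polynomials:
  fixes A B :: "'i \<Rightarrow> real poly"
  assumes c: "c 0 = 1" "\<And>n. c (Suc n) = (\<Sum>i\<le>n. c i * c (n - i))"
    and f0: "coeff f 0 = 0"
    and eq: "\<And>x y. (x - y) * (\<Sum>i\<in>I. poly (A i) x * poly (B i) y) = y * poly f x - x * poly f y"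
  shows "(\<Sum>i\<in>I. shift_eval c (A i) * shift_eval c (B i)) = shift_eval c f - coeff f (Suc 0)"
proof -
  define N where "N = degree f"
  have telescope: "(x - y) * (\<Sum>m<l. x ^ Suc m * y ^ (l - m)) = y * x ^ Suc l - x * y ^ Suc l" for x y :: real and l
  proof (induction l)
    case (Suc l)
    have "(\<Sum>m<Suc l. x ^ Suc m * y ^ (Suc l - m)) = y * (\<Sum>m<l. x ^ Suc m * y ^ (l - m)) + x ^ Suc l * y"
      by (simp add: sum_distrib_left Suc_diff_le algebra_simps)
    then have "(x - y) * (\<Sum>m<Suc l. x ^ Suc m * y ^ (Suc l - m))
        = y * ((x - y) * (\<Sum>m<l. x ^ Suc m * y ^ (l - m))) + (x - y) * (x ^ Suc l * y)"
      by (simp add: algebra_simps)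
    then show ?case unfolding Suc by (simp add: algebra_simps)
  qed simp
  have pf: "poly f x = (\<Sum>l<N. coeff f (Suc l) * x ^ Suc l)" for x
    unfolding poly_altdef N_def[symmetric] by (simp add: sum.atMost_shift f0)
  have 1: "(\<Sum>i\<in>I. smult (poly (B i) y) (A i)) =
      (\<Sum>l<N. \<Sum>m<l. monom (coeff f (Suc l) * y ^ (l - m)) (Suc m))" for y
  proof (rule poly_eq_by_linear_factor[of y])
    fix x
    have "(x - y) * poly (\<Sum>l<N. \<Sum>m<l. monom (coeff f (Suc l) * y ^ (l - m)) (Suc m)) x
        = (\<Sum>l<N. coeff f (Suc l) * ((x - y) * (\<Sum>m<l. x ^ Suc m * y ^ (l - m))))"
      by (simp add: poly_sum poly_monom sum_distrib_left algebra_simps)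
    also have "\<dots> = y * poly f x - x * poly f y"
      unfolding telescope pf by (simp add: sum_distrib_left sum_subtractf algebra_simps)
    finally show "(x - y) * poly (\<Sum>i\<in>I. smult (poly (B i) y) (A i)) x =
        (x - y) * poly (\<Sum>l<N. \<Sum>m<l. monom (coeff f (Suc l) * y ^ (l - m)) (Suc m)) x"
      using eq[of x y] by (simp add: poly_sum mult.commute)
  qed
  have "(\<Sum>i\<in>I. smult (shift_eval c (A i)) (B i)) =
      (\<Sum>l<N. \<Sum>m<l. monom (coeff f (Suc l) * c m) (l - m))"
  proof (rule poly_eq_poly_eq_iff[THEN iffD1, OF ext])
    fix y
    show "poly (\<Sum>i\<in>I. smult (shift_eval c (A i)) (B i)) y =
      poly (\<Sum>l<N. \<Sum>m<l. monom (coeff f (Suc l) * c m) (l - m)) y"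
      using arg_cong[OF 1[of y], of "shift_eval c"]
      by (simp add: shift_eval_sum shift_eval_smult shift_eval_monom poly_sum poly_monom mult_ac)
  qed
  from arg_cong[OF this, of "shift_eval c"]
  have "(\<Sum>i\<in>I. shift_eval c (A i) * shift_eval c (B i)) =
      (\<Sum>l<N. \<Sum>m<l. shift_eval c (monom (coeff f (Suc l) * c m) (l - m)))"
    by (simp add: shift_eval_sum shift_eval_smult)
  also have "\<dots> = (\<Sum>l<N. coeff f (Suc l) * (\<Sum>m<l. c m * c (l - m - 1)))"
  proof (intro sum.cong refl)
    fix l
    have "shift_eval c (monom (coeff f (Suc l) * c m) (l - m)) = coeff f (Suc l) * (c m * c (l - m - 1))"
      if "m < l" for m
    proof -
      have "l - m = Suc (l - m - 1)" using that by simp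
      then show ?thesis using shift_eval_monom[of c "coeff f (Suc l) * c m" "l - m - 1"] by simp
    qed
    then show "(\<Sum>m<l. shift_eval c (monom (coeff f (Suc l) * c m) (l - m)))
        = coeff f (Suc l) * (\<Sum>m<l. c m * c (l - m - 1))"
      by (simp add: sum_distrib_left)
  qed
  also have "\<dots> = (\<Sum>l<N. coeff f (Suc l) * (c l - (if l = 0 then 1 else 0)))"
  proof (intro sum.cong refl arg_cong2[where f = "(*)"])
    fix l
    show "(\<Sum>m<l. c m * c (l - m - 1)) = c l - (if l = 0 then 1 else 0)"
      by (cases l) (simp_all add: c lessThan_Suc_atMost)
  qed
  also have "\<dots> = shift_eval c f - coeff f (Suc 0)"
  proof (cases N)
    case 0
    then show ?thesis by (simp add: shift_eval_def N_def coeff_eq_0)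
  next
    case (Suc M)
    show ?thesis unfolding shift_eval_def N_def[symmetric] Suc
      by (simp add: sum.lessThan_Suc_shift c(1) del: sum.lessThan_Suc)
  qed
  finally show ?thesis .
qed

context
  fixes c :: "nat \<Rightarrow> real"
  assumes c: "c 0 = 1" "\<And>n. c (Suc n) = (\<Sum>i\<le>n. c i * c (n - i))"
begin

lemma shift_eval_chain_rec:
  assumes "0 < d"
  shows "shift_eval c (chain_poly K a d) =
    (\<Sum>m\<in>{0<..<d}. shift_eval c (chain_poly K a m) * shift_eval c (chain_poly K (a + m) (d - m)))
    + coeff (chain_poly K a d) (Suc 0)"
  using convolution_polynomials[OF c chain_poly_coeff_0[OF assms] chain_poly_sum[OF assms]] by simp

text \<open>A flat chain of two or more edges has no triangulation, and the functional agrees: the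
  convolution contributes only for \<open>d = 2\<close>, as \<open>1 * 1\<close>, and there the
  linear coefficient -1 cancels it.\<close>

lemma shift_eval_chain_flat:
  assumes "0 < d" "\<not> separated K a (a + d)"
  shows "shift_eval c (chain_poly K a d) = (if d = 1 then 1 else 0)"
  using assms
proof (induction d arbitrary: a rule: less_induct)
  case (less d)
  have nosep: "\<not> separated K a (a + m)" "\<not> separated K (a + m) (a + m + (d - m))" if "m \<in> {0<..<d}" for m
    using less.prems that separated_mono[of K _ _ a "a + d"] by (auto dest!: separated_mono[of K _ _ a "a + d"])
  have "(\<Sum>m\<in>{0<..<d}. shift_eval c (chain_poly K a m) * shift_eval c (chain_poly K (a + m) (d - m)))
      = (\<Sum>m\<in>{0<..<d}. (if m = 1 then 1 else 0) * (if d - m = 1 then 1 else 0))"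
    by (intro sum.cong refl arg_cong2[where f = "(*)"] less.IH) (use nosep in auto)
  also have "\<dots> = (\<Sum>m\<in>{0<..<d}. if m = 1 then (if d = 2 then 1 else 0) else 0)"
    by (intro sum.cong refl) auto
  also have "\<dots> = (if d = 2 then 1 else 0)" by (auto simp: sum.delta)
  finally have "shift_eval c (chain_poly K a d) = (if d = 2 then 1 else 0) + coeff (chain_poly K a d) (Suc 0)"
    using shift_eval_chain_rec[OF less.prems(1)] by simp
  moreover have "Suc a \<notin> K" if "d = 2" using less.prems that by (auto simp: separated_def)
  ultimately show ?case by (auto simp: chain_poly_coeff_1)
qed

lemma card_tri_sets_chain_poly:
  assumes "i < j" "j \<le> n" "i = 0 \<longrightarrow> separated K j n"
  shows "real (card (tri_sets n K i j)) = shift_eval c (chain_poly K i (j - i))"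
  using assms
proof (induction "j - i" arbitrary: i j rule: less_induct)
  case less
  show ?case
  proof (cases "j = Suc i")
    case True
    then show ?thesis by (simp add: tri_sets_Suc shift_eval_def c)
  next
    case False
    then have ij: "Suc i < j" using less.prems by simp
    show ?thesis
    proof (cases "separated K i j")
      case False
      then have none: "{m. i < m \<and> m < j \<and> nonflat n K i m j} = {}" by (auto simp: nonflat_def)
      have "card (tri_sets n K i j) = 0" unfolding card_tri_sets[OF ij] none by simp
      moreover have "shift_eval c (chain_poly K i (j - i)) = 0"
        using shift_eval_chain_flat[of "j - i" K i] False ij by auto
      ultimately show ?thesis by simp
    next
      case True
      have "{m. i < m \<and> m < j \<and> nonflat n K i m j} = {i<..<j}"
        using True less.prems separated_mono[of K j n] by (auto simp: nonflat_def)
      then have "real (card (tri_sets n K i j)) =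
          (\<Sum>m\<in>{i<..<j}. real (card (tri_sets n K i m)) * real (card (tri_sets n K m j)))"
        by (simp add: card_tri_sets[OF ij])
      also have "\<dots> = (\<Sum>m\<in>{i<..<j}. shift_eval c (chain_poly K i (m - i)) * shift_eval c (chain_poly K m (j - m)))"
      proof (intro sum.cong refl arg_cong2[where f = "(*)"])
        fix m assume m: "m \<in> {i<..<j}"
        show "real (card (tri_sets n K i m)) = shift_eval c (chain_poly K i (m - i))"
          using m less.prems separated_mono[of K j n m n] by (intro less.hyps) auto
        show "real (card (tri_sets n K m j)) = shift_eval c (chain_poly K m (j - m))"
          using m less.prems by (intro less.hyps) auto
      qed
      also have "\<dots> = (\<Sum>m\<in>{0<..<j - i}. shift_eval c (chain_poly K i m) * shift_eval c (chain_poly K (i + m) (j - i - m)))"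
        by (rule sum.reindex_bij_witness[of _ "\<lambda>m. i + m" "\<lambda>m. m - i"]) auto
      also have "\<dots> = shift_eval c (chain_poly K i (j - i))"
        using shift_eval_chain_rec[of "j - i" K i] chain_poly_coeff_1_separated[of K i "j - i"] True ij
        by simp
      finally show ?thesis .
    qed
  qed
qed

text \<open>At the top level the base \<open>(0, n - 1)\<close> lies on the last side, so the apexes on that side
  are excluded; of these only the neighbour of \<open>n - 1\<close> would have contributed. This turns
  the chain of length \<open>n - 1\<close> into the closed chain of length \<open>n\<close>.\<close>

lemma card_tri_sets_closed:
  assumes "separated K 0 (n - 1)"
  obtains g where "coeff g 0 = 0" "chain_poly K 0 n = [:0, 1:] * g"
    "real (card (tri_sets n K 0 (n - 1))) = shift_eval c g"
proof -
  obtain q where q: "q \<in> K" "0 < q" "q < n - 1" using assms by (auto simp: separated_def)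
  then obtain d where d: "n = Suc (Suc d)" "0 < d" using that[of "n - 2"] by simp
  \<comment> \<open>If the point \<open>n - 1 = Suc d\<close> is a corner, the last side has no
    inner point and no apex is excluded.\<close>
  define \<kappa> :: real where "\<kappa> = (if Suc d \<in> K then 0 else 1)"
  define L where "L m = shift_eval c (chain_poly K 0 m) * shift_eval c (chain_poly K m (Suc d - m))" for m
  have sep1: "separated K m n \<longleftrightarrow> separated K m (Suc d) \<or> Suc d \<in> K" if "m < Suc d" for m
    using that by (auto simp: separated_def d less_Suc_eq intro: bexI[of _ "Suc d"])
  have "{m. 0 < m \<and> m < Suc d \<and> nonflat n K 0 m (Suc d)} = {m \<in> {0<..<Suc d}. separated K m n}"
    using assms by (auto simp: nonflat_def d)
  then have "real (card (tri_sets n K 0 (Suc d))) =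
      (\<Sum>m | m \<in> {0<..<Suc d} \<and> separated K m n. real (card (tri_sets n K 0 m)) * real (card (tri_sets n K m (Suc d))))"
    using card_tri_sets[of 0 "Suc d" n K] d by simp
  also have "\<dots> = (\<Sum>m | m \<in> {0<..<Suc d} \<and> separated K m n. L m)"
  proof (intro sum.cong refl)
    fix m assume m: "m \<in> {m \<in> {0<..<Suc d}. separated K m n}"
    then have "real (card (tri_sets n K 0 m)) = shift_eval c (chain_poly K 0 (m - 0))"
      using d by (intro card_tri_sets_chain_poly) auto
    moreover have "real (card (tri_sets n K m (Suc d))) = shift_eval c (chain_poly K m (Suc d - m))"
      using m d by (intro card_tri_sets_chain_poly) auto
    ultimately show "real (card (tri_sets n K 0 m)) * real (card (tri_sets n K m (Suc d))) = L m"
      by (simp add: L_def)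
  qed
  also have "\<dots> = (\<Sum>m\<in>{0<..<Suc d}. L m) - (\<Sum>m | m \<in> {0<..<Suc d} \<and> \<not> separated K m n. L m)"
  proof -
    have un: "{0<..<Suc d} = {m \<in> {0<..<Suc d}. separated K m n} \<union> {m \<in> {0<..<Suc d}. \<not> separated K m n}"
      by blast
    have "sum L {0<..<Suc d} = sum L {m \<in> {0<..<Suc d}. separated K m n} + sum L {m \<in> {0<..<Suc d}. \<not> separated K m n}"
      by (subst un, rule sum.union_disjoint) auto
    then show ?thesis by simp
  qed
  also have "(\<Sum>m | m \<in> {0<..<Suc d} \<and> \<not> separated K m n. L m) = \<kappa> * shift_eval c (chain_poly K 0 d)"
  proof -
    have "(\<Sum>m | m \<in> {0<..<Suc d} \<and> \<not> separated K m n. L m) =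
        (\<Sum>m | m \<in> {0<..<Suc d} \<and> \<not> separated K m n. if m = d then shift_eval c (chain_poly K 0 d) else 0)"
    proof (intro sum.cong refl)
      fix m assume "m \<in> {m \<in> {0<..<Suc d}. \<not> separated K m n}"
      then show "L m = (if m = d then shift_eval c (chain_poly K 0 d) else 0)"
        using shift_eval_chain_flat[of "Suc d - m" K m] sep1[of m] by (auto simp: L_def)
    qed
    also have "\<dots> = \<kappa> * shift_eval c (chain_poly K 0 d)"
      using d sep1[of d] by (auto simp: sum.delta \<kappa>_def) (auto simp: separated_def)
    finally show ?thesis .
  qed
  also have "(\<Sum>m\<in>{0<..<Suc d}. L m) = shift_eval c (chain_poly K 0 (Suc d))"
    using shift_eval_chain_rec[of "Suc d" K 0] chain_poly_coeff_1_separated[of K 0 "Suc d"] assms d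
    by (simp add: L_def)
  finally have "real (card (tri_sets n K 0 (n - 1))) =
      shift_eval c (chain_poly K 0 (Suc d) - smult \<kappa> (chain_poly K 0 d))"
    by (simp add: d shift_eval_diff shift_eval_smult)
  moreover have "chain_poly K 0 n = [:0, 1:] * (chain_poly K 0 (Suc d) - smult \<kappa> (chain_poly K 0 d))"
    by (simp add: d(1) \<kappa>_def)
  moreover have "coeff (chain_poly K 0 (Suc d) - smult \<kappa> (chain_poly K 0 d)) 0 = 0"
    using d by (simp add: chain_poly_coeff_0)
  ultimately show ?thesis using that by blast
qed

end

section \<open>The configurations \<open>SC(k,r)\<close>\<close>

definition polygon_corner :: "nat \<Rightarrow> (nat \<Rightarrow> real^2) \<Rightarrow> nat \<Rightarrow> real^2" where
  "polygon_corner k v i = v (i mod k)"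

definition side_point :: "nat \<Rightarrow> (nat \<Rightarrow> real^2) \<Rightarrow> nat \<Rightarrow> (nat \<Rightarrow> real) \<Rightarrow> nat \<Rightarrow> real^2" where
  "side_point k v r t a =
     (1 - t a) *\<^sub>R polygon_corner k v (a div r) + t a *\<^sub>R polygon_corner k v (Suc (a div r))"

section \<open>Orientation of the corners of a convex polygon\<close>

context
  fixes k :: nat and v :: "nat \<Rightarrow> real^2"
  assumes k3: "3 \<le> k" and poly: "convex_polygon k v"
begin

abbreviation corner :: "nat \<Rightarrow> real^2" where
  "corner \<equiv> polygon_corner k v"

lemma corner_eq_iff: "corner i = corner j \<longleftrightarrow> i mod k = j mod k"
  using poly k3 unfolding convex_polygon_def polygon_corner_def by (auto simp: inj_on_def)

lemma corner_Suc_neq: "corner i \<noteq> corner (Suc i)"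
  using k3 by (auto simp: corner_eq_iff mod_Suc split: if_splits)

lemma corner_Suc_Suc_neq: "corner i \<noteq> corner (Suc (Suc i))"
  using k3 by (auto simp: corner_eq_iff mod_Suc split: if_splits)

definition polygon :: "(real^2) set" where
  "polygon = convex hull (v ` {..<k})"

lemma corner_edge: "closed_segment (corner i) (corner (Suc i)) edge_of polygon"
proof -
  have "closed_segment (v (i mod k)) (v (Suc (i mod k) mod k)) edge_of polygon"
    using poly k3 unfolding convex_polygon_def polygon_def by simp
  then show ?thesis by (simp add: polygon_corner_def mod_Suc_eq)
qed

lemma corner_extreme: "corner i extreme_point_of polygon"
proof -
  have "{corner i} face_of closed_segment (corner i) (corner (Suc i))"
    by (simp add: face_of_singleton extreme_point_of_segment)
  moreover have "closed_segment (corner i) (corner (Suc i)) face_of polygon"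
    using corner_edge by (simp add: edge_of_def)
  ultimately show ?thesis using face_of_trans face_of_singleton by metis
qed

lemma corner_in: "corner i \<in> polygon"
  using corner_extreme by (simp add: extreme_point_of_def)

lemma corner_not_between:
  "\<lbrakk>x \<in> polygon; y \<in> polygon\<rbrakk> \<Longrightarrow> corner i \<notin> open_segment x y"
  using corner_extreme by (simp add: extreme_point_of_def)

text \<open>A point of the polygon on the line beyond \<open>corner i\<close> or
  \<open>corner j\<close> would put that extreme point strictly between two points of the
  polygon.\<close>

lemma outside_param:
  assumes z: "z = (1 - t) *\<^sub>R corner i + t *\<^sub>R corner j" "z \<in> polygon" and ne: "corner i \<noteq> corner j"
  shows "0 \<le> t \<and> t \<le> 1"
proof (rule ccontr)
  have eq: "(1 - 0) *\<^sub>R corner i + 0 *\<^sub>R corner j = corner i" "(1 - 1) *\<^sub>R corner i + 1 *\<^sub>R corner j = corner j"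
    by simp_all
  assume "\<not> (0 \<le> t \<and> t \<le> 1)"
  then consider "t < 0" | "1 < t" by linarith
  then show False
  proof cases
    case 1
    then have "corner i \<in> open_segment z (corner j)"
      using open_segment_param[OF ne, of t 0 1] eq z(1) by simp
    then show False using corner_not_between z(2) corner_in by blast
  next
    case 2
    then have "corner j \<in> open_segment (corner i) z"
      using open_segment_param[OF ne, of 0 1 t] eq z(1) by simp
    then show False using corner_not_between z(2) corner_in by blast
  qed
qed

lemma corners_not_collinear:
  assumes "corner i \<noteq> corner j" "corner l \<noteq> corner i" "corner l \<noteq> corner j"
  shows "orient (corner i) (corner j) (corner l) \<noteq> 0"
proof
  assume "orient (corner i) (corner j) (corner l) = 0"
  then obtain t where t: "corner l = (1 - t) *\<^sub>R corner i + t *\<^sub>R corner j"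
    using orient_0_param assms(1) by metis
  then have "0 \<le> t" "t \<le> 1" using outside_param[OF t corner_in assms(1)] by auto
  moreover have "t \<noteq> 0" "t \<noteq> 1" using t assms by auto
  ultimately have "0 < t \<and> t < 1" by simp
  then have "corner l \<in> open_segment (corner i) (corner j)"
    unfolding in_segment using t assms(1) by blast
  then show False using corner_not_between corner_in by blast
qed

text \<open>Otherwise the segment between the two corners would meet the line of the edge in a point
  of the polygon, hence of the edge by \<open>outside_param\<close>; as the edge is a face, it would
  contain the corners too.\<close>

lemma corners_same_side:
  assumes "corner j \<notin> {corner i, corner (Suc i)}" "corner l \<notin> {corner i, corner (Suc i)}"
  shows "orient (corner i) (corner (Suc i)) (corner j) * orient (corner i) (corner (Suc i)) (corner l) > 0"
proof (rule ccontr)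
  define H where "H x = orient (corner i) (corner (Suc i)) x" for x
  note ne = corner_Suc_neq[of i]
  assume "\<not> ?thesis"
  moreover have "H (corner j) \<noteq> 0" "H (corner l) \<noteq> 0"
    using corners_not_collinear[OF ne] assms by (auto simp: H_def)
  ultimately have "H (corner j) * H (corner l) < 0" by (simp add: H_def less_le)
  then obtain x y where xy: "x \<in> {corner j, corner l}" "y \<in> {corner j, corner l}" "H x > 0" "H y < 0"
    by (auto simp: mult_less_0_iff)
  define u where "u = H x / (H x - H y)"
  have u: "0 < u" "u < 1" using xy by (auto simp: u_def)
  define z where "z = (1 - u) *\<^sub>R x + u *\<^sub>R y"
  have inP: "x \<in> polygon" "y \<in> polygon" using xy corner_in by auto
  have zP: "z \<in> polygon"
    unfolding z_def using inP u by (intro convexD) (auto simp: polygon_def)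
  have "x \<noteq> y" using xy by auto
  then have zxy: "z \<in> open_segment x y" using u by (auto simp: in_segment z_def)
  have "H z = (1 - u) * H x + u * H y" unfolding z_def H_def by (simp add: orient_affine)
  also have "\<dots> = 0" using xy by (simp add: u_def field_simps)
  finally obtain t where t: "z = (1 - t) *\<^sub>R corner i + t *\<^sub>R corner (Suc i)"
    using orient_0_param ne H_def by metis
  have "z \<in> closed_segment (corner i) (corner (Suc i))"
    using outside_param[OF t zP ne] t by (auto simp: in_segment)
  then have "x \<in> closed_segment (corner i) (corner (Suc i))"
    using corner_edge[of i] inP zxy unfolding edge_of_def face_of_def by blast
  then have "H x = 0" unfolding H_def by (auto simp: in_segment orient_affine)
  then show False using xy by simp
qed

text \<open>Only the sign matters; this becomes the \<open>\<epsilon>\<close> of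
  \<open>subdivided_polygon\<close>.\<close>

definition turning :: real where
  "turning = orient (corner 0) (corner 1) (corner 2)"

text \<open>The sign propagates because the corners \<open>i\<close> and \<open>i + 3\<close> lie on
  the same side of the edge from \<open>i + 1\<close> to \<open>i + 2\<close>.\<close>

lemma edge_orient_Suc_Suc: "turning * orient (corner i) (corner (Suc i)) (corner (Suc (Suc i))) > 0"
proof (induction i)
  case 0
  have "corner 0 \<noteq> corner 1" "corner 2 \<noteq> corner 0" "corner 2 \<noteq> corner 1"
    using corner_Suc_neq[of 0] corner_Suc_neq[of 1] corner_Suc_Suc_neq[of 0] by (auto simp: numeral_2_eq_2)
  from corners_not_collinear[OF this] have "turning \<noteq> 0" by (simp add: turning_def)
  then show ?case by (auto simp: turning_def numeral_2_eq_2 zero_less_mult_iff)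
next
  case (Suc i)
  have "orient (corner (Suc i)) (corner (Suc (Suc i))) (corner i) *
      orient (corner (Suc i)) (corner (Suc (Suc i))) (corner (Suc (Suc (Suc i)))) > 0"
    using corner_Suc_neq corner_Suc_Suc_neq by (intro corners_same_side) (auto, metis+)
  then show ?case
    using Suc orient_rotate[of "corner i" "corner (Suc i)"] by (auto simp: zero_less_mult_iff)
qed

lemma edge_orient:
  assumes "corner j \<notin> {corner i, corner (Suc i)}"
  shows "turning * orient (corner i) (corner (Suc i)) (corner j) > 0"
proof -
  have "orient (corner i) (corner (Suc i)) (corner (Suc (Suc i))) *
      orient (corner i) (corner (Suc i)) (corner j) > 0"
    using corner_Suc_neq corner_Suc_Suc_neq assms by (intro corners_same_side) (auto, metis+)
  then show ?thesis using edge_orient_Suc_Suc[of i] by (auto simp: zero_less_mult_iff)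
qed

text \<open>Edges control only the triples with two neighbouring corners. The step from
  \<open>c\<close> to \<open>Suc c\<close> uses the three-term Pluecker relation around
  \<open>corner a\<close> for the corners \<open>Suc a\<close>, \<open>b\<close>, \<open>c\<close>,
  \<open>Suc c\<close>, in which all other factors are positive by an edge or by induction.\<close>

lemma corner_orient_less:
  assumes "a < b" "b < c" "c < k"
  shows "turning * orient (corner a) (corner b) (corner c) > 0"
proof -
  define B where "B x y = turning * orient (corner a) (corner x) (corner y)" for x y
  have neq: "corner x \<noteq> corner y" if "x < k" "y < k" "x \<noteq> y" for x y
    using that by (simp add: corner_eq_iff)
  have adj: "B j (Suc j) > 0" if "a < j" "Suc j < k" for j
    using edge_orient[of a j] neq[of a j] neq[of a "Suc j"] that orient_rotate[of "corner a" "corner j"]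
    by (simp add: B_def)
  have first: "B (Suc a) j > 0" if "Suc a < j" "j < k" for j
    using edge_orient[of j a] neq[of j a] neq[of j "Suc a"] that by (simp add: B_def)
  have "Suc b \<le> c" using assms by simp
  then have "B b c > 0" using \<open>c < k\<close>
  proof (induction c rule: dec_induct)
    case base
    then show ?case using adj assms by simp
  next
    case (step c)
    show ?case
    proof (cases "b = Suc a")
      case True
      then show ?thesis using first step by simp
    next
      case False
      then have b: "Suc a < b" using assms by simp
      have "B (Suc a) c * B b (Suc c) = B (Suc a) b * B c (Suc c) + B (Suc a) (Suc c) * B b c"
        unfolding B_def orient_def by algebra
      also have "\<dots> > 0"
        using first[of b] adj[of c] first[of "Suc c"] step b assms by (intro add_pos_pos mult_pos_pos) auto
      finally show ?thesis using first[of c] step b by (simp add: zero_less_mult_iff)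
    qed
  qed
  then show ?thesis by (simp add: B_def)
qed

lemma corner_orient_pos:
  assumes "a < b" "b < c" "c \<le> k" "\<not> (a = 0 \<and> c = k)"
  shows "turning * orient (corner a) (corner b) (corner c) > 0"
proof (cases "c = k")
  case True
  then have "corner c = corner 0" by (simp add: corner_eq_iff)
  then show ?thesis
    using corner_orient_less[of 0 a b] assms True orient_rotate[of "corner 0" "corner a" "corner b"] by simp
qed (use corner_orient_less assms in simp)

lemma corner_orient_nonneg:
  assumes "a \<le> b" "b \<le> c" "c \<le> k"
  shows "turning * orient (corner a) (corner b) (corner c) \<ge> 0"
proof -
  have "corner k = corner 0" by (simp add: corner_eq_iff)
  then consider "a < b" "b < c" "\<not> (a = 0 \<and> c = k)"
    | "corner a = corner b \<or> corner b = corner c \<or> corner a = corner c"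
    using assms by (metis le_neq_implies_less)
  then show ?thesis
  proof cases
    case 1
    then show ?thesis using corner_orient_pos[of a b c] assms by simp
  qed auto
qed

lemma eps_nonzero: "turning \<noteq> 0"
  using edge_orient_Suc_Suc[of 0] by auto

section \<open>Orientation of the points on the sides\<close>

context
  fixes r :: nat and t :: "nat \<Rightarrow> real"
  assumes r1: "1 \<le> r"
    and t0: "\<And>a. r dvd a \<Longrightarrow> t a = 0"
    and t1: "\<And>a. a < k * r \<Longrightarrow> 0 \<le> t a \<and> t a < 1"
    and tmono: "\<And>a b. \<lbrakk>a < b; b < k * r; a div r = b div r\<rbrakk> \<Longrightarrow> t a < t b"
begin

abbreviation pt :: "nat \<Rightarrow> real^2" where
  "pt \<equiv> side_point k v r t"

lemma div_less: "a < k * r \<Longrightarrow> a div r < k"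
  using r1 by (simp add: less_mult_imp_div_less)

lemma not_separated_div:
  assumes "\<not> separated {q. r dvd q} a c"
  shows "c \<le> Suc (a div r) * r"
proof (rule ccontr)
  assume "\<not> ?thesis"
  moreover have "a < Suc (a div r) * r" using r1 by (simp add: dividend_less_div_times)
  ultimately show False using assms by (auto simp: separated_def)
qed

lemma separated_div:
  assumes "separated {q. r dvd q} a c"
  shows "Suc (a div r) * r < c"
proof -
  obtain s where s: "a < s * r" "s * r < c" using assms by (auto simp: separated_def dvd_def mult.commute)
  then have "a div r < s" by (simp add: less_mult_imp_div_less)
  then have "Suc (a div r) * r \<le> s * r" by (intro mult_right_mono) auto
  then show ?thesis using s by simp
qed

lemma t_pos:
  assumes "a < k * r" "\<not> r dvd a"
  shows "0 < t a"
proof -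
  have "a div r * r < a" using assms(2) div_mult_mod_eq[of a r] by (metis dvd_triv_right le_neq_implies_less div_times_less_eq_dividend)
  then have "t (a div r * r) < t a" using tmono[of "a div r * r" a] assms(1) r1 by simp
  then show ?thesis using t0 by simp
qed

lemma orient_pt_same_side:
  assumes "a div r = b div r"
  shows "orient (pt a) (pt b) x = (t b - t a) * orient (corner (a div r)) (corner (Suc (a div r))) x"
  unfolding side_point_def assms orient_def by (simp add: algebra_simps)

lemma orient_pt_right:
  "orient x y (pt c) = (1 - t c) * orient x y (corner (c div r)) + t c * orient x y (corner (Suc (c div r)))"
  unfolding side_point_def by (rule orient_affine) simp

text \<open>Orientation is affine in each point, so it expands into orientations of corners with
  nonnegative weights. None of these is negative; each case exhibits one term that is
  positive.\<close>

lemma orient_pt: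
  assumes "a < b" "b < c" "c < k * r" "nonflat (k * r) {q. r dvd q} a b c"
  shows "turning * orient (pt a) (pt b) (pt c) > 0"
proof -
  note sep = separated_div[of a c]
  have sac: "separated {q. r dvd q} a c" using assms(4) by (simp add: nonflat_def)
  have le: "a div r \<le> b div r" "b div r \<le> c div r" "c div r < k"
    using assms by (auto intro: div_le_mono div_less)
  have t: "0 \<le> t a" "t a < 1" "0 \<le> t b" "t b < 1" "0 \<le> t c" "t c < 1"
    using assms t1[of a] t1[of b] t1[of c] by auto
  define T where "T i j l = turning * orient (corner i) (corner j) (corner l)" for i j l
  have Tn: "T i j l \<ge> 0" if "i \<le> j" "j \<le> l" "l \<le> k" for i j l
    using corner_orient_nonneg that by (simp add: T_def)
  have Tp: "T i j l > 0" if "i < j" "j < l" "l \<le> k" "\<not> (i = 0 \<and> l = k)" for i j l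
    using corner_orient_pos that by (simp add: T_def)
  consider "a div r < b div r" "b div r < c div r" | "a div r = b div r" "b div r < c div r"
    | "a div r < b div r" "b div r = c div r" | "a div r = c div r"
    using le by linarith
  then show ?thesis
  proof cases
    case 1
    define A B C where "A = a div r" "B = b div r" "C = c div r"
    note ABC = this
    have lt: "A < B" "B < C" "C < k" using 1 le ABC by auto
    have "turning * orient (pt a) (pt b) (pt c) =
        (1 - t a) * (1 - t b) * (1 - t c) * T A B C
        + ((1 - t a) * (1 - t b) * t c * T A B (Suc C)
        + (1 - t a) * t b * (1 - t c) * T A (Suc B) C
        + (1 - t a) * t b * t c * T A (Suc B) (Suc C)
        + t a * (1 - t b) * (1 - t c) * T (Suc A) B C
        + t a * (1 - t b) * t c * T (Suc A) B (Suc C)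
        + t a * t b * (1 - t c) * T (Suc A) (Suc B) C
        + t a * t b * t c * T (Suc A) (Suc B) (Suc C))"
      unfolding side_point_def T_def ABC[symmetric] orient_def by (simp add: algebra_simps)
    also have "\<dots> > 0"
      using t lt Tp[of A B C] by (intro add_pos_nonneg add_nonneg_nonneg mult_pos_pos mult_nonneg_nonneg Tn) auto
    finally show ?thesis .
  next
    case 2
    define s where "s = a div r"
    have "Suc s * r < c" using sep[OF sac] by (simp add: s_def)
    \<comment> \<open>If \<open>c\<close> is on the very next side, the triple with the first corner
      of that side degenerates. Then \<open>c\<close> is past this corner, so \<open>t c > 0\<close>
      and the triple with its second corner counts.\<close>
    then have cs: "Suc s < c div r \<or> Suc s = c div r \<and> \<not> r dvd c"
      using 2 r1 by (metis Suc_lessI dvd_div_mult_self less_irrefl s_def)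
    have "turning * orient (pt a) (pt b) (pt c) =
        (t b - t a) * ((1 - t c) * T s (Suc s) (c div r) + t c * T s (Suc s) (Suc (c div r)))"
      unfolding orient_pt_same_side[OF 2(1)] T_def s_def orient_pt_right by (simp add: algebra_simps)
    moreover have "t b - t a > 0" using tmono[of a b] 2 assms by simp
    moreover have "(1 - t c) * T s (Suc s) (c div r) + t c * T s (Suc s) (Suc (c div r)) > 0"
      using cs
    proof
      assume "Suc s < c div r"
      then show ?thesis using t le Tp[of s "Suc s" "c div r"]
        by (intro add_pos_nonneg mult_pos_pos mult_nonneg_nonneg Tn) auto
    next
      assume c: "Suc s = c div r \<and> \<not> r dvd c"
      then have "t c > 0" using t_pos assms by simp
      moreover have "\<not> (s = 0 \<and> Suc (c div r) = k)" using c k3 by linarith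
      ultimately show ?thesis using t le c Tp[of s "Suc s" "Suc (c div r)"]
        by (intro add_nonneg_pos mult_pos_pos mult_nonneg_nonneg Tn) auto
    qed
    ultimately show ?thesis by simp
  next
    case 3
    define s where "s = b div r"
    have "turning * orient (pt a) (pt b) (pt c) = turning * orient (pt b) (pt c) (pt a)"
      using orient_rotate[of "pt a"] by simp
    also have "\<dots> = (t c - t b) * ((1 - t a) * T s (Suc s) (a div r) + t a * T s (Suc s) (Suc (a div r)))"
      unfolding orient_pt_same_side[OF 3(2)] T_def s_def orient_pt_right by (simp add: algebra_simps)
    also have "\<dots> = (t c - t b) * ((1 - t a) * T (a div r) s (Suc s) + t a * T (Suc (a div r)) s (Suc s))"
      unfolding T_def using orient_rotate[of "corner (a div r)"] orient_rotate[of "corner (Suc (a div r))"] by simp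
    finally have eq: "turning * orient (pt a) (pt b) (pt c) = \<dots>" .
    have "t c - t b > 0" using tmono[of b c] 3 assms by simp
    moreover have "(1 - t a) * T (a div r) s (Suc s) + t a * T (Suc (a div r)) s (Suc s) > 0"
    proof (cases "a div r = 0 \<and> Suc s = k")
      case False
      then show ?thesis using t 3 le Tp[of "a div r" s "Suc s"]
        by (intro add_pos_nonneg mult_pos_pos mult_nonneg_nonneg Tn) (auto simp: s_def)
    next
      case True
      \<comment> \<open>Here the leading triple vanishes, as \<open>corner k = corner 0\<close>.
        Nonflatness excludes \<open>a = 0\<close>, so \<open>t a > 0\<close> and the triple with
        \<open>corner 1\<close> counts.\<close>
      have "a \<noteq> 0"
      proof
        assume "a = 0"
        then have "separated {q. r dvd q} b (k * r)" using assms(4) by (simp add: nonflat_def)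
        then have "Suc (b div r) * r < k * r" by (rule separated_div)
        moreover have "Suc (b div r) = k" using True by (simp add: s_def)
        ultimately show False by simp
      qed
      moreover have "a < r" using True r1 by (simp add: div_eq_0_iff)
      ultimately have "\<not> r dvd a" by (auto dest: dvd_imp_le)
      then have "t a > 0" using t_pos assms by simp
      then show ?thesis using t 3 le k3 True Tp[of "Suc (a div r)" s "Suc s"]
        by (intro add_nonneg_pos mult_pos_pos mult_nonneg_nonneg Tn) (auto simp: s_def)
    qed
    ultimately show ?thesis unfolding eq by simp
  next
    case 4
    then have "c < Suc (a div r) * r" using r1 by (metis dividend_less_div_times less_le_trans mult_Suc add.commute zero_less_one)
    then show ?thesis using sep[OF sac] by simp
  qed
qed

text \<open>The end of side \<open>s\<close> has index \<open>Suc s * r\<close>, which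
  \<open>div\<close> assigns to the next side; as a point of side \<open>s\<close> its parameter is
  1.\<close>

lemma pt_on_side:
  assumes "a div r = s \<or> a = Suc s * r"
  shows "pt a = (1 - (if a div r = s then t a else 1)) *\<^sub>R corner s + (if a div r = s then t a else 1) *\<^sub>R corner (Suc s)"
  using assms r1 t0[of a] by (auto simp: side_point_def)

lemma subdivided_polygon_pt: "subdivided_polygon (k * r) {q. r dvd q} pt turning"
proof
  have kr: "3 * r \<le> k * r" using k3 by simp
  then show "3 \<le> k * r" using r1 by linarith
  show "separated {q. r dvd q} 0 (k * r - 1)"
  proof -
    have "0 < r \<and> r < k * r - 1" using kr r1 by linarith
    then show ?thesis unfolding separated_def by (intro bexI[of _ r]) auto
  qed
  \<comment> \<open>The corner \<open>r\<close> would not do: for \<open>r = 1\<close> it is the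
    point 1 itself.\<close>
  have "1 < 2 * r \<and> 2 * r < k * r" using kr r1 by linarith
  then show "separated {q. r dvd q} 1 (k * r)"
    unfolding separated_def by (intro bexI[of _ "2 * r"]) auto
  show "pt b \<in> open_segment (pt a) (pt c)"
    if abc: "a < b" "b < c" "c < k * r" "\<not> separated {q. r dvd q} a c" for a b c
  proof -
    define s where "s = a div r"
    have cs: "c \<le> Suc s * r" using not_separated_div abc by (simp add: s_def)
    have "b < Suc s * r" using abc cs by simp
    then have "b div r < Suc s" by (rule less_mult_imp_div_less)
    moreover have "s \<le> b div r" using abc by (simp add: s_def div_le_mono)
    ultimately have bs: "b div r = s" by simp
    have cs': "c div r = s \<or> c = Suc s * r"
    proof (cases "c = Suc s * r")
      case False
      then have "c div r < Suc s" using cs less_mult_imp_div_less[of c "Suc s" r] by simp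
      moreover have "s \<le> c div r" using abc by (simp add: s_def div_le_mono)
      ultimately show ?thesis by simp
    qed simp
    have "t a < t b" using tmono[of a b] abc bs by (simp add: s_def)
    moreover have "t b < (if c div r = s then t c else 1)"
      using tmono[of b c] t1[of b] abc bs by auto
    ultimately show ?thesis
      using open_segment_param[OF corner_Suc_neq[of s], of "t a" "t b" "if c div r = s then t c else 1"]
        pt_on_side[of a s] pt_on_side[of b s] pt_on_side[OF cs'] bs by (simp add: s_def)
  qed
  show "pt c \<in> open_segment (pt b) (pt 0)"
    if bc: "0 < b" "b < c" "c < k * r" "\<not> separated {q. r dvd q} b (k * r)" for b c
  proof -
    define s where "s = b div r"
    have "k * r \<le> Suc s * r" using not_separated_div bc by (simp add: s_def)
    then have "k \<le> Suc s" using r1 by (simp del: mult_Suc)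
    moreover have "s \<le> c div r" "c div r < k" using bc by (simp_all add: s_def div_le_mono div_less)
    ultimately have s: "Suc s = k" "c div r = s" by auto
    have "corner (Suc s) = corner 0" using s by (simp add: corner_eq_iff)
    then have "pt 0 = (1 - 1) *\<^sub>R corner s + 1 *\<^sub>R corner (Suc s)" using t0[of 0] by (simp add: side_point_def)
    moreover have "t b < t c" "t c < 1" using tmono[of b c] t1[of c] bc s by (auto simp: s_def)
    ultimately show ?thesis
      using open_segment_param[OF corner_Suc_neq[of s], of "t b" "t c" 1] s by (simp add: side_point_def s_def)
  qed
qed (use eps_nonzero orient_pt in auto)

end

end

text \<open>The sets \<open>X i\<close> are unordered. On each side the parameters of their points,
  with 0 added for the corner, are sorted; entry \<open>i\<close> of the list for side
  \<open>s\<close> is the parameter of the point \<open>s * r + i\<close>.\<close>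

lemma SC_subdivided_polygon:
  assumes k3: "3 \<le> k" and r1: "1 \<le> r" and S: "S \<in> SC k r"
  obtains p \<epsilon> where "subdivided_polygon (k * r) {q. r dvd q} p \<epsilon>" "S = p ` {..<k * r}"
proof -
  obtain v X where poly: "convex_polygon k v"
    and X: "\<And>i. i < k \<Longrightarrow> X i \<subseteq> open_segment (v i) (v (Suc i mod k)) \<and> finite (X i) \<and> card (X i) = r - 1"
    and S: "S = v ` {..<k} \<union> (\<Union>i<k. X i)"
    using S unfolding SC_def by blast
  define f where "f s u = (1 - u) *\<^sub>R v s + u *\<^sub>R v (Suc s mod k)" for s u
  define T where "T s = insert 0 {u. 0 < u \<and> u < 1 \<and> f s u \<in> X s}" for s
  define L where "L s = sorted_list_of_set (T s)" for s
  define t where "t a = L (a div r) ! (a mod r)" for a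
  have inj: "inj (f s)" if "s < k" for s
  proof (rule injI)
    have ne: "v s \<noteq> v (Suc s mod k)"
      using corner_Suc_neq[OF k3 poly, of s] that by (simp add: polygon_corner_def)
    fix x y assume "f s x = f s y"
    then have "(x - y) *\<^sub>R (v (Suc s mod k) - v s) = 0" by (simp add: f_def algebra_simps)
    then show "x = y" using ne by simp
  qed
  have img: "f s ` {u. 0 < u \<and> u < 1 \<and> f s u \<in> X s} = X s" if "s < k" for s
  proof -
    have "\<exists>u. 0 < u \<and> u < 1 \<and> x = f s u" if "x \<in> X s" for x
      using that X[OF \<open>s < k\<close>] by (auto simp: in_segment f_def)
    then show ?thesis by blast
  qed
  have fin_card: "finite {u. 0 < u \<and> u < 1 \<and> f s u \<in> X s} \<and> card {u. 0 < u \<and> u < 1 \<and> f s u \<in> X s} = r - 1"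
    if "s < k" for s
  proof -
    define U where "U = {u. 0 < u \<and> u < 1 \<and> f s u \<in> X s}"
    have "inj_on (f s) U" using inj[OF that] inj_on_subset by blast
    moreover have "f s ` U = X s" using img[OF that] by (simp add: U_def)
    ultimately have "finite U \<and> card U = r - 1" using X[OF that] finite_imageD card_image by metis
    then show ?thesis by (simp add: U_def)
  qed
  have L: "finite (T s)" "set (L s) = T s" "length (L s) = r" "sorted_wrt (<) (L s)" if "s < k" for s
  proof -
    have "finite (T s) \<and> card (T s) = r" using fin_card[OF that] r1 by (simp add: T_def)
    then show "finite (T s)" "set (L s) = T s" "length (L s) = r" "sorted_wrt (<) (L s)"
      by (simp_all add: L_def)
  qed
  have Lmono: "L s ! i < L s ! j" if "s < k" "i < j" "j < r" for s i j
    using L[OF that(1)] that sorted_wrt_nth_less by metis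
  have Lin: "L s ! i \<in> T s" if "s < k" "i < r" for s i
    using L[OF that(1)] that nth_mem by metis
  have range: "0 \<le> u \<and> u < 1" if "u \<in> T s" for u s
    using that by (auto simp: T_def)
  have L0: "L s ! 0 = 0" if "s < k" for s
  proof -
    have "0 \<in> set (L s)" "length (L s) = r" using L[OF that] by (simp_all add: T_def)
    then obtain i where i: "i < r" "L s ! i = 0" by (metis in_set_conv_nth)
    then show ?thesis using Lmono[OF that, of 0 i] range[OF Lin[OF that, of 0]] r1 by (cases "i = 0") auto
  qed
  have sk: "a div r < k" if "a < k * r" for a using that by (rule less_mult_imp_div_less)
  \<comment> \<open>Set to 0 beyond the last point, because the parameter has to vanish at every
    multiple of \<open>r\<close>.\<close>
  define t' where "t' a = (if a < k * r then t a else 0)" for a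
  have t0: "t' a = 0" if "r dvd a" for a using that L0 sk by (auto simp: t'_def t_def)
  have t1: "0 \<le> t' a \<and> t' a < 1" if "a < k * r" for a
    using that range[OF Lin] sk r1 by (auto simp: t'_def t_def)
  have tmono: "t' a < t' b" if "a < b" "b < k * r" "a div r = b div r" for a b
  proof -
    have "a mod r < b mod r" using that by (metis div_mult_mod_eq nat_add_left_cancel_less)
    then show ?thesis using that Lmono[OF sk[OF that(2)]] r1 by (simp add: t'_def t_def)
  qed
  define p where "p = side_point k v r t'"
  have sub: "subdivided_polygon (k * r) {q. r dvd q} p (turning k v)"
    unfolding p_def by (rule subdivided_polygon_pt[OF k3 poly r1 t0 t1 tmono])
  have p: "p a = f (a div r) (t' a)" if "a < k * r" for a
    using sk[OF that] unfolding p_def side_point_def polygon_corner_def f_def by simp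
  have "p ` {..<k * r} = (\<Union>s<k. f s ` T s)"
  proof (intro equalityI subsetI)
    fix x assume "x \<in> p ` {..<k * r}"
    then obtain a where a: "a < k * r" "x = p a" by auto
    then have "t' a \<in> T (a div r)" using Lin sk r1 by (simp add: t'_def t_def)
    then show "x \<in> (\<Union>s<k. f s ` T s)" using a p sk by auto
  next
    fix x assume "x \<in> (\<Union>s<k. f s ` T s)"
    then obtain s u where s: "s < k" "u \<in> T s" "x = f s u" by auto
    then obtain i where i: "i < r" "u = L s ! i" using L[OF s(1)] by (metis in_set_conv_nth)
    have "s * r + i < Suc s * r" using i by simp
    also have "\<dots> \<le> k * r" using s by (intro mult_right_mono) auto
    finally have lt: "s * r + i < k * r" .
    have "t' (s * r + i) = u" "(s * r + i) div r = s" using i lt by (auto simp: t'_def t_def)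
    then have "p (s * r + i) = x" using p[OF lt] s by simp
    then show "x \<in> p ` {..<k * r}" using lt by blast
  qed
  also have "\<dots> = (\<Union>s<k. insert (v s) (X s))"
  proof (rule SUP_cong)
    fix s assume "s \<in> {..<k}"
    then show "f s ` T s = insert (v s) (X s)" using img[of s] unfolding T_def by (simp add: f_def)
  qed simp
  also have "\<dots> = S" unfolding S by auto
  finally show ?thesis using that sub by blast
qed

section \<open>The integral formula\<close>

text \<open>The even moments of the semicircle law after the substitution by
  \<open>2 * cos x\<close>, that is, the Catalan numbers. With the integral as definition,
  \<open>shift_eval cat\<close> is an integral by linearity; the counting refers to
  \<open>cat_0\<close> and \<open>cat_Suc\<close> only.\<close>

definition cat :: "nat \<Rightarrow> real" where
  "cat n = (4 / pi) * integral {0..pi/2} (\<lambda>x. (4 * (cos x)\<^sup>2) ^ n * (sin x)\<^sup>2)"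

lemma cat_integrable: "(\<lambda>x. (4 * (cos x)\<^sup>2) ^ n * (sin x)\<^sup>2 :: real) integrable_on {0..pi/2}"
  by (intro integrable_continuous_real continuous_intros)

lemma cat_0: "cat 0 = 1"
proof -
  have "((\<lambda>x. (sin x)\<^sup>2) has_integral ((pi/2 - sin (pi/2) * cos (pi/2)) / 2 - (0 - sin 0 * cos 0) / 2)) {0..pi/2}"
  proof (rule fundamental_theorem_of_calculus)
    show "((\<lambda>x. (x - sin x * cos x) / 2) has_vector_derivative (sin x)\<^sup>2) (at x within {0..pi/2})" for x
    proof -
      have "(sin x)\<^sup>2 = (1 - (cos x * cos x - sin x * sin x)) / 2"
        using sin_cos_squared_add[of x] by (simp add: power2_eq_square)
      then show ?thesis
        unfolding has_real_derivative_iff_has_vector_derivative[symmetric]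
        by (auto intro!: derivative_eq_intros)
    qed
  qed simp
  then show ?thesis by (simp add: cat_def integral_unique)
qed

text \<open>Integrate the derivative of \<open>4 ^ Suc n * cos x ^ (2 * n + 1) * sin x ^ 3\<close>,
  a function that vanishes at both ends.\<close>

lemma cat_rec: "(real n + 2) * cat (Suc n) = (4 * real n + 2) * cat n"
proof -
  define A where "A n x = (4 * (cos x)\<^sup>2) ^ n * (sin x)\<^sup>2" for n and x :: real
  define G where "G x = 4 ^ Suc n * (cos x ^ Suc (2 * n) * sin x ^ Suc 2)" for x :: real
  have "((\<lambda>x. (2 * real n + 4) * A (Suc n) x - 4 * (2 * real n + 1) * A n x) has_integral (G (pi/2) - G 0)) {0..pi/2}"
  proof (rule fundamental_theorem_of_calculus)
    fix x :: real
    define c s where "c = cos x" and "s = sin x"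
    have "((\<lambda>x. cos x ^ Suc (2 * n)) has_real_derivative (1 + real (2 * n)) * (- sin x * cos x ^ (2 * n))) (at x within {0..pi/2})"
      "((\<lambda>x. sin x ^ Suc 2) has_real_derivative (1 + real 2) * (cos x * sin x ^ 2)) (at x within {0..pi/2})"
      by (intro DERIV_power_Suc has_field_derivative_at_within[OF DERIV_cos] has_field_derivative_at_within[OF DERIV_sin])+
    from DERIV_cmult[OF DERIV_mult[OF this], of "4 ^ Suc n"]
    have "(G has_real_derivative 4 ^ Suc n * ((1 + real (2 * n)) * (- s * c ^ (2 * n)) * s ^ Suc 2
        + (1 + real 2) * (c * s ^ 2) * c ^ Suc (2 * n))) (at x within {0..pi/2})"
      unfolding G_def c_def s_def by simp
    also have "4 ^ Suc n * ((1 + real (2 * n)) * (- s * c ^ (2 * n)) * s ^ Suc 2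
        + (1 + real 2) * (c * s ^ 2) * c ^ Suc (2 * n))
      = 4 ^ Suc n * c ^ (2 * n) * (s\<^sup>2 * (3 * c\<^sup>2 - (1 + 2 * real n) * s\<^sup>2))"
      by (simp add: algebra_simps power2_eq_square power3_eq_cube)
    also have "s\<^sup>2 * (3 * c\<^sup>2 - (1 + 2 * real n) * s\<^sup>2) = s\<^sup>2 * ((2 * real n + 4) * c\<^sup>2 - (2 * real n + 1))"
      by (simp add: s_def c_def sin_squared_eq algebra_simps)
    finally have "(G has_real_derivative 4 ^ Suc n * (cos x ^ (2 * n)) *
        ((sin x)\<^sup>2 * ((2 * real n + 4) * (cos x)\<^sup>2 - (2 * real n + 1)))) (at x within {0..pi/2})"
      by (simp only: c_def s_def)
    also have "4 ^ Suc n * (cos x ^ (2 * n)) * ((sin x)\<^sup>2 * ((2 * real n + 4) * (cos x)\<^sup>2 - (2 * real n + 1)))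
        = (2 * real n + 4) * A (Suc n) x - 4 * (2 * real n + 1) * A n x"
      unfolding A_def power_mult power_mult_distrib power_Suc by (simp add: algebra_simps)
    finally show "(G has_vector_derivative (2 * real n + 4) * A (Suc n) x - 4 * (2 * real n + 1) * A n x) (at x within {0..pi/2})"
      by (simp add: has_real_derivative_iff_has_vector_derivative)
  qed simp
  then have 0: "((\<lambda>x. (2 * real n + 4) * A (Suc n) x - 4 * (2 * real n + 1) * A n x) has_integral 0) {0..pi/2}"
    by (simp add: G_def)
  have 1: "((\<lambda>x. (2 * real n + 4) * A (Suc n) x - 4 * (2 * real n + 1) * A n x) has_integral
      (2 * real n + 4) * integral {0..pi/2} (A (Suc n)) - 4 * (2 * real n + 1) * integral {0..pi/2} (A n)) {0..pi/2}"
    using cat_integrable[of n] cat_integrable[of "Suc n"] unfolding A_def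
    by (intro has_integral_diff has_integral_mult_right integrable_integral)
  define I where "I n = integral {0..pi/2} (A n)" for n
  have "(2 * real n + 4) * I (Suc n) = 4 * (2 * real n + 1) * I n"
    using has_integral_unique[OF 0 1] by (simp add: I_def)
  moreover have I: "I n = (pi / 4) * cat n" for n by (simp add: cat_def I_def A_def[abs_def])
  ultimately have "(pi / 2) * ((real n + 2) * cat (Suc n)) = (pi / 2) * ((4 * real n + 2) * cat n)"
    unfolding I by (simp add: algebra_simps)
  then show ?thesis by simp
qed

text \<open>The recurrence says that the generating function \<open>F\<close> satisfies
  \<open>X (1 - 4 X) F' + (1 - 2 X) F = 1\<close>; hence \<open>G = F - 1 - X F\<^sup>2\<close> satisfies the homogeneous
  equation \<open>X (1 - 4 X) G' = - G\<close>, whose only power series solution is \<open>0\<close>.\<close>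

lemma cat_Suc: "cat (Suc n) = (\<Sum>i\<le>n. cat i * cat (n - i))"
proof -
  define F where "F = Abs_fps cat"
  define X where "X = (fps_X :: real fps)"
  define G where "G = F - 1 - X * F * F"
  have ode: "X * (1 - 4 * X) * fps_deriv F = 1 - (1 - 2 * X) * F"
  proof (rule fps_ext)
    fix m
    have 4: "(4 :: real fps) = fps_const 4" "(2 :: real fps) = fps_const 2" by (simp_all add: numeral_fps_const)
    show "fps_nth (X * (1 - 4 * X) * fps_deriv F) m = fps_nth (1 - (1 - 2 * X) * F) m"
    proof (cases m)
      case 0
      then show ?thesis by (simp add: X_def F_def cat_0)
    next
      case (Suc l)
      have e1: "X * (1 - 4 * X) * fps_deriv F = X * fps_deriv F - fps_const 4 * (X * (X * fps_deriv F))"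
        unfolding 4 by (simp add: algebra_simps)
      have e2: "1 - (1 - 2 * X) * F = 1 - F + fps_const 2 * (X * F)"
        unfolding 4 by (simp add: algebra_simps)
      show ?thesis
        unfolding e1 e2 using cat_rec[of l] Suc
        by (cases l) (simp_all add: X_def F_def algebra_simps)
    qed
  qed
  have "X * (1 - 4 * X) * fps_deriv G =
      X * (1 - 4 * X) * fps_deriv F * (1 - 2 * X * F) - X * (1 - 4 * X) * F * F"
    by (simp add: G_def X_def algebra_simps)
  also have "\<dots> = (1 - (1 - 2 * X) * F) * (1 - 2 * X * F) - X * (1 - 4 * X) * F * F"
    unfolding ode ..
  also have "\<dots> = - G"
    by (simp add: G_def algebra_simps)
  finally have hom: "X * (1 - 4 * X) * fps_deriv G = - G" .
  have 4: "X * (1 - 4 * X) * fps_deriv G = X * fps_deriv G - fps_const 4 * (X * (X * fps_deriv G))"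
    by (simp add: numeral_fps_const algebra_simps)
  have G0: "fps_nth G m = 0" for m
  proof (induction m)
    case 0
    show ?case by (simp add: G_def X_def F_def cat_0)
  next
    case (Suc m)
    have "fps_nth (X * fps_deriv G - fps_const 4 * (X * (X * fps_deriv G))) (Suc m) = - fps_nth G (Suc m)"
      using hom unfolding 4 by simp
    then have "(real m + 2) * fps_nth G (Suc m) = 0"
      using Suc by (cases m) (simp_all add: X_def algebra_simps)
    then show ?case by (simp add: add_nonneg_eq_0_iff)
  qed
  have "fps_nth F (Suc n) = fps_nth (X * (F * F)) (Suc n)"
    using G0[of "Suc n"] by (simp add: G_def mult.assoc)
  also have "\<dots> = fps_nth (F * F) n" by (simp add: X_def)
  finally show ?thesis by (simp add: F_def fps_mult_nth atLeast0AtMost)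
qed

text \<open>Without the factor \<open>(2 * cos x) ^ u\<close> the recurrence is that of the
  Chebyshev polynomials of the second kind in \<open>cos x\<close>. With \<open>K = {}\<close> the
  chain is a single side.\<close>

lemma chain_poly_chebyshev:
  "poly (chain_poly {} a u) (4 * (cos x)\<^sup>2) * sin x = (2 * cos x) ^ u * sin (real (Suc u) * x)"
proof (induction u rule: induct_nat_012)
  case (ge2 d)
  define y where "y = real (Suc (Suc d)) * x"
  have y: "real (Suc d) * x = y - x" "real (Suc (Suc (Suc d))) * x = y + x"
    by (simp_all add: y_def algebra_simps)
  have "poly (chain_poly {} a (Suc (Suc d))) (4 * (cos x)\<^sup>2) * sin x =
      4 * (cos x)\<^sup>2 * (poly (chain_poly {} a (Suc d)) (4 * (cos x)\<^sup>2) * sin x - poly (chain_poly {} a d) (4 * (cos x)\<^sup>2) * sin x)"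
    by (simp add: algebra_simps)
  also have "\<dots> = (2 * cos x) ^ Suc (Suc d) * (2 * cos x * sin y - sin (y - x))"
    unfolding ge2 y y_def[symmetric] by (simp add: algebra_simps power2_eq_square)
  also have "2 * cos x * sin y - sin (y - x) = sin (y + x)"
    by (simp add: sin_add sin_diff)
  finally show ?case unfolding y .
qed (use sin_double[of x] in \<open>auto simp: power2_eq_square\<close>)

text \<open>At a corner the recurrence is a bare multiplication by \<open>x\<close>, so the next
  side starts afresh with 1 and \<open>x\<close>, times what has been built so far.\<close>

lemma chain_poly_multiples:
  assumes "1 \<le> r" "u \<le> r"
  shows "chain_poly {q. r dvd q} 0 (s * r + u) = chain_poly {} 0 r ^ s * chain_poly {} 0 u"
  using assms(2)
proof (induction "s * r + u" arbitrary: s u rule: less_induct)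
  case less
  \<comment> \<open>A positive multiple of \<open>r\<close> has two forms, with \<open>u = 0\<close>
    and with \<open>u = r\<close>. The recurrence is applied in a form with \<open>u' > 0\<close>,
    to which the case \<open>u = 0\<close> is transferred at the end.\<close>
  have pos: "chain_poly {q. r dvd q} 0 (s * r + u) = chain_poly {} 0 r ^ s * chain_poly {} 0 u"
    if su: "s * r + u = s' * r + u'" "0 < u'" "u' \<le> r" 
      "chain_poly {} 0 r ^ s * chain_poly {} 0 u = chain_poly {} 0 r ^ s' * chain_poly {} 0 u'" for s' u'
  proof -
    define R where "R = chain_poly {} 0 r"
    obtain w where w: "u' = Suc w" using su(2) by (cases u') auto
    have IH1: "chain_poly {q. r dvd q} 0 (s' * r + w) = R ^ s' * chain_poly {} 0 w"
      using less.hyps[of s' w] su w by (simp add: R_def)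
    show ?thesis
    proof (cases w)
      case 0
      show ?thesis
      proof (cases "s' * r")
        case 0
        then have "s' = 0" using assms by simp
        then show ?thesis unfolding su(1,4) using w \<open>w = 0\<close> by simp
      next
        case (Suc m)
        have "r dvd Suc m" using Suc by (metis dvd_triv_right)
        then have "chain_poly {q. r dvd q} 0 (Suc (Suc m)) = [:0, 1:] * chain_poly {q. r dvd q} 0 (Suc m)"
          by simp
        then show ?thesis unfolding su(1,4) using w \<open>w = 0\<close> IH1 Suc by (simp add: R_def)
      qed
    next
      case (Suc w')
      have IH2: "chain_poly {q. r dvd q} 0 (s' * r + w') = R ^ s' * chain_poly {} 0 w'"
        using less.hyps[of s' w'] su w Suc by (simp add: R_def)
      have "\<not> r dvd s' * r + Suc w'"
      proof
        assume "r dvd s' * r + Suc w'"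
        then have "r dvd Suc w'" by (metis dvd_add_right_iff dvd_triv_right)
        then show False using su(3) w Suc by (auto dest: dvd_imp_le)
      qed
      then have "chain_poly {q. r dvd q} 0 (s' * r + u') =
          [:0, 1:] * (chain_poly {q. r dvd q} 0 (s' * r + w) - chain_poly {q. r dvd q} 0 (s' * r + w'))"
        unfolding w Suc by simp
      also have "\<dots> = R ^ s' * chain_poly {} 0 u'"
        unfolding IH1 IH2 unfolding w Suc by (simp add: algebra_simps)
      finally show ?thesis unfolding su(1,4) R_def .
    qed
  qed
  show ?case
  proof (cases "u = 0")
    case False
    then show ?thesis using pos[of s u] less.prems by simp
  next
    case True
    show ?thesis
    proof (cases s)
      case 0
      then show ?thesis using True by simp
    next
      case (Suc s')
      then show ?thesis using pos[of s' r] True assms by (simp add: algebra_simps)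
    qed
  qed
qed

lemma num_triangulations_integral:
  assumes k3: "3 \<le> k" and r1: "1 \<le> r" and S: "S \<in> SC k r"
  shows "real (num_triangulations S) = (4 / pi) * (LBINT x:{0<..<pi/2}.
    ((2 * cos x) ^ r * (sin (real (Suc r) * x) / sin x)) ^ k / (4 * (cos x)\<^sup>2)\<^sup>2 * (sin x)\<^sup>2)"
proof -
  define K where "K = {q. r dvd q}"
  obtain p \<epsilon> where sub: "subdivided_polygon (k * r) K p \<epsilon>" and Sp: "S = p ` {..<k * r}"
    unfolding K_def using SC_subdivided_polygon[OF assms] by blast
  interpret subdivided_polygon "k * r" K p \<epsilon> by (rule sub)
  obtain g where g: "coeff g 0 = 0" "chain_poly K 0 (k * r) = [:0, 1:] * g"
    "real (card (tri_sets (k * r) K 0 (k * r - 1))) = shift_eval cat g"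
    using card_tri_sets_closed[OF cat_0 cat_Suc corners(1)] by blast
  \<comment> \<open>\<open>h\<close> is \<open>g\<close> divided by its argument, so the closed
    chain polynomial is \<open>t\<^sup>2 * h t\<close> and \<open>shift_eval cat g\<close> is the
    integral of \<open>h\<close>.\<close>
  define h where "h t = (\<Sum>i<degree g. coeff g (Suc i) * t ^ i)" for t :: real
  have gt: "poly g t = t * h t" for t
    unfolding poly_altdef h_def by (simp add: sum.atMost_shift g sum_distrib_left algebra_simps)
  have tt: "t\<^sup>2 * h t = poly (chain_poly {} 0 r) t ^ k" for t
  proof -
    have "t\<^sup>2 * h t = poly (chain_poly K 0 (k * r + 0)) t"
      using g(2) gt by (simp add: power2_eq_square)
    also have "\<dots> = poly (chain_poly {} 0 r) t ^ k"
      unfolding K_def chain_poly_multiples[OF r1 le0] by (simp add: poly_power)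
    finally show ?thesis .
  qed
  define H where "H x = h (4 * (cos x)\<^sup>2) * (sin x)\<^sup>2" for x :: real
  have "real (num_triangulations S) = shift_eval cat g"
    unfolding Sp num_triangulations_eq g(3) ..
  also have "\<dots> = (4 / pi) * (\<Sum>i<degree g. coeff g (Suc i) * integral {0..pi/2} (\<lambda>x. (4 * (cos x)\<^sup>2) ^ i * (sin x)\<^sup>2))"
    by (simp add: shift_eval_def cat_def sum_distrib_left algebra_simps)
  also have "\<dots> = (4 / pi) * integral {0..pi/2} H"
  proof -
    have "integral {0..pi/2} (\<lambda>x. \<Sum>i<degree g. coeff g (Suc i) * ((4 * (cos x)\<^sup>2) ^ i * (sin x)\<^sup>2))
        = (\<Sum>i<degree g. integral {0..pi/2} (\<lambda>x. coeff g (Suc i) * ((4 * (cos x)\<^sup>2) ^ i * (sin x)\<^sup>2)))"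
      by (intro integral_sum finite_lessThan integrable_on_mult_right cat_integrable)
    then show ?thesis
      unfolding H_def h_def sum_distrib_right mult.assoc integral_mult_right by simp
  qed
  \<comment> \<open>The quotient formula holds only where \<open>sin x\<close> and
    \<open>cos x\<close> are nonzero, hence the open interval.\<close>
  also have "integral {0..pi/2} H = (LBINT x:{0<..<pi/2}. H x)"
  proof -
    have "continuous_on {0..pi/2} H" unfolding H_def h_def by (intro continuous_intros)
    then have "set_integrable lborel {0..pi/2} H" by (rule borel_integrable_atLeastAtMost')
    then have "set_integrable lborel {0<..<pi/2} H" by (rule set_integrable_subset) auto
    then have "(LBINT x:{0<..<pi/2}. H x) = integral {0<..<pi/2} H"
      by (rule set_borel_integral_eq_integral(2))
    also have "\<dots> = integral {0..pi/2} H"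
      using integral_open_interval[of 0 "pi/2" H] by (simp add: box_real cbox_interval)
    finally show ?thesis ..
  qed
  also have "(LBINT x:{0<..<pi/2}. H x) = (LBINT x:{0<..<pi/2}.
    ((2 * cos x) ^ r * (sin (real (Suc r) * x) / sin x)) ^ k / (4 * (cos x)\<^sup>2)\<^sup>2 * (sin x)\<^sup>2)"
  proof (rule set_lebesgue_integral_cong)
    show "\<forall>x. x \<in> {0<..<pi/2} \<longrightarrow> H x =
      ((2 * cos x) ^ r * (sin (real (Suc r) * x) / sin x)) ^ k / (4 * (cos x)\<^sup>2)\<^sup>2 * (sin x)\<^sup>2"
    proof (intro allI impI)
      fix x :: real assume x: "x \<in> {0<..<pi/2}"
      have s: "sin x > 0" "cos x > 0" using x by (auto intro!: sin_gt_zero cos_gt_zero)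
      have P: "poly (chain_poly {} 0 r) (4 * (cos x)\<^sup>2) = (2 * cos x) ^ r * (sin (real (Suc r) * x) / sin x)"
        using chain_poly_chebyshev[of 0 r x] s by (simp add: field_simps)
      have "(4 * (cos x)\<^sup>2)\<^sup>2 * h (4 * (cos x)\<^sup>2) = ((2 * cos x) ^ r * (sin (real (Suc r) * x) / sin x)) ^ k"
        unfolding tt P ..
      then have "h (4 * (cos x)\<^sup>2) = ((2 * cos x) ^ r * (sin (real (Suc r) * x) / sin x)) ^ k / (4 * (cos x)\<^sup>2)\<^sup>2"
        using s by (intro nonzero_eq_divide_eq[THEN iffD2]) (auto simp: mult.commute)
      then show "H x = ((2 * cos x) ^ r * (sin (real (Suc r) * x) / sin x)) ^ k / (4 * (cos x)\<^sup>2)\<^sup>2 * (sin x)\<^sup>2"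
        by (simp add: H_def)
    qed
  qed simp
  finally show ?thesis .
qed

section \<open>Asymptotics\<close>

lemma mult_cos_le_sin:
  assumes "0 \<le> x" "x \<le> pi"
  shows "x * cos x \<le> sin (x :: real)"
proof -
  have "sin 0 - 0 * cos 0 \<le> sin x - x * cos x"
  proof (rule DERIV_nonneg_imp_nondecreasing[OF assms(1)])
    fix y assume y: "0 \<le> y" "y \<le> x"
    have "((\<lambda>x. sin x - x * cos x) has_real_derivative y * sin y) (at y)"
      by (auto intro!: derivative_eq_intros)
    moreover have "y * sin y \<ge> 0" using y assms by (intro mult_nonneg_nonneg sin_ge_zero) auto
    ultimately show "\<exists>z. ((\<lambda>x. sin x - x * cos x) has_real_derivative z) (at y) \<and> 0 \<le> z" by blast
  qed
  then show ?thesis by simp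
qed

lemma sin_over_decreasing:
  assumes "0 < x" "x \<le> y" "y \<le> pi"
  shows "sin y / y \<le> sin x / (x :: real)"
proof (rule DERIV_nonpos_imp_nonincreasing[OF assms(2)])
  fix z assume z: "x \<le> z" "z \<le> y"
  then have "z \<noteq> 0" using assms by simp
  then have "((\<lambda>x. sin x / x) has_real_derivative (cos z * z - sin z * 1) / (z * z)) (at z)"
    by (auto intro!: derivative_eq_intros)
  moreover have "(cos z * z - sin z * 1) / (z * z) \<le> 0"
    using mult_cos_le_sin[of z] z assms by (intro divide_nonpos_nonneg) (auto simp: mult.commute)
  ultimately show "\<exists>d. ((\<lambda>x. sin x / x) has_real_derivative d) (at z) \<and> d \<le> 0" by blast
qed

text \<open>The inequality \<open>y \<le> tan y\<close>, squared and freed of division.\<close>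

lemma cos_squared_le: 
  assumes "0 \<le> y" "y \<le> pi / 2"
  shows "(cos y)\<^sup>2 * (1 + y\<^sup>2) \<le> (1 :: real)"
proof -
  have "0 \<le> y * cos y" "y * cos y \<le> sin y"
    using assms by (auto intro!: mult_nonneg_nonneg cos_ge_zero mult_cos_le_sin)
  then have "(y * cos y)\<^sup>2 \<le> (sin y)\<^sup>2" by (intro power_mono)
  then have "y\<^sup>2 * (cos y)\<^sup>2 \<le> 1 - (cos y)\<^sup>2" by (simp add: power_mult_distrib sin_squared_eq)
  then show ?thesis by (simp add: algebra_simps)
qed

text \<open>For \<open>m x \<le> \<pi>\<close> halve the angle in \<open>sin (m x)\<close>; beyond that, \<open>sin (m x)\<^sup>2 \<le> 1\<close> suffices.\<close>

lemma sin_multiple_bound: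
  fixes m x :: real
  assumes m: "2 \<le> m" and x: "0 < x" "x \<le> pi / 2"
  shows "(sin (m * x))\<^sup>2 * (1 + (m * x)\<^sup>2 / 4) \<le> (m * sin x)\<^sup>2"
proof (cases "m * x \<le> pi")
  case True
  define y where "y = m * x / 2"
  have y: "x \<le> y" "0 < y" "y \<le> pi / 2" using m x True by (auto simp: y_def)
  have "sin y / y \<le> sin x / x" using sin_over_decreasing[of x y] x y by simp
  then have "sin y \<le> (m / 2) * sin x" using y x by (simp add: y_def field_simps)
  moreover have "0 \<le> sin y" using y by (intro sin_ge_zero) auto
  ultimately have s: "(sin y)\<^sup>2 \<le> ((m / 2) * sin x)\<^sup>2" by (intro power_mono)
  have "m * x = 2 * y" by (simp add: y_def)
  then have "(sin (m * x))\<^sup>2 * (1 + (m * x)\<^sup>2 / 4) = 4 * (sin y)\<^sup>2 * ((cos y)\<^sup>2 * (1 + y\<^sup>2))"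
    by (simp add: sin_double power_mult_distrib)
  also have "\<dots> \<le> 4 * (sin y)\<^sup>2 * 1"
    using cos_squared_le[of y] y by (intro mult_left_mono) auto
  also have "\<dots> \<le> 4 * ((m / 2) * sin x)\<^sup>2" using s by simp
  also have "\<dots> = (m * sin x)\<^sup>2" by (simp add: power_mult_distrib field_simps)
  finally show ?thesis .
next
  case False
  \<comment> \<open>Jordan's inequality \<open>2 / pi * x \<le> sin x\<close>.\<close>
  have "sin (pi / 2) / (pi / 2) \<le> sin x / x" using sin_over_decreasing[of x "pi / 2"] x by simp
  then have "2 / pi * x \<le> sin x" using x by (simp add: field_simps)
  then have "2 / pi * (m * x) \<le> m * sin x" using m by (simp add: field_simps)
  then have "(2 / pi * (m * x))\<^sup>2 \<le> (m * sin x)\<^sup>2" using m x by (intro power_mono) auto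
  \<comment> \<open>Both sides are affine in \<open>(m * x)\<^sup>2\<close> and the right one is
    steeper, so the case \<open>m * x = pi\<close> decides; there the claim is
    \<open>pi\<^sup>2 \<le> 12\<close>.\<close>
  moreover have "1 + (m * x)\<^sup>2 / 4 \<le> (2 / pi * (m * x))\<^sup>2"
  proof -
    have "pi\<^sup>2 \<le> (3.2 :: real)\<^sup>2" by (intro power_mono) (use pi_approx in auto)
    then have pi2: "pi\<^sup>2 \<le> 12" by (simp add: power2_eq_square)
    then have "1/12 \<le> 1 / pi\<^sup>2" by (simp add: field_simps)
    then have c: "0 \<le> 4 / pi\<^sup>2 - 1/4" by simp
    have "pi\<^sup>2 \<le> (m * x)\<^sup>2" using False by (intro power_mono) auto
    then have "(4 / pi\<^sup>2 - 1/4) * pi\<^sup>2 \<le> (4 / pi\<^sup>2 - 1/4) * (m * x)\<^sup>2" using c by (intro mult_left_mono)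
    moreover have "(4 / pi\<^sup>2 - 1/4) * pi\<^sup>2 = 4 - pi\<^sup>2 / 4" by (simp add: algebra_simps)
    ultimately show ?thesis using pi2 by (simp add: power_mult_distrib power_divide algebra_simps)
  qed
  moreover have "(sin (m * x))\<^sup>2 * (1 + (m * x)\<^sup>2 / 4) \<le> 1 * (1 + (m * x)\<^sup>2 / 4)"
    by (intro mult_right_mono) (auto simp: abs_square_le_1)
  ultimately show ?thesis unfolding mult_1 by (meson order_trans)
qed

text \<open>Minus the quadratic coefficient of the logarithm: \<open>cos x ^ r\<close> contributes
  \<open>r / 2\<close>, the quotient of sines \<open>((r + 1)\<^sup>2 - 1) / 6\<close>.\<close>

definition \<sigma> :: "nat \<Rightarrow> real" where
  "\<sigma> r = real r * (real r + 5) / 6"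

lemma \<sigma>_ge_1: "1 \<le> r \<Longrightarrow> 1 \<le> \<sigma> r"
proof -
  assume "1 \<le> r"
  then have "1 * 6 \<le> real r * (real r + 5)" by (intro mult_mono) auto
  then show ?thesis by (simp add: \<sigma>_def)
qed

definition ratio :: "nat \<Rightarrow> real \<Rightarrow> real" where
  "ratio r x = sin (real (Suc r) * x) / (real (Suc r) * sin x)"

text \<open>The integrand of the counting formula, divided by its maximal value and rescaled by
  \<open>x = u / \<surd>(\<sigma> k)\<close>.\<close>

definition scaled :: "nat \<Rightarrow> nat \<Rightarrow> real \<Rightarrow> real" where
  "scaled r k u = (let x = u / sqrt (\<sigma> r * real k) in
     indicator {0<..<pi/2} x * ((cos x ^ r * ratio r x) ^ k / cos x ^ 4 * (\<sigma> r * real k * (sin x)\<^sup>2)))"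

text \<open>\<open>sin_multiple_bound\<close> and \<open>3 * \<sigma> r \<le> m\<^sup>2\<close>
  bound the square of the ratio by \<open>1 / (1 + w / k)\<close>. Bernoulli on a quarter of the
  exponent, followed by a fourth power and a square root, gives decay of order
  \<open>1 / u ^ 4\<close>, enough to integrate against \<open>u\<^sup>2\<close>.\<close>

lemma ratio_power_bound:
  assumes r: "1 \<le> r" and k: "4 \<le> k" and x: "0 < x" "x \<le> pi / 2" and u: "x = u / sqrt (\<sigma> r * real k)"
  shows "\<bar>ratio r x\<bar> ^ k \<le> 1 / (1 + 3 / 32 * u\<^sup>2)\<^sup>2"
proof -
  define m where "m = real (Suc r)"
  define w where "w = 3 / 4 * u\<^sup>2"
  have k0: "real k > 0" using k by simp
  have s1: "1 \<le> \<sigma> r" using \<sigma>_ge_1 r .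
  have sx: "sin x > 0" using x by (intro sin_gt_zero) auto
  have m: "2 \<le> m" "m > 0" using r by (auto simp: m_def)
  have w0: "0 \<le> w" by (simp add: w_def)
  have "6 * \<sigma> r = m\<^sup>2 + 3 * m - 4" by (simp add: \<sigma>_def m_def power2_eq_square algebra_simps)
  moreover have "(m - 2)\<^sup>2 + m \<ge> 0" using m by simp
  ultimately have s3: "3 * \<sigma> r \<le> m\<^sup>2" by (simp add: power2_eq_square algebra_simps)
  have x2: "x\<^sup>2 = u\<^sup>2 / (\<sigma> r * real k)" using s1 k0 by (simp add: u power_divide)
  have "w / real k \<le> (m * x)\<^sup>2 / 4"
  proof -
    have "3 * \<sigma> r * (u\<^sup>2 / (4 * \<sigma> r * real k)) \<le> m\<^sup>2 * (u\<^sup>2 / (4 * \<sigma> r * real k))"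
      using s3 s1 k0 by (intro mult_right_mono) auto
    then show ?thesis using s1 k0 by (simp add: x2 w_def power_mult_distrib field_simps)
  qed
  have den: "1 + (m * x)\<^sup>2 / 4 > 0" by (simp add: add_pos_nonneg)
  have "(ratio r x)\<^sup>2 = (sin (m * x))\<^sup>2 / (m * sin x)\<^sup>2" by (simp add: ratio_def m_def power_divide)
  also have "\<dots> \<le> 1 / (1 + (m * x)\<^sup>2 / 4)"
    using sin_multiple_bound[OF m(1) x] den sx m by (simp add: field_simps)
  also have "\<dots> \<le> 1 / (1 + w / real k)"
    using \<open>w / real k \<le> _\<close> w0 k0 by (intro divide_left_mono mult_pos_pos) (auto simp: add_pos_nonneg)
  finally have r2: "(ratio r x)\<^sup>2 \<le> 1 / (1 + w / real k)" .
  \<comment> \<open>For \<open>k \<ge> 4\<close> the quotient \<open>q / k\<close> is at least 1/8,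
    the source of \<open>w / 8 = 3 / 32 * u\<^sup>2\<close>.\<close>
  define q where "q = k div 4"
  have q: "4 * q \<le> k" "k \<le> 8 * q" using k unfolding q_def by presburger+
  have "real k \<le> 8 * real q" using q by linarith
  then have "w / 8 \<le> real q * (w / real k)" using mult_left_mono[of "real k" "8 * real q" w] w0 k0 by (simp add: field_simps)
  then have "1 + w / 8 \<le> 1 + real q * (w / real k)" by simp
  also have "\<dots> \<le> (1 + w / real k) ^ q"
  proof (rule Bernoulli_inequality)
    have "0 \<le> w / real k" using w0 k0 by simp
    then show "- 1 \<le> w / real k" by linarith
  qed
  finally have "(1 + w / 8) ^ 4 \<le> ((1 + w / real k) ^ q) ^ 4"
    using w0 by (intro power_mono) auto
  also have "\<dots> = (1 + w / real k) ^ (4 * q)" by (simp add: power_mult[symmetric] mult.commute)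
  also have "\<dots> \<le> (1 + w / real k) ^ k" using q w0 k0 by (intro power_increasing) auto
  finally have big: "(1 + w / 8) ^ 4 \<le> (1 + w / real k) ^ k" .
  have "(\<bar>ratio r x\<bar> ^ k)\<^sup>2 = ((ratio r x)\<^sup>2) ^ k" by (simp add: power_mult[symmetric] power_even_abs mult.commute)
  also have "\<dots> \<le> (1 / (1 + w / real k)) ^ k" using r2 by (intro power_mono) auto
  also have "\<dots> = 1 / (1 + w / real k) ^ k" by (simp add: power_divide)
  also have "\<dots> \<le> 1 / (1 + w / 8) ^ 4"
    using big w0 k0 by (intro divide_left_mono mult_pos_pos) (auto intro!: zero_less_power add_pos_nonneg)
  also have "\<dots> = (1 / (1 + w / 8)\<^sup>2)\<^sup>2" by (simp add: power_divide power_mult[symmetric])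
  finally have "\<bar>ratio r x\<bar> ^ k \<le> 1 / (1 + w / 8)\<^sup>2"
    by (rule power2_le_imp_le) simp
  then show ?thesis by (simp add: w_def mult.commute)
qed

text \<open>Since \<open>r * k \<ge> 4\<close>, the four cosines of the denominator cancel; the
  remaining ones are at most 1, and \<open>sin x \<le> x\<close> bounds the weight by
  \<open>u\<^sup>2\<close>.\<close>

lemma scaled_bound:
  assumes r: "1 \<le> r" and k: "4 \<le> k"
  shows "\<bar>scaled r k u\<bar> \<le> indicator {0<..} u * ((32 / 3)\<^sup>2 * (1 / (1 + u\<^sup>2)))"
proof (cases "u / sqrt (\<sigma> r * real k) \<in> {0<..<pi/2}")
  case False
  then show ?thesis by (auto simp: scaled_def Let_def indicator_def)
next
  case True
  define x where "x = u / sqrt (\<sigma> r * real k)"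
  have sk: "\<sigma> r * real k > 0" using \<sigma>_ge_1[OF r] k by (intro mult_pos_pos) auto
  have x: "0 < x" "x < pi / 2" using True by (auto simp: x_def)
  have u0: "u > 0" using x(1) sk by (simp add: x_def zero_less_divide_iff)
  have c: "cos x > 0" "cos x \<le> 1" using x by (auto intro: cos_gt_zero)
  have s: "0 \<le> sin x" "sin x \<le> x" using x by (auto intro: sin_ge_zero sin_x_le_x)
  have rk: "4 \<le> r * k" using mult_mono[OF r k] by simp
  have "\<bar>scaled r k u\<bar> = cos x ^ (r * k - 4) * \<bar>ratio r x\<bar> ^ k * (\<sigma> r * real k * (sin x)\<^sup>2)"
  proof -
    have "cos x ^ (r * k) = cos x ^ (r * k - 4) * cos x ^ 4"
      using rk by (simp add: power_add[symmetric])
    then have "(cos x ^ r * ratio r x) ^ k / cos x ^ 4 = cos x ^ (r * k - 4) * ratio r x ^ k"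
      using c by (simp add: power_mult_distrib power_mult[symmetric])
    moreover have "scaled r k u = (cos x ^ r * ratio r x) ^ k / cos x ^ 4 * (\<sigma> r * real k * (sin x)\<^sup>2)"
      unfolding scaled_def Let_def x_def[symmetric] using x by simp
    ultimately have "scaled r k u = cos x ^ (r * k - 4) * ratio r x ^ k * (\<sigma> r * real k * (sin x)\<^sup>2)"
      by simp
    then show ?thesis using c sk \<sigma>_ge_1[OF r] by (simp add: abs_mult power_abs)
  qed
  also have "\<dots> \<le> 1 * (1 / (1 + 3 / 32 * u\<^sup>2)\<^sup>2) * u\<^sup>2"
  proof (intro mult_mono)
    show "cos x ^ (r * k - 4) \<le> 1" using c by (intro power_le_one) auto
    show "\<bar>ratio r x\<bar> ^ k \<le> 1 / (1 + 3 / 32 * u\<^sup>2)\<^sup>2"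
      using ratio_power_bound[OF r k] x x_def by simp
    have "\<sigma> r * real k * (sin x)\<^sup>2 \<le> \<sigma> r * real k * x\<^sup>2"
      using s sk by (intro mult_left_mono power_mono) auto
    also have "x\<^sup>2 = u\<^sup>2 / (\<sigma> r * real k)" using sk by (simp add: x_def power_divide)
    also have "\<sigma> r * real k * (u\<^sup>2 / (\<sigma> r * real k)) = u\<^sup>2"
      using sk by (metis less_irrefl nonzero_mult_div_cancel_left times_divide_eq_right)
    finally show "\<sigma> r * real k * (sin x)\<^sup>2 \<le> u\<^sup>2" .
  qed (use c sk in auto)
  also have "\<dots> \<le> (32 / 3)\<^sup>2 * (1 / (1 + u\<^sup>2))"
  proof -
    have "3 / 32 * (1 + u\<^sup>2) \<le> 1 + 3 / 32 * u\<^sup>2" by simp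
    then have "(3 / 32 * (1 + u\<^sup>2))\<^sup>2 \<le> (1 + 3 / 32 * u\<^sup>2)\<^sup>2" by (intro power_mono) auto
    then have "u\<^sup>2 / (1 + 3 / 32 * u\<^sup>2)\<^sup>2 \<le> (1 + u\<^sup>2) / (3 / 32 * (1 + u\<^sup>2))\<^sup>2"
    proof (intro frac_le)
      show "0 < (3 / 32 * (1 + u\<^sup>2))\<^sup>2" by (intro zero_less_power mult_pos_pos add_pos_nonneg) auto
    qed auto
    also have "\<dots> = (32 / 3)\<^sup>2 * (1 / (1 + u\<^sup>2))"
    proof -
      define y where "y = 1 + u\<^sup>2"
      have "y > 0" by (simp add: y_def add_pos_nonneg)
      then show ?thesis unfolding y_def[symmetric] by (simp add: power2_eq_square field_simps)
    qed
    finally show ?thesis by simp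
  qed
  finally show ?thesis using u0 by simp
qed

section \<open>Pointwise limit of the rescaled integrand and dominated convergence\<close>

lemma ln_cos_limit: "((\<lambda>x::real. ln (cos x) / x\<^sup>2 + 1/2) \<longlongrightarrow> 0) (at_right 0)"
  by real_asymp

lemma ln_sinc_limit: "((\<lambda>x::real. ln (sin x / x) / x\<^sup>2 + 1/6) \<longlongrightarrow> 0) (at_right 0)"
  by real_asymp

lemma weight_limit: "((\<lambda>x::real. (sin x / x)\<^sup>2 / cos x ^ 4) \<longlongrightarrow> 1) (at_right 0)"
  by real_asymp

text \<open>With \<open>A\<close> and \<open>B\<close> the errors of the quadratic approximations,
  \<open>k * ln g = u\<^sup>2 * (- 1 + e k)\<close>, where \<open>e k\<close> combines them with the
  weights \<open>r / \<sigma>\<close>, \<open>m\<^sup>2 / \<sigma>\<close> and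
  \<open>1 / \<sigma>\<close>. These are at most 6 for every \<open>r\<close>, which is why
  \<open>r\<close> may vary with \<open>k\<close>.\<close>

lemma scaled_limit:
  assumes r: "\<forall>\<^sub>F k in sequentially. 1 \<le> r k" and u: "0 < u"
  shows "(\<lambda>k. scaled (r k) k u) \<longlonglongrightarrow> u\<^sup>2 * exp (- u\<^sup>2)"
proof -
  define s where "s k = \<sigma> (r k)" for k
  define x where "x k = u / sqrt (s k * real k)" for k
  define m where "m k = real (Suc (r k))" for k
  define A where "A x = ln (cos x) / x\<^sup>2 + 1/2" for x :: real
  define B where "B x = ln (sin x / x) / x\<^sup>2 + 1/6" for x :: real
  have ev: "\<forall>\<^sub>F k in sequentially. 1 \<le> r k \<and> 0 < k"
    using r eventually_gt_at_top[of 0] by eventually_elim simp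
  have base: "0 < x k" "0 < m k * x k" "(x k)\<^sup>2 = u\<^sup>2 / (s k * real k)" "1 \<le> s k"
    "(m k)\<^sup>2 \<le> 6 * s k" if "1 \<le> r k \<and> 0 < k" for k
  proof -
    show s1: "1 \<le> s k" using that \<sigma>_ge_1 by (simp add: s_def)
    then have sk: "0 < s k * real k" using that by (intro mult_pos_pos) auto
    show "0 < x k" using u sk by (simp add: x_def)
    then show "0 < m k * x k" by (simp add: m_def)
    show "(x k)\<^sup>2 = u\<^sup>2 / (s k * real k)" using sk by (simp add: x_def power_divide)
    show "(m k)\<^sup>2 \<le> 6 * s k" using that by (simp add: s_def m_def \<sigma>_def power2_eq_square algebra_simps)
  qed
  have lim0: "(\<lambda>k. sqrt (6 * u\<^sup>2 / real k)) \<longlonglongrightarrow> 0"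
    using tendsto_real_sqrt[OF lim_const_over_n[of "6 * u\<^sup>2"]] by simp
  have mx_le: "m k * x k \<le> sqrt (6 * u\<^sup>2 / real k)" if "1 \<le> r k \<and> 0 < k" for k
  proof (rule real_le_rsqrt)
    have "(m k * x k)\<^sup>2 = (m k)\<^sup>2 * (u\<^sup>2 / (s k * real k))" using base[OF that] by (simp add: power_mult_distrib)
    also have "\<dots> \<le> 6 * s k * (u\<^sup>2 / (s k * real k))" using base[OF that] by (intro mult_right_mono) auto
    also have "\<dots> = 6 * u\<^sup>2 / real k" using base(4)[OF that] by (simp add: field_simps)
    finally show "(m k * x k)\<^sup>2 \<le> 6 * u\<^sup>2 / real k" .
  qed
  \<comment> \<open>This is the larger of the two angles;
    \<open>m\<^sup>2 \<le> 6 * \<sigma>\<close> compensates the growth of \<open>r\<close>.\<close>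
  have mx_lim: "(\<lambda>k. m k * x k) \<longlonglongrightarrow> 0"
  proof (rule tendsto_sandwich[OF _ _ tendsto_const lim0])
    show "\<forall>\<^sub>F k in sequentially. 0 \<le> m k * x k"
      using ev by (rule eventually_mono) (rule less_imp_le[OF base(2)])
    show "\<forall>\<^sub>F k in sequentially. m k * x k \<le> sqrt (6 * u\<^sup>2 / real k)"
      using ev by (rule eventually_mono) (rule mx_le)
  qed
  have mx: "filterlim (\<lambda>k. m k * x k) (at_right 0) sequentially"
    using mx_lim eventually_mono[OF ev base(2)] by (simp add: tendsto_imp_filterlim_at_right)
  have x_lim: "x \<longlonglongrightarrow> 0"
  proof (rule tendsto_sandwich[OF _ _ tendsto_const mx_lim])
    have "x k \<le> m k * x k" if "1 \<le> r k \<and> 0 < k" for k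
      using base(1)[OF that] mult_right_mono[of 1 "m k" "x k"] by (simp add: m_def)
    with ev show "\<forall>\<^sub>F k in sequentially. x k \<le> m k * x k" by (rule eventually_mono)
    show "\<forall>\<^sub>F k in sequentially. 0 \<le> x k"
      using ev by (rule eventually_mono) (rule less_imp_le[OF base(1)])
  qed
  have x: "filterlim x (at_right 0) sequentially"
    using x_lim eventually_mono[OF ev base(1)] by (simp add: tendsto_imp_filterlim_at_right)
  have A: "(\<lambda>k. A (x k)) \<longlonglongrightarrow> 0" using filterlim_compose[OF ln_cos_limit x] by (simp add: A_def)
  have Bx: "(\<lambda>k. B (x k)) \<longlonglongrightarrow> 0" using filterlim_compose[OF ln_sinc_limit x] by (simp add: B_def)
  have Bmx: "(\<lambda>k. B (m k * x k)) \<longlonglongrightarrow> 0" using filterlim_compose[OF ln_sinc_limit mx] by (simp add: B_def)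
  define e where "e k = (real (r k) / s k) * A (x k) + ((m k)\<^sup>2 / s k) * B (m k * x k) - (1 / s k) * B (x k)" for k
  have e: "e \<longlonglongrightarrow> 0 + 0 - 0"
    unfolding e_def
  proof (intro tendsto_add tendsto_diff)
    have r_le: "\<bar>real (r k) / s k\<bar> \<le> 6" "\<bar>(m k)\<^sup>2 / s k\<bar> \<le> 6" "\<bar>1 / s k\<bar> \<le> 6" if "1 \<le> r k \<and> 0 < k" for k
    proof -
      have "real (r k) * 6 \<le> real (r k) * (real (r k) + 5)" using that by (intro mult_left_mono) auto
      then have "real (r k) \<le> 6 * s k" by (simp add: s_def \<sigma>_def)
      then show "\<bar>real (r k) / s k\<bar> \<le> 6" "\<bar>(m k)\<^sup>2 / s k\<bar> \<le> 6" "\<bar>1 / s k\<bar> \<le> 6"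
        using base[OF that] by (auto simp: field_simps)
    qed
    have null: "(\<lambda>k. f k * g k) \<longlonglongrightarrow> 0" if "g \<longlonglongrightarrow> 0" "\<And>k. 1 \<le> r k \<and> 0 < k \<Longrightarrow> \<bar>f k\<bar> \<le> 6" for f g :: "nat \<Rightarrow> real"
    proof (rule tendsto_0_le[OF that(1), of _ 6])
      show "\<forall>\<^sub>F k in sequentially. norm (f k * g k) \<le> norm (g k) * 6"
        using ev
      proof eventually_elim
        case (elim k)
        have "\<bar>g k\<bar> * \<bar>f k\<bar> \<le> \<bar>g k\<bar> * 6" using that(2)[OF elim] by (intro mult_left_mono) auto
        then show ?case by (simp add: abs_mult mult.commute)
      qed
    qed
    show "(\<lambda>k. real (r k) / s k * A (x k)) \<longlonglongrightarrow> 0" by (rule null[OF A r_le(1)])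
    show "(\<lambda>k. (m k)\<^sup>2 / s k * B (m k * x k)) \<longlonglongrightarrow> 0" by (rule null[OF Bmx r_le(2)])
    show "(\<lambda>k. 1 / s k * B (x k)) \<longlonglongrightarrow> 0" by (rule null[OF Bx r_le(3)])
  qed
  \<comment> \<open>Below \<open>pi / 2\<close> the sines and cosines are positive, so that the
    logarithms split.\<close>
  have small: "\<forall>\<^sub>F k in sequentially. m k * x k < pi / 2"
    using mx_lim by (rule order_tendstoD(2)) simp
  have "\<forall>\<^sub>F k in sequentially. scaled (r k) k u =
      exp (u\<^sup>2 * (- 1 + e k)) * (u\<^sup>2 * ((sin (x k) / x k)\<^sup>2 / cos (x k) ^ 4))"
    using ev small
  proof eventually_elim
    case (elim k)
    note b = base[OF elim(1)]
    have "x k \<le> m k * x k" using b(1) mult_right_mono[of 1 "m k" "x k"] by (simp add: m_def)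
    then have xk: "0 < x k" "x k < pi / 2" "m k * x k < pi / 2" using elim(2) b(1) by linarith+
    have c: "cos (x k) > 0" using xk by (intro cos_gt_zero) auto
    have sn: "sin (x k) > 0" using xk by (intro sin_gt_zero) auto
    have smn: "sin (m k * x k) > 0" using xk b by (intro sin_gt_zero) auto
    have sk: "s k * real k > 0" using b elim by (intro mult_pos_pos) auto
    have lnc: "ln (cos (x k)) = (x k)\<^sup>2 * (A (x k) - 1/2)" using b(1) by (simp add: A_def)
    have lns: "ln (sin (x k) / x k) = (x k)\<^sup>2 * (B (x k) - 1/6)" using b(1) by (simp add: B_def)
    have lnm: "ln (sin (m k * x k) / (m k * x k)) = (m k * x k)\<^sup>2 * (B (m k * x k) - 1/6)"
      using b(2) by (simp add: B_def)
    define g where "g = cos (x k) ^ r k * ratio (r k) (x k)"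
    have g: "g = cos (x k) ^ r k * ((sin (m k * x k) / (m k * x k)) / (sin (x k) / x k))"
      using xk by (simp add: g_def ratio_def m_def)
    have g0: "g > 0"
      unfolding g using c sn smn b(1) by (intro mult_pos_pos divide_pos_pos zero_less_power) (simp_all add: m_def)
    have "ln g = real (r k) * ln (cos (x k)) + ln (sin (m k * x k) / (m k * x k)) - ln (sin (x k) / x k)"
    proof -
      have pos: "0 < sin (m k * x k) / (m k * x k)" "0 < sin (x k) / x k"
        by (rule divide_pos_pos[OF smn b(2)], rule divide_pos_pos[OF sn b(1)])
      have "ln g = ln (cos (x k) ^ r k) + ln ((sin (m k * x k) / (m k * x k)) / (sin (x k) / x k))"
        unfolding g by (rule ln_mult_pos[OF zero_less_power[OF c] divide_pos_pos[OF pos]])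
      then show ?thesis using c ln_divide_pos[OF pos] by (simp add: ln_realpow)
    qed
    also have "\<dots> = (x k)\<^sup>2 * (real (r k) * A (x k) + (m k)\<^sup>2 * B (m k * x k) - B (x k)
        - (real (r k) / 2 + ((m k)\<^sup>2 - 1) / 6))"
      unfolding lnc lns lnm by (simp add: power_mult_distrib field_simps)
    also have "real (r k) / 2 + ((m k)\<^sup>2 - 1) / 6 = s k"
      by (simp add: s_def m_def \<sigma>_def power2_eq_square field_simps)
    finally have "real k * ln g = (real k * (x k)\<^sup>2) * (real (r k) * A (x k) + (m k)\<^sup>2 * B (m k * x k) - B (x k) - s k)"
      by simp
    also have "real k * (x k)\<^sup>2 = u\<^sup>2 / s k" using b elim by simp
    also have "u\<^sup>2 / s k * (real (r k) * A (x k) + (m k)\<^sup>2 * B (m k * x k) - B (x k) - s k) = u\<^sup>2 * (- 1 + e k)"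
      using b by (simp add: e_def field_simps)
    finally have lng: "real k * ln g = u\<^sup>2 * (- 1 + e k)" .
    have gk: "g ^ k = exp (u\<^sup>2 * (- 1 + e k))"
      using g0 lng by (metis exp_ln exp_of_nat_mult)
    have "scaled (r k) k u = g ^ k / cos (x k) ^ 4 * (s k * real k * (sin (x k))\<^sup>2)"
      using xk by (simp add: scaled_def Let_def x_def s_def g_def)
    also have "s k * real k = u\<^sup>2 / (x k)\<^sup>2" using b(3) sk xk u by (simp add: field_simps)
    finally show ?case unfolding gk by (simp add: power_divide)
  qed
  moreover have "(\<lambda>k. exp (u\<^sup>2 * (- 1 + e k)) * (u\<^sup>2 * ((sin (x k) / x k)\<^sup>2 / cos (x k) ^ 4)))
      \<longlonglongrightarrow> exp (u\<^sup>2 * (- 1 + (0 + 0 - 0))) * (u\<^sup>2 * 1)"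
    by (intro tendsto_intros e filterlim_compose[OF weight_limit x])
  ultimately show ?thesis by (simp add: tendsto_cong mult.commute)
qed

lemma scaled_integral_limit:
  assumes r: "\<And>k. 3 \<le> k \<Longrightarrow> 1 \<le> r k"
  shows "(\<lambda>k. \<integral>u. scaled (r k) k u \<partial>lborel) \<longlonglongrightarrow> sqrt pi / 4"
proof -
  define f where "f u = indicator {0..} u *\<^sub>R (exp (- u\<^sup>2) * u\<^sup>2)" for u :: real
  have f: "has_bochner_integral lborel f (sqrt pi / 4)"
    using gaussian_moment_even_pos[of 1] by (simp add: f_def[abs_def])
  \<comment> \<open>Shifted by 4 because \<open>scaled_bound\<close> asks for
    \<open>k \<ge> 4\<close>. The limit is half of a Gaussian second moment.\<close>
  have "(\<lambda>k. \<integral>u. scaled (r (k + 4)) (k + 4) u \<partial>lborel) \<longlonglongrightarrow> (\<integral>u. f u \<partial>lborel)"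
  proof (rule integral_dominated_convergence[where w = "\<lambda>u. indicator {0<..} u * ((32 / 3)\<^sup>2 * (1 / (1 + u\<^sup>2)))"])
    show "f \<in> borel_measurable lborel" by (rule borel_measurable_has_bochner_integral[OF f])
    show "scaled (r (k + 4)) (k + 4) \<in> borel_measurable lborel" for k
      unfolding scaled_def Let_def ratio_def by measurable
    have "set_integrable lborel {0<..} (\<lambda>u::real. 1 / (1 + u\<^sup>2))"
      using integrable_I0i_1_div_plus_square
      by (simp add: interval_lebesgue_integrable_def zero_ereal_def)
    then have "integrable lborel (\<lambda>u::real. (32 / 3)\<^sup>2 * (indicator {0<..} u *\<^sub>R (1 / (1 + u\<^sup>2))))"
      unfolding set_integrable_def by (rule integrable_mult_right)
    then show "integrable lborel (\<lambda>u::real. indicator {0<..} u * ((32 / 3)\<^sup>2 * (1 / (1 + u\<^sup>2))))"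
      by (simp add: mult_ac)
    show "AE u in lborel. norm (scaled (r (k + 4)) (k + 4) u) \<le> indicator {0<..} u * ((32 / 3)\<^sup>2 * (1 / (1 + u\<^sup>2)))" for k
      using scaled_bound[of "r (k + 4)" "k + 4"] r[of "k + 4"] by simp
    show "AE u in lborel. (\<lambda>k. scaled (r (k + 4)) (k + 4) u) \<longlonglongrightarrow> f u"
    proof (rule AE_I2)
      fix u :: real
      show "(\<lambda>k. scaled (r (k + 4)) (k + 4) u) \<longlonglongrightarrow> f u"
      proof (cases "0 < u")
        case True
        have "\<forall>\<^sub>F k in sequentially. 1 \<le> r k" using r by (auto simp: eventually_sequentially)
        from LIMSEQ_ignore_initial_segment[OF scaled_limit[OF this True], of 4]
        show ?thesis using True by (simp add: f_def mult.commute)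
      next
        case False
        have "scaled (r (k + 4)) (k + 4) u = 0" for k
        proof -
          have "\<sigma> (r (k + 4)) * real (k + 4) > 0"
            using \<sigma>_ge_1[OF r[of "k + 4"]] by (intro mult_pos_pos) auto
          then have "u / sqrt (\<sigma> (r (k + 4)) * real (k + 4)) \<le> 0"
            using False by (intro divide_nonpos_pos) auto
          then show ?thesis by (simp add: scaled_def Let_def)
        qed
        moreover have "f u = 0" using False by (cases "u = 0") (auto simp: f_def)
        ultimately show ?thesis by simp
      qed
    qed
  qed
  then show ?thesis
    using has_bochner_integral_integral_eq[OF f] LIMSEQ_offset by fastforce
qed

theorem theorem6p4:
  fixes r :: "nat \<Rightarrow> nat" and S :: "nat \<Rightarrow> (real^2) set"
  assumes "\<And>k. k \<ge> 3 \<Longrightarrow> r k \<ge> 1"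
    and "\<And>k. k \<ge> 3 \<Longrightarrow> S k \<in> SC k (r k)"
  shows "(\<lambda>k. real (num_triangulations (S k))) \<sim>[at_top]
    (\<lambda>k. (2 ^ r k * (real (r k) + 1)) ^ k /
         (16 * sqrt pi * (real (r k) * (real (r k) + 5) / 6) powr (3/2) * real k powr (3/2)))"
proof (rule asymp_equivI')
  define I where "I k = (\<integral>u. scaled (r k) k u \<partial>lborel)" for k
  define T where "T k = (2 ^ r k * (real (r k) + 1)) ^ k /
         (16 * sqrt pi * (real (r k) * (real (r k) + 5) / 6) powr (3/2) * real k powr (3/2))" for k
  \<comment> \<open>An identity for each \<open>k\<close>, so that only the integral has to be sent
    to its limit \<open>sqrt pi / 4\<close>.\<close>
  have "real (num_triangulations (S k)) / T k = 4 / sqrt pi * I k" if k: "3 \<le> k" for k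
  proof -
    define M where "M = (2 ^ r k * (real (r k) + 1)) ^ k"
    define q where "q = sqrt (\<sigma> (r k) * real k)"
    have pos: "0 < \<sigma> (r k)" "0 < real k" using \<sigma>_ge_1[OF assms(1)[OF k]] k by auto
    have q: "q > 0" "q\<^sup>2 = \<sigma> (r k) * real k" using pos by (auto simp: q_def)
    define h where "h x = indicator {0<..<pi/2} x *
      (((2 * cos x) ^ r k * (sin (real (Suc (r k)) * x) / sin x)) ^ k / (4 * (cos x)\<^sup>2)\<^sup>2 * (sin x)\<^sup>2)" for x :: real
    \<comment> \<open>The value at angle 0 is split off: \<open>M\<close> from the powers, 16 from
      \<open>(4 * (cos x)\<^sup>2)\<^sup>2\<close>. The factor \<open>1 / q\<^sup>2\<close>
      compensates the scale of \<open>(sin x)\<^sup>2\<close>.\<close>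
    have h: "h (u / q) = M / (16 * q\<^sup>2) * scaled (r k) k u" for u
    proof -
      define x where "x = u / q"
      have "((2 * cos x) ^ r k * (sin (real (Suc (r k)) * x) / sin x)) = 2 ^ r k * (real (r k) + 1) * (cos x ^ r k * ratio (r k) x)"
      proof -
        have "(real (r k) + 1) * ratio (r k) x = sin (real (Suc (r k)) * x) / sin x"
          using nonzero_mult_divide_mult_cancel_left[of "real (Suc (r k))" "sin (real (Suc (r k)) * x)" "sin x"]
          by (simp only: ratio_def times_divide_eq_right of_nat_Suc add.commute)
        from this[symmetric] show ?thesis by (simp only: power_mult_distrib mult_ac)
      qed
      then have "((2 * cos x) ^ r k * (sin (real (Suc (r k)) * x) / sin x)) ^ k = M * (cos x ^ r k * ratio (r k) x) ^ k"
        by (simp add: M_def power_mult_distrib)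
      moreover have "(4 * (cos x)\<^sup>2)\<^sup>2 = 16 * cos x ^ 4" by (simp add: power_mult_distrib power_mult[symmetric])
      ultimately have "h x = M / (16 * q\<^sup>2) * (indicator {0<..<pi/2} x *
          ((cos x ^ r k * ratio (r k) x) ^ k / cos x ^ 4 * (q\<^sup>2 * (sin x)\<^sup>2)))"
        using q(1) by (simp add: h_def)
      then show ?thesis by (simp add: scaled_def Let_def x_def q(2) q_def[symmetric])
    qed
    have "real (num_triangulations (S k)) = 4 / pi * (\<integral>x. h x \<partial>lborel)"
      using num_triangulations_integral[OF k assms(1)[OF k] assms(2)[OF k]]
      by (simp add: h_def set_lebesgue_integral_def)
    \<comment> \<open>The substitution \<open>x = u / q\<close> supplies the third factor
      \<open>1 / q\<close>, hence the exponents \<open>3/2\<close>.\<close>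
    also have "(\<integral>x. h x \<partial>lborel) = 1 / q * (\<integral>u. h (u / q) \<partial>lborel)"
      using lborel_integral_real_affine[of "1 / q" h 0] q by simp
    also have "\<dots> = M / (16 * (q * q\<^sup>2)) * I k"
      unfolding h I_def by simp
    also have "q * q\<^sup>2 = \<sigma> (r k) powr (3/2) * real k powr (3/2)"
    proof -
      have "q * q\<^sup>2 = (\<sigma> (r k) * real k) powr (1/2) * (\<sigma> (r k) * real k) powr 1"
        using pos by (simp add: q(2)) (simp add: q_def powr_half_sqrt)
      also have "\<dots> = (\<sigma> (r k) * real k) powr (3/2)" unfolding powr_add[symmetric] by simp
      finally show ?thesis using pos by (simp add: powr_mult)
    qed
    finally have N: "real (num_triangulations (S k)) =
      4 / pi * (M / (16 * (\<sigma> (r k) powr (3/2) * real k powr (3/2))) * I k)" .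
    have T: "T k = M / (16 * sqrt pi * \<sigma> (r k) powr (3/2) * real k powr (3/2))"
      by (simp add: T_def M_def \<sigma>_def)
    have "M > 0" by (simp add: M_def)
    moreover have "pi = sqrt pi * sqrt pi" by simp
    ultimately show ?thesis unfolding N T using pos by (simp add: field_simps)
  qed
  then have "\<forall>\<^sub>F k in sequentially. real (num_triangulations (S k)) / T k = 4 / sqrt pi * I k"
    by (auto simp: eventually_sequentially)
  moreover have "(\<lambda>k. 4 / sqrt pi * I k) \<longlonglongrightarrow> 4 / sqrt pi * (sqrt pi / 4)"
    unfolding I_def by (intro tendsto_intros scaled_integral_limit assms(1))
  ultimately show "(\<lambda>k. real (num_triangulations (S k)) / ((2 ^ r k * (real (r k) + 1)) ^ k /
         (16 * sqrt pi * (real (r k) * (real (r k) + 5) / 6) powr (3/2) * real k powr (3/2)))) \<longlonglongrightarrow> 1"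
    by (simp add: tendsto_cong T_def)
qed

end
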